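(* Let $\mathfrak A$ be an AF$\ell$-algebra whose Elliott monoid is finitely generated, presented as $\mathfrak A=\mathfrak M_n/\mathfrak I$ for some $n\ge1$ and some ideal $\mathfrak I$ of $\mathfrak M_n$. Then for all $i,j\in\{1,2,3,4\}$, problem $\mathsf P_i$ for $\mathfrak A$ is polytime reducible to problem $\mathsf P_j$ for $\mathfrak A$. In particular, $\mathsf P_i$ for $\mathfrak A$ is decidable in polynomial time iff $\mathsf P_j$ for $\mathfrak A$ is.
   Context: AF-algebras are separable unital; ideals are closed two-sided. An AF$\ell$-algebra is an AF-algebra whose Murray–von Neumann order of equivalence classes $[p]$ of projections is a lattice, equivalently whose $K_0$ is a lattice-ordered group with strong unit $[1]$. Its Elliott monoid $E(\mathfrak A)$ is the set of classes of projections identified with $\{x\in K_0(\mathfrak A):0\le x\le[1]\}$, with $x\oplus y=(x+y)\wedge[1]$, $x^*=[1]-x$, $0$: an MV-algebra, whose order coincides with Murray–von Neumann order $\preceq$. In an MV-algebra: $1=0^*$, $x\odot y=(x^*\oplus y^* )^*$, $x\ominus y=x\odot y^*$, $\mathrm{dist}(x,y)=(x\ominus y)\oplus(y\ominus x)$. An MV-ideal is a subset containing 0, downward closed, closed under $\oplus$; quotient by $x\equiv y\iff\mathrm{dist}(x,y)\in\mathfrak j$; prime ideals are proper ideals with totally ordered quotient. For $n\ge1$, $\mathrm{Free}_n$ is the MV-algebra of continuous functions $[0,1]^n\to[0,1]$ that are piecewise linear with finitely many pieces each with integer coefficients, with pointwise $f\oplus g=\min(1,f+g)$, $f^*=1-f$;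 it is free on the coordinate functions $\pi_1,\dots,\pi_n$. $\mathfrak M_n$ is the AF$\ell$-algebra (unique up to isomorphism) with $E(\mathfrak M_n)=\mathrm{Free}_n$. Ideals $\mathfrak I$ of $\mathfrak M_n$ correspond bijectively to MV-ideals $\mathfrak i=K_0(\mathfrak I)\cap E(\mathfrak M_n)$, with $E(\mathfrak M_n/\mathfrak I)\cong\mathrm{Free}_n/\mathfrak i$. Every AF$\ell$-algebra with finitely generated Elliott monoid is isomorphic to some $\mathfrak M_n/\mathfrak I$. Terms: alphabet $\mathcal A=\{0,{}^*,\oplus,X_1,X_2,\dots,(,)\}$, $\mathcal A^*$ the finite strings. $\mathsf{TERM}_n$ is the least set of strings containing $0,X_1,\dots,X_n$ and closed under $\alpha\mapsto\alpha^*$, $(\alpha,\beta)\mapsto(\alpha\oplus\beta)$. For $\mathfrak A=\mathfrak M_n/\mathfrak I$, the interpretation $\phi^{\mathfrak A}\in E(\mathfrak A)=\mathrm{Free}_n/\mathfrak i$ is defined by $0^{\mathfrak A}=0$, $X_j^{\mathfrak A}=\pi_j/\mathfrak i$, $(\psi^* )^{\mathfrak A}=(\psi^{\mathfrak A})^*$, $(\alpha\oplus\beta)^{\mathfrak A}=\alpha^{\mathfrak A}\oplus\beta^{\mathfrak A}$. Problems for $\mathfrak A$ (subsets of $\mathcal A^*$, pairs of terms encoded as strings): $\mathsf P_1=\{(\phi,\psi)\in\mathsf{TERM}_n^2:\phi^{\mathfrak A}=\psi^{\mathfrak A}\}$ (word problem); $\mathsf P_2=\{(\phi,\psi)\in\mathsf{TERM}_n^2:\phi^{\mathfrak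 A}\preceq\psi^{\mathfrak A}\}$ (order problem); $\mathsf P_3=\{(\phi,\psi)\in\mathsf{TERM}_n^2:\phi^{\mathfrak A}\sqsubseteq\psi^{\mathfrak A}\}$ (eccentricity problem), where $x\sqsubseteq y$ iff for every prime ideal $\mathfrak p$ of $E(\mathfrak A)$, ($y/\mathfrak p<y^*/\mathfrak p\Rightarrow x/\mathfrak p\le y/\mathfrak p$) and ($y/\mathfrak p>y^*/\mathfrak p\Rightarrow x/\mathfrak p\ge y/\mathfrak p$); $\mathsf P_4=\{\phi\in\mathsf{TERM}_n:\phi^{\mathfrak A}=0\}$ (zero problem). $\|\sigma\|$ is the number of symbol occurrences in $\sigma$. A problem is decidable in polytime if a Turing machine decides membership of each $\sigma$ within $q(\|\sigma\|)$ steps for a polynomial $q$. A reduction of $\mathsf P'$ to $\mathsf P''$ is a map $\rho:\mathcal A^*\to\mathcal A^*$ with $\sigma\in\mathsf P'\iff\rho(\sigma)\in\mathsf P''$; it is polytime if computable in polynomial time. *)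

theory Defs
  imports
    "HOL-Analysis.Analysis"
    "HOL-Computational_Algebra.Polynomial"
    "Jordan_Normal_Form.Matrix"
begin

section \<open>Unital C*-algebras and AF-algebras\<close>

text \<open>
  Unlike \<^class>\<open>real_normed_algebra_1\<close>, this class admits the zero algebra (with \<open>1 = 0\<close>), which is
  the quotient of an algebra by itself.
\<close>

class cstar_algebra = banach + real_normed_algebra + monoid_mult +
  fixes scaleC :: "complex \<Rightarrow> 'a \<Rightarrow> 'a"  (infixr \<open>*\<^sub>C\<close> 75)
    and star :: "'a \<Rightarrow> 'a"
  assumes scaleC_add_right: "a *\<^sub>C (x + y) = a *\<^sub>C x + a *\<^sub>C y"
    and scaleC_add_left: "(a + b) *\<^sub>C x = a *\<^sub>C x + b *\<^sub>C x"
    and scaleC_scaleC: "a *\<^sub>C b *\<^sub>C x = (a * b) *\<^sub>C x"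
    and scaleC_of_real: "complex_of_real r *\<^sub>C x = r *\<^sub>R x"
    and mult_scaleC_left: "(a *\<^sub>C x) * y = a *\<^sub>C (x * y)"
    and mult_scaleC_right: "x * (a *\<^sub>C y) = a *\<^sub>C (x * y)"
    and norm_scaleC: "norm (a *\<^sub>C x) = cmod a * norm x"
    and star_add: "star (x + y) = star x + star y"
    and star_scaleC: "star (a *\<^sub>C x) = cnj a *\<^sub>C star x"
    and star_mult: "star (x * y) = star y * star x"
    and star_star [simp]: "star (star x) = x"
    and cstar_identity: "norm (star x * x) = (norm x)\<^sup>2"

definition unital_star_subalgebra :: "'a::cstar_algebra set \<Rightarrow> bool" where
  "unital_star_subalgebra B \<longleftrightarrow> 1 \<in> B \<and>
     (\<forall>x\<in>B. \<forall>y\<in>B. x + y \<in> B \<and> x * y \<in> B) \<and> (\<forall>x\<in>B. star x \<in> B \<and> (\<forall>c. c *\<^sub>C x \<in> B))"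

text \<open>
  Finite dimension is expressed by the real span, which for complex subspaces is equivalent to
  finite complex dimension. Separability is a consequence.
\<close>

definition af_algebra :: "'a::cstar_algebra itself \<Rightarrow> bool" where
  "af_algebra _ \<longleftrightarrow> (\<exists>B :: nat \<Rightarrow> 'a set.
     (\<forall>k. unital_star_subalgebra (B k) \<and> (\<exists>S. finite S \<and> B k \<subseteq> span S) \<and> B k \<subseteq> B (Suc k)) \<and>
     closure (\<Union>k. B k) = UNIV)"

definition closed_ideal :: "'a::cstar_algebra set \<Rightarrow> bool" where
  "closed_ideal I \<longleftrightarrow> closed I \<and> 0 \<in> I \<and> (\<forall>x\<in>I. \<forall>y\<in>I. x + y \<in> I) \<and>
     (\<forall>x\<in>I. \<forall>a. a * x \<in> I \<and> x * a \<in> I)"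

definition star_hom :: "('a::cstar_algebra \<Rightarrow> 'b::cstar_algebra) \<Rightarrow> bool" where
  "star_hom h \<longleftrightarrow> (\<forall>x y. h (x + y) = h x + h y \<and> h (x * y) = h x * h y) \<and>
     (\<forall>c x. h (c *\<^sub>C x) = c *\<^sub>C h x) \<and> (\<forall>x. h (star x) = star (h x)) \<and> h 1 = 1"

text \<open>
  A presentation of \<open>'b\<close> as the quotient of \<open>'a\<close> by the ideal \<open>I\<close>, given by its quotient map.
  A surjective *-homomorphism of C*-algebras with kernel \<open>I\<close> induces an (automatically isometric)
  isomorphism from the quotient C*-algebra onto its codomain.
\<close>

definition quotient_map_by :: "('a::cstar_algebra \<Rightarrow> 'b::cstar_algebra) \<Rightarrow> 'a set \<Rightarrow> bool" where
  "quotient_map_by h I \<longleftrightarrow> star_hom h \<and> surj h \<and> {x. h x = 0} = I"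


section \<open>Murray--von Neumann equivalence of projections in matrices\<close>

lemma star_zero [simp]: "star (0::'a::cstar_algebra) = 0"
  using star_add[of 0 "0::'a"] by simp

lemma star_one [simp]: "star (1::'a::cstar_algebra) = 1"
  using star_mult[of "star 1" "1::'a"] by simp

lemma star_sum: "star (sum f S) = (\<Sum>i\<in>S. star (f i :: 'a::cstar_algebra))"
  by (induction S rule: infinite_finite_induct) (auto simp: star_add)

definition adj :: "'a::cstar_algebra mat \<Rightarrow> 'a mat" where
  "adj A = map_mat star (transpose_mat A)"

definition projection_mat :: "'a::cstar_algebra mat \<Rightarrow> bool" where
  "projection_mat p \<longleftrightarrow> (\<exists>k. p \<in> carrier_mat k k) \<and> p * p = p \<and> adj p = p"

definition mvn_equiv :: "'a::cstar_algebra mat \<Rightarrow> 'a mat \<Rightarrow> bool" where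
  "mvn_equiv p q \<longleftrightarrow> projection_mat p \<and> projection_mat q \<and>
     (\<exists>v \<in> carrier_mat (dim_row q) (dim_row p). adj v * v = p \<and> v * adj v = q)"

definition block_sum :: "'a::cstar_algebra mat \<Rightarrow> 'a mat \<Rightarrow> 'a mat" where
  "block_sum p q = four_block_mat p (0\<^sub>m (dim_row p) (dim_col q)) (0\<^sub>m (dim_row q) (dim_col p)) q"

lemma adj_carrier: "A \<in> carrier_mat m n \<Longrightarrow> adj A \<in> carrier_mat n m"
  by (auto simp: adj_def)

lemma adj_adj [simp]: "adj (adj A) = A"
  by (rule eq_matI) (auto simp: adj_def)

lemma adj_zero [simp]: "adj (0\<^sub>m m n) = 0\<^sub>m n m"
  by (rule eq_matI) (auto simp: adj_def)

lemma adj_mult: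
  assumes "A \<in> carrier_mat l m" "B \<in> carrier_mat m n"
  shows "adj (A * B) = adj B * adj A"
  using assms
  by (intro eq_matI) (auto simp: adj_def scalar_prod_def star_sum star_mult intro!: sum.cong)

lemma adj_four_block:
  assumes "A \<in> carrier_mat m k" "B \<in> carrier_mat m l" "C \<in> carrier_mat n k" "D \<in> carrier_mat n l"
  shows "adj (four_block_mat A B C D) = four_block_mat (adj A) (adj C) (adj B) (adj D)"
  unfolding adj_def transpose_four_block_mat[OF assms]
  using assms by (intro map_four_block_mat) auto

lemma projection_matD:
  assumes "projection_mat p"
  shows "p \<in> carrier_mat (dim_row p) (dim_row p)" "p * p = p" "adj p = p"
  using assms by (auto simp: projection_mat_def)

lemma mvn_equivI:
  assumes "projection_mat p" "projection_mat q" "v \<in> carrier_mat m k"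
    "p \<in> carrier_mat k k" "q \<in> carrier_mat m m" "adj v * v = p" "v * adj v = q"
  shows "mvn_equiv p q"
proof -
  have "v \<in> carrier_mat (dim_row q) (dim_row p)" using assms(3-5) by simp
  then show ?thesis using assms(1,2,6,7) unfolding mvn_equiv_def by blast
qed

lemma mvn_equivD: "mvn_equiv p q \<Longrightarrow> projection_mat p"
  by (simp add: mvn_equiv_def)

lemma mvn_equivE:
  assumes "mvn_equiv p q"
  obtains v k m where "projection_mat p" "projection_mat q" "v \<in> carrier_mat m k"
    "p \<in> carrier_mat k k" "q \<in> carrier_mat m m" "adj v * v = p" "v * adj v = q"
  using assms projection_matD(1)[of p] projection_matD(1)[of q] unfolding mvn_equiv_def by metis

lemma mvn_refl: "projection_mat p \<Longrightarrow> mvn_equiv p p"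
  by (rule mvn_equivI[OF _ _ projection_matD(1) projection_matD(1) projection_matD(1)])
    (simp_all only: projection_matD)

lemma mvn_sym:
  assumes "mvn_equiv p q"
  shows "mvn_equiv q p"
proof -
  obtain v k m where v: "projection_mat p" "projection_mat q" "v \<in> carrier_mat m k"
    "p \<in> carrier_mat k k" "q \<in> carrier_mat m m" "adj v * v = p" "v * adj v = q"
    using assms by (rule mvn_equivE)
  show ?thesis
    by (rule mvn_equivI[OF v(2,1) adj_carrier[OF v(3)] v(5,4)]) (simp_all only: adj_adj v(6,7))
qed

lemma mvn_trans:
  assumes "mvn_equiv p q" "mvn_equiv q r"
  shows "mvn_equiv p r"
proof -
  obtain v k m where v: "projection_mat p" "projection_mat q" "v \<in> carrier_mat m k"
    "p \<in> carrier_mat k k" "q \<in> carrier_mat m m" "adj v * v = p" "v * adj v = q"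
    using assms(1) by (rule mvn_equivE)
  obtain w m' n where w': "projection_mat r" "w \<in> carrier_mat n m'"
    "q \<in> carrier_mat m' m'" "r \<in> carrier_mat n n" "adj w * w = q" "w * adj w = r"
    using assms(2) by (rule mvn_equivE)
  have "m' = m" using w' v by auto
  note w = w'[unfolded this]
  note av = adj_carrier[OF v(3)] and aw = adj_carrier[OF w(2)]
  have "adj (w * v) * (w * v) = adj v * (adj w * (w * v))"
    unfolding adj_mult[OF w(2) v(3)] using av aw w(2) v(3) by (intro assoc_mult_mat) auto
  also have "adj w * (w * v) = q * v"
    using assoc_mult_mat[OF aw w(2) v(3)] w(5) by simp
  also have "q * v = v * p"
    using assoc_mult_mat[OF v(3) av v(3)] v(6,7) by simp
  also have "adj v * (v * p) = p * p"
    using assoc_mult_mat[OF av v(3) v(4)] v(6) by simp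
  also have "\<dots> = p" using v(1) by (rule projection_matD)
  finally have 1: "adj (w * v) * (w * v) = p" .
  have "(w * v) * adj (w * v) = w * (v * (adj v * adj w))"
    unfolding adj_mult[OF w(2) v(3)] using av aw w(2) v(3) by (intro assoc_mult_mat) auto
  also have "v * (adj v * adj w) = q * adj w"
    using assoc_mult_mat[OF v(3) av aw] v(7) by simp
  also have "q * adj w = adj w * r"
    using assoc_mult_mat[OF aw w(2) aw] w(5,6) by simp
  also have "w * (adj w * r) = r * r"
    using assoc_mult_mat[OF w(2) aw w(4)] w(6) by simp
  also have "\<dots> = r" using w(1) by (rule projection_matD)
  finally have 2: "(w * v) * adj (w * v) = r" .
  show ?thesis
    by (rule mvn_equivI[OF v(1) w(1) mult_carrier_mat[OF w(2) v(3)] v(4) w(4) 1 2])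
qed

lemma projection_block_sum:
  assumes "projection_mat p" "projection_mat q"
  shows "projection_mat (block_sum p q)"
proof -
  obtain k l where p: "p \<in> carrier_mat k k" and q: "q \<in> carrier_mat l l"
    using projection_matD(1)[OF assms(1)] projection_matD(1)[OF assms(2)] by blast
  have "block_sum p q * block_sum p q = block_sum p q"
    using p q projection_matD(2)[OF assms(1)] projection_matD(2)[OF assms(2)]
    by (simp add: block_sum_def mult_four_block_mat[OF p _ _ q p _ _ q])
  moreover have "adj (block_sum p q) = block_sum p q"
    using p q projection_matD(3)[OF assms(1)] projection_matD(3)[OF assms(2)]
    by (simp add: block_sum_def adj_four_block[OF p _ _ q])
  moreover have "block_sum p q \<in> carrier_mat (k + l) (k + l)"
    using p q by (simp add: block_sum_def)
  ultimately show ?thesis unfolding projection_mat_def by blast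
qed

lemma mvn_block_sum_cong:
  assumes "mvn_equiv p p'" "mvn_equiv q q'"
  shows "mvn_equiv (block_sum p q) (block_sum p' q')"
proof -
  obtain v k m where v: "projection_mat p" "projection_mat p'" "v \<in> carrier_mat m k"
    "p \<in> carrier_mat k k" "p' \<in> carrier_mat m m" "adj v * v = p" "v * adj v = p'"
    using assms(1) by (rule mvn_equivE)
  obtain w l n where w: "projection_mat q" "projection_mat q'" "w \<in> carrier_mat n l"
    "q \<in> carrier_mat l l" "q' \<in> carrier_mat n n" "adj w * w = q" "w * adj w = q'"
    using assms(2) by (rule mvn_equivE)
  note av = adj_carrier[OF v(3)] and aw = adj_carrier[OF w(3)]
  let ?u = "four_block_mat v (0\<^sub>m m l) (0\<^sub>m n k) w"
  have au: "adj ?u = four_block_mat (adj v) (0\<^sub>m k n) (0\<^sub>m l m) (adj w)"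
    using adj_four_block[OF v(3) _ _ w(3)] by simp
  show ?thesis
  proof (rule mvn_equivI[where v = ?u and k = "k + l" and m = "m + n"])
    show "adj ?u * ?u = block_sum p q"
      unfolding au using v w av aw
      by (simp add: block_sum_def mult_four_block_mat[OF av _ _ aw v(3) _ _ w(3)])
    show "?u * adj ?u = block_sum p' q'"
      unfolding au using v w av aw
      by (simp add: block_sum_def mult_four_block_mat[OF v(3) _ _ w(3) av _ _ aw])
    show "projection_mat (block_sum p q)" "projection_mat (block_sum p' q')"
      using v(1,2) w(1,2) by (simp_all only: projection_block_sum)
  qed (use v(3-5) w(3-5) in \<open>simp_all add: block_sum_def\<close>)
qed

lemma mvn_block_sum_commute:
  assumes "projection_mat p" "projection_mat q"
  shows "mvn_equiv (block_sum p q) (block_sum q p)"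
proof -
  obtain k l where p: "p \<in> carrier_mat k k" and q: "q \<in> carrier_mat l l"
    using projection_matD(1)[OF assms(1)] projection_matD(1)[OF assms(2)] by blast
  note P = projection_matD(2,3)[OF assms(1)] and Q = projection_matD(2,3)[OF assms(2)]
  let ?u = "four_block_mat (0\<^sub>m l k) q p (0\<^sub>m k l)"
  have z: "0\<^sub>m l k \<in> carrier_mat l k" "0\<^sub>m k l \<in> carrier_mat k l" by auto
  have au: "adj ?u = four_block_mat (0\<^sub>m k l) p q (0\<^sub>m l k)"
    using adj_four_block[OF z(1) q p z(2)] P Q by simp
  show ?thesis
  proof (rule mvn_equivI[where v = ?u and k = "k + l" and m = "l + k"])
    show "adj ?u * ?u = block_sum p q"
      unfolding au using p q P Q
      by (simp add: block_sum_def mult_four_block_mat[OF z(2) p q z(1) z(1) q p z(2)])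
    show "?u * adj ?u = block_sum q p"
      unfolding au using p q P Q
      by (simp add: block_sum_def mult_four_block_mat[OF z(1) q p z(2) z(2) p q z(1)])
    show "projection_mat (block_sum p q)" "projection_mat (block_sum q p)"
      using assms by (simp_all only: projection_block_sum)
  qed (use p q in \<open>simp_all add: block_sum_def\<close>)
qed

lemma block_sum_assoc: "block_sum (block_sum p q) r = block_sum p (block_sum q r)"
  unfolding block_sum_def by (rule assoc_four_block_mat[symmetric])

lemma projection_zero: "projection_mat (0\<^sub>m k k)"
  by (auto simp: projection_mat_def intro!: exI[of _ k])

lemma block_sum_zero: "projection_mat p \<Longrightarrow> block_sum (0\<^sub>m 0 0) p = p"
  by (rule eq_matI) (auto simp: block_sum_def projection_mat_def)

quotient_type (overloaded) 'a mvn_class =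
  "'a::cstar_algebra mat" / partial: mvn_equiv
  morphisms rep_mvn_class mvn_class
proof (rule part_equivpI)
  show "\<exists>p::'a mat. mvn_equiv p p" using projection_zero mvn_refl by blast
  show "symp (mvn_equiv :: 'a mat \<Rightarrow> _)" by (auto intro: sympI mvn_sym)
  show "transp (mvn_equiv :: 'a mat \<Rightarrow> _)" by (auto intro: transpI mvn_trans)
qed

instantiation mvn_class :: (cstar_algebra) comm_monoid_add
begin

lift_definition zero_mvn_class :: "'a mvn_class" is "0\<^sub>m 0 0"
  by (simp add: mvn_refl projection_zero)

lift_definition plus_mvn_class :: "'a mvn_class \<Rightarrow> 'a mvn_class \<Rightarrow> 'a mvn_class" is block_sum
  by (rule mvn_block_sum_cong)

instance
proof
  fix a b c :: "'a mvn_class"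
  show "a + b + c = a + (b + c)"
    by transfer (simp only: block_sum_assoc mvn_refl projection_block_sum mvn_equivD)
  show "a + b = b + a"
    by transfer (simp only: mvn_block_sum_commute mvn_equivD)
  show "0 + a = a"
    by transfer (simp only: block_sum_zero mvn_equivD)
qed

end

text \<open>The Murray--von Neumann order: \<open>p\<close> is equivalent to a subprojection of \<open>q\<close>.\<close>

definition mvn_le :: "'a::cstar_algebra mvn_class \<Rightarrow> 'a mvn_class \<Rightarrow> bool" where
  "mvn_le a b \<longleftrightarrow> (\<exists>p r q. projection_mat p \<and> projection_mat q \<and> mvn_equiv p r \<and>
     dim_row r = dim_row q \<and> r * q = r \<and> a = mvn_class p \<and> b = mvn_class q)"


section \<open>The ordered Grothendieck group\<close>

definition grothendieck ::
  "'a::cstar_algebra mvn_class \<times> 'a mvn_class \<Rightarrow> 'a mvn_class \<times> 'a mvn_class \<Rightarrow> bool" where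
  "grothendieck x y \<longleftrightarrow> (\<exists>c. fst x + snd y + c = fst y + snd x + c)"

quotient_type (overloaded) 'a K0 =
  "'a::cstar_algebra mvn_class \<times> 'a mvn_class" / grothendieck
proof (rule equivpI)
  show "reflp (grothendieck :: 'a mvn_class \<times> _ \<Rightarrow> _)"
    by (auto intro: reflpI simp: grothendieck_def)
  show "symp (grothendieck :: 'a mvn_class \<times> _ \<Rightarrow> _)"
    by (rule sympI) (auto simp: grothendieck_def intro: sym)
  show "transp (grothendieck :: 'a mvn_class \<times> _ \<Rightarrow> _)"
  proof (rule transpI)
    fix x y z :: "'a mvn_class \<times> 'a mvn_class"
    assume "grothendieck x y" "grothendieck y z"
    then obtain c d where c: "fst x + snd y + c = fst y + snd x + c"
      and d: "fst y + snd z + d = fst z + snd y + d"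
      by (auto simp: grothendieck_def)
    have "fst x + snd z + (fst y + snd y + c + d) = (fst x + snd y + c) + (fst y + snd z + d)"
      by (simp only: add_ac)
    also have "\<dots> = fst z + snd x + (fst y + snd y + c + d)"
      unfolding c d by (simp only: add_ac)
    finally show "grothendieck x z" unfolding grothendieck_def by blast
  qed
qed

instantiation K0 :: (cstar_algebra) ab_group_add
begin

definition zero_K0 :: "'a K0" where
  "zero_K0 = abs_K0 (0, 0)"

definition plus_K0 :: "'a K0 \<Rightarrow> 'a K0 \<Rightarrow> 'a K0" where
  "plus_K0 x y = abs_K0 (fst (rep_K0 x) + fst (rep_K0 y), snd (rep_K0 x) + snd (rep_K0 y))"

definition uminus_K0 :: "'a K0 \<Rightarrow> 'a K0" where
  "uminus_K0 x = abs_K0 (snd (rep_K0 x), fst (rep_K0 x))"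

definition minus_K0 :: "'a K0 \<Rightarrow> 'a K0 \<Rightarrow> 'a K0" where
  "minus_K0 x y = x + - y"

lemma abs_K0_surj:
  obtains a b where "(x :: 'a K0) = abs_K0 (a, b)"
proof -
  have "x = abs_K0 (fst (rep_K0 x), snd (rep_K0 x))"
    by (simp only: prod.collapse Quotient3_abs_rep[OF Quotient3_K0])
  then show thesis by (rule that)
qed

lemma abs_K0_eq:
  "abs_K0 (a, b) = abs_K0 (a', b') \<longleftrightarrow> (\<exists>c :: 'a mvn_class. a + b' + c = a' + b + c)"
  by (simp only: K0.abs_eq_iff grothendieck_def fst_conv snd_conv)

lemma rep_abs_K0:
  "\<exists>c :: 'a mvn_class. fst (rep_K0 (abs_K0 (a, b))) + b + c = a + snd (rep_K0 (abs_K0 (a, b))) + c"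
  unfolding abs_K0_eq[symmetric] prod.collapse by (rule Quotient3_abs_rep[OF Quotient3_K0])

lemma plus_abs_K0: "abs_K0 (a, b) + abs_K0 (a', b') = abs_K0 (a + a', b + (b' :: 'a mvn_class))"
proof -
  obtain x y x' y' where xy: "rep_K0 (abs_K0 (a, b)) = (x, y)"
    "rep_K0 (abs_K0 (a', b')) = (x', y')"
    by (cases "rep_K0 (abs_K0 (a, b))", cases "rep_K0 (abs_K0 (a', b'))") (rule that)
  obtain c d where c: "x + b + c = a + y + c" and d: "x' + b' + d = a' + y' + d"
    using rep_abs_K0[of a b] rep_abs_K0[of a' b'] unfolding xy fst_conv snd_conv by blast
  have "(x + x') + (b + b') + (c + d) = (x + b + c) + (x' + b' + d)" by (simp only: add_ac)
  also have "\<dots> = (a + a') + (y + y') + (c + d)" unfolding c d by (simp only: add_ac)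
  finally show ?thesis unfolding plus_K0_def xy fst_conv snd_conv abs_K0_eq by blast
qed

lemma uminus_abs_K0: "- abs_K0 (a, b) = abs_K0 (b, (a :: 'a mvn_class))"
proof -
  obtain x y where xy: "rep_K0 (abs_K0 (a, b)) = (x, y)"
    by (cases "rep_K0 (abs_K0 (a, b))") (rule that)
  obtain c where "x + b + c = a + y + c"
    using rep_abs_K0[of a b] unfolding xy fst_conv snd_conv by blast
  then have "y + a + c = b + x + c" by (simp only: add_ac)
  then show ?thesis unfolding uminus_K0_def xy fst_conv snd_conv abs_K0_eq by blast
qed

instance
proof
  fix x y z :: "'a K0"
  obtain a a' where x: "x = abs_K0 (a, a')" by (rule abs_K0_surj)
  obtain b b' where y: "y = abs_K0 (b, b')" by (rule abs_K0_surj)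
  obtain c c' where z: "z = abs_K0 (c, c')" by (rule abs_K0_surj)
  show "x + y + z = x + (y + z)" unfolding x y z plus_abs_K0 by (simp only: add_ac)
  show "x + y = y + x" unfolding x y plus_abs_K0 by (simp only: add_ac)
  show "0 + x = x" unfolding x zero_K0_def plus_abs_K0 by (simp only: add_0)
  show "- x + x = 0"
    unfolding x uminus_abs_K0 plus_abs_K0 zero_K0_def abs_K0_eq by (simp only: add_ac) simp
  show "x - y = x + - y" by (simp only: minus_K0_def)
qed

end

definition k0_of :: "'a::cstar_algebra mvn_class \<Rightarrow> 'a K0" where
  "k0_of a = abs_K0 (a, 0)"

definition k0_unit :: "'a::cstar_algebra K0" where
  "k0_unit = k0_of (mvn_class (1\<^sub>m 1))"

definition k0_le :: "'a::cstar_algebra K0 \<Rightarrow> 'a K0 \<Rightarrow> bool" where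
  "k0_le x y \<longleftrightarrow> y - x \<in> range k0_of"

definition k0_less :: "'a::cstar_algebra K0 \<Rightarrow> 'a K0 \<Rightarrow> bool" where
  "k0_less x y \<longleftrightarrow> k0_le x y \<and> \<not> k0_le y x"

definition k0_meet :: "'a::cstar_algebra K0 \<Rightarrow> 'a K0 \<Rightarrow> 'a K0" where
  "k0_meet x y = (THE z. k0_le z x \<and> k0_le z y \<and> (\<forall>w. k0_le w x \<and> k0_le w y \<longrightarrow> k0_le w z))"

text \<open>Translation invariance of the order is immediate from its definition.\<close>

definition afl_algebra :: "'a::cstar_algebra itself \<Rightarrow> bool" where
  "afl_algebra T \<longleftrightarrow> af_algebra T \<and>
     (\<exists>inf sup. class.lattice inf (k0_le :: 'a K0 \<Rightarrow> _) k0_less sup) \<and>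
     (\<forall>x :: 'a K0. \<exists>k::nat. k0_le x (\<Sum>i<k. k0_unit))"

text \<open>
  The order of Murray--von Neumann classes, transported to \<open>K0\<close>. Representing projections may lie
  in matrix algebras.
\<close>

definition k0_mvn_le :: "'a::cstar_algebra K0 \<Rightarrow> 'a K0 \<Rightarrow> bool" where
  "k0_mvn_le x y \<longleftrightarrow> (\<exists>a b. x = k0_of a \<and> y = k0_of b \<and> mvn_le a b)"

text \<open>
  The map induced on \<open>K0\<close> by a *-homomorphism. The descriptions below are meaningful (that is, the
  described element is unique) only for *-homomorphisms.
\<close>

definition mvn_map :: "('a::cstar_algebra \<Rightarrow> 'b::cstar_algebra) \<Rightarrow> 'a mvn_class \<Rightarrow> 'b mvn_class" where
  "mvn_map h a = (THE b. \<exists>p. projection_mat p \<and> a = mvn_class p \<and> b = mvn_class (map_mat h p))"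

definition k0_map :: "('a::cstar_algebra \<Rightarrow> 'b::cstar_algebra) \<Rightarrow> 'a K0 \<Rightarrow> 'b K0" where
  "k0_map h x = (THE y. \<exists>a b. x = k0_of a - k0_of b \<and> y = k0_of (mvn_map h a) - k0_of (mvn_map h b))"


section \<open>MV-algebras\<close>

record 'a mv =
  mvcarrier :: "'a set"
  mvzero :: 'a
  mvneg :: "'a \<Rightarrow> 'a"
  mvplus :: "'a \<Rightarrow> 'a \<Rightarrow> 'a"

definition mvtimes :: "'a mv \<Rightarrow> 'a \<Rightarrow> 'a \<Rightarrow> 'a" where
  "mvtimes A x y = mvneg A (mvplus A (mvneg A x) (mvneg A y))"

definition mvminus :: "'a mv \<Rightarrow> 'a \<Rightarrow> 'a \<Rightarrow> 'a" where
  "mvminus A x y = mvtimes A x (mvneg A y)"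

definition mvdist :: "'a mv \<Rightarrow> 'a \<Rightarrow> 'a \<Rightarrow> 'a" where
  "mvdist A x y = mvplus A (mvminus A x y) (mvminus A y x)"

definition mvle :: "'a mv \<Rightarrow> 'a \<Rightarrow> 'a \<Rightarrow> bool" where
  "mvle A x y \<longleftrightarrow> mvminus A x y = mvzero A"

definition mvless :: "'a mv \<Rightarrow> 'a \<Rightarrow> 'a \<Rightarrow> bool" where
  "mvless A x y \<longleftrightarrow> mvle A x y \<and> x \<noteq> y"

definition mv_ideal :: "'a mv \<Rightarrow> 'a set \<Rightarrow> bool" where
  "mv_ideal A J \<longleftrightarrow> J \<subseteq> mvcarrier A \<and> mvzero A \<in> J \<and>
     (\<forall>x\<in>J. \<forall>y\<in>mvcarrier A. mvle A y x \<longrightarrow> y \<in> J) \<and> (\<forall>x\<in>J. \<forall>y\<in>J. mvplus A x y \<in> J)"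

definition mvcoset :: "'a mv \<Rightarrow> 'a set \<Rightarrow> 'a \<Rightarrow> 'a set" where
  "mvcoset A J x = {y \<in> mvcarrier A. mvdist A x y \<in> J}"

definition mvquot :: "'a mv \<Rightarrow> 'a set \<Rightarrow> 'a set mv" where
  "mvquot A J = \<lparr>
     mvcarrier = mvcoset A J ` mvcarrier A,
     mvzero = mvcoset A J (mvzero A),
     mvneg = (\<lambda>C. \<Union>x\<in>C. mvcoset A J (mvneg A x)),
     mvplus = (\<lambda>C D. \<Union>x\<in>C. \<Union>y\<in>D. mvcoset A J (mvplus A x y)) \<rparr>"

definition mv_prime :: "'a mv \<Rightarrow> 'a set \<Rightarrow> bool" where
  "mv_prime A J \<longleftrightarrow> mv_ideal A J \<and> J \<noteq> mvcarrier A \<and>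
     (\<forall>C\<in>mvcarrier (mvquot A J). \<forall>D\<in>mvcarrier (mvquot A J).
        mvle (mvquot A J) C D \<or> mvle (mvquot A J) D C)"

definition eccentric_le :: "'a mv \<Rightarrow> 'a \<Rightarrow> 'a \<Rightarrow> bool" where
  "eccentric_le A x y \<longleftrightarrow> (\<forall>J. mv_prime A J \<longrightarrow>
     (let Q = mvquot A J; x' = mvcoset A J x; y' = mvcoset A J y; ny' = mvcoset A J (mvneg A y)
      in (mvless Q y' ny' \<longrightarrow> mvle Q x' y') \<and> (mvless Q ny' y' \<longrightarrow> mvle Q y' x')))"

definition mv_iso :: "'a mv \<Rightarrow> 'b mv \<Rightarrow> ('a \<Rightarrow> 'b) \<Rightarrow> bool" where
  "mv_iso A B f \<longleftrightarrow> bij_betw f (mvcarrier A) (mvcarrier B) \<and> f (mvzero A) = mvzero B \<and>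
     (\<forall>x\<in>mvcarrier A. f (mvneg A x) = mvneg B (f x)) \<and>
     (\<forall>x\<in>mvcarrier A. \<forall>y\<in>mvcarrier A. f (mvplus A x y) = mvplus B (f x) (f y))"

inductive_set mv_generated :: "'a mv \<Rightarrow> 'a set \<Rightarrow> 'a set" for A S where
  gen: "x \<in> S \<Longrightarrow> x \<in> mv_generated A S"
| zero: "mvzero A \<in> mv_generated A S"
| neg: "x \<in> mv_generated A S \<Longrightarrow> mvneg A x \<in> mv_generated A S"
| plus: "x \<in> mv_generated A S \<Longrightarrow> y \<in> mv_generated A S \<Longrightarrow> mvplus A x y \<in> mv_generated A S"

definition mv_finitely_generated :: "'a mv \<Rightarrow> bool" where
  "mv_finitely_generated A \<longleftrightarrow>
     (\<exists>S. finite S \<and> S \<subseteq> mvcarrier A \<and> mv_generated A S = mvcarrier A)"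

text \<open>The Elliott monoid, as the unit interval of \<open>K0\<close>.\<close>

definition elliott :: "'a::cstar_algebra K0 mv" where
  "elliott = \<lparr>
     mvcarrier = {x. k0_le 0 x \<and> k0_le x k0_unit},
     mvzero = 0,
     mvneg = (\<lambda>x. k0_unit - x),
     mvplus = (\<lambda>x y. k0_meet (x + y) k0_unit) \<rparr>"

text \<open>
  Points of the cube are extensional functions on \<open>{..<n}\<close>; with the product topology of
  \<open>nat \<Rightarrow> real\<close> this is the usual cube. Coordinates are numbered from 0.
\<close>

definition cube :: "nat \<Rightarrow> (nat \<Rightarrow> real) set" where
  "cube n = ({..<n} \<rightarrow>\<^sub>E {0..1})"

definition mcnaughton :: "nat \<Rightarrow> ((nat \<Rightarrow> real) \<Rightarrow> real) set" where
  "mcnaughton n = {f \<in> cube n \<rightarrow>\<^sub>E {0..1}. continuous_on (cube n) f \<and>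
     (\<exists>L :: ((nat \<Rightarrow> int) \<times> int) set. finite L \<and>
        (\<forall>x\<in>cube n. \<exists>(a, b)\<in>L. f x = real_of_int b + (\<Sum>i<n. real_of_int (a i) * x i)))}"

definition Free :: "nat \<Rightarrow> ((nat \<Rightarrow> real) \<Rightarrow> real) mv" where
  "Free n = \<lparr>
     mvcarrier = mcnaughton n,
     mvzero = restrict (\<lambda>x. 0) (cube n),
     mvneg = (\<lambda>f. restrict (\<lambda>x. 1 - f x) (cube n)),
     mvplus = (\<lambda>f g. restrict (\<lambda>x. min 1 (f x + g x)) (cube n)) \<rparr>"

definition coord :: "nat \<Rightarrow> nat \<Rightarrow> (nat \<Rightarrow> real) \<Rightarrow> real" where
  "coord n j = restrict (\<lambda>x. x j) (cube n)"


section \<open>Terms and their interpretation\<close>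

text \<open>\<open>Var j\<close> is the symbol $X_{j+1}$.\<close>

datatype sym = Zero | Star | Oplus | Var nat | LPar | RPar

inductive_set term_strings :: "nat \<Rightarrow> sym list set" for n where
  "[Zero] \<in> term_strings n"
| "j < n \<Longrightarrow> [Var j] \<in> term_strings n"
| "\<alpha> \<in> term_strings n \<Longrightarrow> \<alpha> @ [Star] \<in> term_strings n"
| "\<alpha> \<in> term_strings n \<Longrightarrow> \<beta> \<in> term_strings n \<Longrightarrow> LPar # \<alpha> @ Oplus # \<beta> @ [RPar] \<in> term_strings n"

text \<open>
  The graph of the interpretation of terms, given the values \<open>g\<close> of the variables. By unique
  readability it is the graph of a function.
\<close>

inductive interprets :: "'a mv \<Rightarrow> (nat \<Rightarrow> 'a) \<Rightarrow> sym list \<Rightarrow> 'a \<Rightarrow> bool" for A g where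
  "interprets A g [Zero] (mvzero A)"
| "interprets A g [Var j] (g j)"
| "interprets A g \<alpha> x \<Longrightarrow> interprets A g (\<alpha> @ [Star]) (mvneg A x)"
| "interprets A g \<alpha> x \<Longrightarrow> interprets A g \<beta> y \<Longrightarrow>
     interprets A g (LPar # \<alpha> @ Oplus # \<beta> @ [RPar]) (mvplus A x y)"

definition interp :: "'a mv \<Rightarrow> (nat \<Rightarrow> 'a) \<Rightarrow> sym list \<Rightarrow> 'a" where
  "interp A g \<phi> = (THE x. interprets A g \<phi> x)"

text \<open>
  Let \<open>e\<close> be an isomorphism from the Elliott monoid of \<open>'a\<close> onto \<open>Free n\<close>, and \<open>h\<close> the quotient map
  of \<open>'a\<close> onto \<open>'b\<close>. Under the identification of the Elliott monoid of \<open>'b\<close> with a quotient of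
  \<open>Free n\<close>, the class of \<open>f\<close> corresponds to the image under \<open>K0(h)\<close> of the element that \<open>e\<close>
  sends to \<open>f\<close>.
\<close>

definition generator :: "nat \<Rightarrow> ('a::cstar_algebra K0 \<Rightarrow> (nat \<Rightarrow> real) \<Rightarrow> real) \<Rightarrow>
    ('a \<Rightarrow> 'b::cstar_algebra) \<Rightarrow> nat \<Rightarrow> 'b K0" where
  "generator n e h j = k0_map h (inv_into (mvcarrier elliott) e (coord n j))"

text \<open>
  Pairs of strings are encoded as \<open>(\<phi>)(\<psi>)\<close>; this is injective on pairs of terms since \<open>)(\<close> is not
  a substring of a term.
\<close>

definition pair_code :: "sym list \<Rightarrow> sym list \<Rightarrow> sym list" where
  "pair_code \<phi> \<psi> = LPar # \<phi> @ [RPar, LPar] @ \<psi> @ [RPar]"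

definition word_problem :: "nat \<Rightarrow> (nat \<Rightarrow> 'b::cstar_algebra K0) \<Rightarrow> sym list set" where
  "word_problem n g = {pair_code \<phi> \<psi> | \<phi> \<psi>. \<phi> \<in> term_strings n \<and> \<psi> \<in> term_strings n \<and>
     interp elliott g \<phi> = interp elliott g \<psi>}"

definition order_problem :: "nat \<Rightarrow> (nat \<Rightarrow> 'b::cstar_algebra K0) \<Rightarrow> sym list set" where
  "order_problem n g = {pair_code \<phi> \<psi> | \<phi> \<psi>. \<phi> \<in> term_strings n \<and> \<psi> \<in> term_strings n \<and>
     k0_mvn_le (interp elliott g \<phi>) (interp elliott g \<psi>)}"

definition eccentricity_problem :: "nat \<Rightarrow> (nat \<Rightarrow> 'b::cstar_algebra K0) \<Rightarrow> sym list set" where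
  "eccentricity_problem n g = {pair_code \<phi> \<psi> | \<phi> \<psi>. \<phi> \<in> term_strings n \<and> \<psi> \<in> term_strings n \<and>
     eccentric_le elliott (interp elliott g \<phi>) (interp elliott g \<psi>)}"

definition zero_problem :: "nat \<Rightarrow> (nat \<Rightarrow> 'b::cstar_algebra K0) \<Rightarrow> sym list set" where
  "zero_problem n g = {\<phi> \<in> term_strings n. interp elliott g \<phi> = 0}"

definition problem :: "nat \<Rightarrow> nat \<Rightarrow> (nat \<Rightarrow> 'b::cstar_algebra K0) \<Rightarrow> sym list set" where
  "problem i n g =
     (if i = 1 then word_problem n g
      else if i = 2 then order_problem n g
      else if i = 3 then eccentricity_problem n g
      else zero_problem n g)"


section \<open>Polynomial-time Turing machines\<close>

text \<open>
  Deterministic machines with \<open>ntapes\<close> two-way infinite tapes, states \<open>{..<nstates}\<close> and tape alphabet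
  \<open>{..<nsyms}\<close>. The blank is 0, the initial state is 0, and the accepting and rejecting
  halting states are 1 and 2. Symbols, writes and moves are indexed by tapes; the transition function
  receives 0 for nonexistent tapes, and what it returns for them is ignored.
\<close>

record tm =
  ntapes :: nat
  nstates :: nat
  nsyms :: nat
  delta :: "nat \<Rightarrow> (nat \<Rightarrow> nat) \<Rightarrow> nat \<times> (nat \<Rightarrow> nat) \<times> (nat \<Rightarrow> int)"

record config =
  cstate :: nat
  chead :: "nat \<Rightarrow> int"
  ctape :: "nat \<Rightarrow> int \<Rightarrow> nat"

text \<open>Tape symbols 1 to 7 are reserved for the encoding of strings.\<close>

definition wf_tm :: "tm \<Rightarrow> bool" where
  "wf_tm M \<longleftrightarrow> 1 \<le> ntapes M \<and> 3 \<le> nstates M \<and> 8 \<le> nsyms M \<and>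
     (\<forall>q<nstates M. \<forall>r. (\<forall>i. r i < nsyms M) \<longrightarrow>
        (case delta M q r of (q', w, m) \<Rightarrow>
           q' < nstates M \<and> (\<forall>i<ntapes M. w i < nsyms M \<and> m i \<in> {-1, 0, 1})))"

definition tm_step :: "tm \<Rightarrow> config \<Rightarrow> config" where
  "tm_step M c =
     (if cstate c \<in> {1, 2} then c
      else case delta M (cstate c) (\<lambda>i. if i < ntapes M then ctape c i (chead c i) else 0) of
        (q, w, m) \<Rightarrow>
          \<lparr> cstate = q,
            chead = (\<lambda>i. if i < ntapes M then chead c i + m i else chead c i),
            ctape = (\<lambda>i. if i < ntapes M then (ctape c i)(chead c i := w i) else ctape c i) \<rparr>)"

text \<open>
  The alphabet of terms is infinite, so on a tape $X_j$ is written as a letter followed by \<open>j\<close>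
  strokes. Running times are nevertheless measured against the number of symbol occurrences.
\<close>

fun sym_code :: "sym \<Rightarrow> nat list" where
  "sym_code Zero = [1]"
| "sym_code Star = [2]"
| "sym_code Oplus = [3]"
| "sym_code LPar = [4]"
| "sym_code RPar = [5]"
| "sym_code (Var j) = 6 # replicate (Suc j) 7"

definition string_tape :: "sym list \<Rightarrow> int \<Rightarrow> nat" where
  "string_tape \<sigma> z = (let w = concat (map sym_code \<sigma>) in
     if 0 \<le> z \<and> nat z < length w then w ! nat z else 0)"

definition tm_init :: "sym list \<Rightarrow> config" where
  "tm_init \<sigma> = \<lparr> cstate = 0, chead = (\<lambda>_. 0),
     ctape = (\<lambda>i. if i = 0 then string_tape \<sigma> else (\<lambda>_. 0)) \<rparr>"

definition polytime_decidable :: "sym list set \<Rightarrow> bool" where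
  "polytime_decidable P \<longleftrightarrow> (\<exists>M (q :: nat poly). wf_tm M \<and>
     (\<forall>\<sigma>. \<exists>t \<le> poly q (length \<sigma>).
        cstate ((tm_step M ^^ t) (tm_init \<sigma>)) = (if \<sigma> \<in> P then 1 else 2)))"

text \<open>The result is left alone on tape 1, with the head at its beginning.\<close>

definition polytime_computable :: "(sym list \<Rightarrow> sym list) \<Rightarrow> bool" where
  "polytime_computable \<rho> \<longleftrightarrow> (\<exists>M (q :: nat poly). wf_tm M \<and> 2 \<le> ntapes M \<and>
     (\<forall>\<sigma>. \<exists>t \<le> poly q (length \<sigma>).
        let c = (tm_step M ^^ t) (tm_init \<sigma>)
        in cstate c = 1 \<and> ctape c 1 = string_tape (\<rho> \<sigma>) \<and> chead c 1 = 0))"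

definition polytime_reducible :: "sym list set \<Rightarrow> sym list set \<Rightarrow> bool" where
  "polytime_reducible P' P'' \<longleftrightarrow>
     (\<exists>\<rho>. (\<forall>\<sigma>. \<sigma> \<in> P' \<longleftrightarrow> \<rho> \<sigma> \<in> P'') \<and> polytime_computable \<rho>)"

end

theory Submission
  imports Defs "HOL-Library.Stream" "HOL-Library.Lattice_Algebras"
begin

text \<open>
  In a lattice-ordered group with strong unit, each of the relations \<open>x = y\<close>, \<open>x \<le> y\<close> and
  \<open>x \<sqsubseteq> y\<close> between elements of the unit interval holds iff a fixed MV-polynomial in \<open>x\<close> and \<open>y\<close>
  vanishes: the distance, the difference \<open>x \<ominus> y\<close>, and
  \<open>((y\<^sup>* \<ominus> y) \<and> (x \<ominus> y)) \<oplus> ((y \<ominus> y\<^sup>*) \<and> (y \<ominus> x))\<close>, the last because a nonzero element is omitted by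
  some prime ideal. Conversely \<open>x = 0\<close> iff the relation holds between \<open>x\<close> and \<open>0\<close>. Hence every
  problem reduces to every other one by substituting the given terms into a fixed template. A Turing
  machine does this in linear time, after checking with a stack that its input is well-formed; it
  stops reading as soon as the index of a variable is too large, so that the length of the code of
  variables is harmless.
\<close>

text \<open>Two kinds of machines occur. The reductions are assembled from small parts with a fixed
  layout of five tapes, whose runs are computed symbolically. The deciders in the final equivalence
  are arbitrary, so composing one with a reduction means relocating its tapes, enlarging its
  alphabet, and bounding the length of the intermediate string by the time spent on writing it. A
  reduction must also answer on every string: ill-formed inputs are sent to the empty string, which
  belongs to none of the four problems, and this is why a rejecting reader makes the composed
  machine accept. On the algebraic side, eccentricity quantifies over prime ideals. For elements
  \<open>p\<close>, \<open>q\<close> of the unit interval, every prime ideal contains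
  \<open>p\<close> or \<open>q\<close> iff \<open>inf p q = 0\<close>; and in a totally ordered
  quotient, \<open>y\<close> lies strictly below its complement iff the positive part of
  \<open>u - y - y\<close> is outside the ideal. This is the origin of the two meets in the third
  polynomial. The lattice operations on K0 are only known to exist, so the algebra is carried out in
  the locale \<open>lattice_ab_group_add\<close> and specialised by interpretation.\<close>

section \<open>Composition of Turing machines\<close>

text \<open>Unlike \<^const>\<open>wf_tm\<close>, this constrains the transitions out of nonexistent states as well.\<close>

definition total_tm :: "tm \<Rightarrow> bool" where
  "total_tm M \<longleftrightarrow> 1 \<le> ntapes M \<and> 3 \<le> nstates M \<and> 8 \<le> nsyms M \<and>
     (\<forall>q r. (\<forall>i. r i < nsyms M) \<longrightarrow>
        (case delta M q r of (q', w, m) \<Rightarrow>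
           q' < nstates M \<and> (\<forall>i<ntapes M. w i < nsyms M \<and> m i \<in> {-1, 0, 1})))"

lemma total_tm_wf: "total_tm M \<Longrightarrow> wf_tm M"
  unfolding total_tm_def wf_tm_def by simp

text \<open>The step count is an upper bound, so that estimates can be added and weakened without
  knowing exact running times.\<close>

definition run :: "tm \<Rightarrow> nat \<Rightarrow> config \<Rightarrow> config \<Rightarrow> bool" where
  "run M t c c' \<longleftrightarrow> (\<exists>t'\<le>t. (tm_step M ^^ t') c = c')"

lemma run_refl: "run M t c c"
  unfolding run_def by (intro exI[of _ 0]) simp

lemma run_step: "run M (Suc 0) c (tm_step M c)"
  unfolding run_def by (intro exI[of _ 1]) simp

lemma run_trans:
  assumes "run M s c c'" "run M t c' c''"
  shows "run M (s + t) c c''"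
proof -
  obtain s' t' where "s' \<le> s" "(tm_step M ^^ s') c = c'" "t' \<le> t" "(tm_step M ^^ t') c' = c''"
    using assms unfolding run_def by blast
  then have "(tm_step M ^^ (t' + s')) c = c''" "t' + s' \<le> s + t"
    by (simp_all add: funpow_add)
  then show ?thesis unfolding run_def by blast
qed

lemma run_mono: "run M s c c' \<Longrightarrow> s \<le> t \<Longrightarrow> run M t c c'"
  unfolding run_def using le_trans by blast

lemma run_Suc: "run M t (tm_step M c) c' \<Longrightarrow> run M (Suc t) c c'"
  using run_trans[OF run_step] by simp

lemma tm_step_halted: "cstate c \<in> {1, 2} \<Longrightarrow> (tm_step M ^^ t) c = c"
  by (induction t) (auto simp: tm_step_def)

text \<open>
  If the first machine rejects, then the composition accepts at once. State 3 is the start of the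
  second machine; the other running states of the first machine become even, those of the second odd.
\<close>

definition seq_left :: "nat \<Rightarrow> nat" where
  "seq_left q = (if q = 0 then 0 else if q = 1 then 3 else if q = 2 then 1 else 2 * q)"

definition seq_right :: "nat \<Rightarrow> nat" where
  "seq_right q = (if q = 0 then 3 else if q \<le> 2 then q else 2 * q + 1)"

text \<open>Code 3 is free for the start of \<open>N\<close>, since \<open>2 * q + 1 = 3\<close>
  would encode its halting state 1, which is kept as 1.\<close>

definition seq_tm :: "tm \<Rightarrow> tm \<Rightarrow> tm" where
  "seq_tm M N = \<lparr> ntapes = ntapes M, nstates = 2 * (nstates M + nstates N), nsyms = nsyms M,
     delta = (\<lambda>q r.
       if odd q then case delta N (if q = 3 then 0 else q div 2) r of (q', w, m) \<Rightarrow> (seq_right q', w, m)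
       else case delta M (q div 2) r of (q', w, m) \<Rightarrow> (seq_left q', w, m)) \<rparr>"

lemma seq_tm_simps [simp]:
  "ntapes (seq_tm M N) = ntapes M" "nsyms (seq_tm M N) = nsyms M"
  by (simp_all add: seq_tm_def)

text \<open>A state of the composition may decode to a nonexistent state of either component;
  totality of the components controls these transitions too.\<close>

lemma total_seq_tm:
  assumes "total_tm M" "total_tm N" "ntapes N = ntapes M" "nsyms N = nsyms M"
  shows "total_tm (seq_tm M N)"
proof -
  have "case delta (seq_tm M N) q r of (q', w, m) \<Rightarrow> q' < nstates (seq_tm M N) \<and>
      (\<forall>i<ntapes M. w i < nsyms M \<and> m i \<in> {-1, 0, 1})"
    if r: "\<forall>i. r i < nsyms M" for q r
  proof -
    obtain q1 w1 m1 where 1: "delta M (q div 2) r = (q1, w1, m1)" by (cases "delta M (q div 2) r")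
    obtain q2 w2 m2 where 2: "delta N (if q = 3 then 0 else q div 2) r = (q2, w2, m2)"
      by (cases "delta N (if q = 3 then 0 else q div 2) r")
    have "q1 < nstates M \<and> (\<forall>i<ntapes M. w1 i < nsyms M \<and> m1 i \<in> {-1, 0, 1})"
      using assms(1) r 1 unfolding total_tm_def by (metis (no_types, lifting) case_prod_conv)
    moreover have "q2 < nstates N \<and> (\<forall>i<ntapes M. w2 i < nsyms M \<and> m2 i \<in> {-1, 0, 1})"
      using assms(2) r 2 unfolding total_tm_def assms(3,4) by (metis (no_types, lifting) case_prod_conv)
    moreover have "3 \<le> nstates M" using assms(1) by (simp add: total_tm_def)
    ultimately show ?thesis
      using 1 2 by (auto simp: seq_tm_def seq_left_def seq_right_def)
  qed
  then show ?thesis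
    using assms(1,2) unfolding total_tm_def by (auto simp: seq_tm_def)
qed

lemma tm_step_seq_left:
  assumes "cstate c \<notin> {1, 2}"
  shows "tm_step (seq_tm M N) (c\<lparr>cstate := seq_left (cstate c)\<rparr>) =
    (tm_step M c)\<lparr>cstate := seq_left (cstate (tm_step M c))\<rparr>"
proof -
  have "even (seq_left (cstate c))" "seq_left (cstate c) div 2 = cstate c"
    "seq_left (cstate c) \<notin> {1, 2}"
    using assms by (auto simp: seq_left_def)
  then show ?thesis
    using assms by (simp add: tm_step_def seq_tm_def cong: if_cong split: prod.split)
qed

text \<open>Halting states of \<open>N\<close> also halt the composition, so unlike on the left they
  need not be excluded.\<close>

lemma tm_step_seq_right:
  assumes "ntapes N = ntapes M"
  shows "tm_step (seq_tm M N) (c\<lparr>cstate := seq_right (cstate c)\<rparr>) =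
    (tm_step N c)\<lparr>cstate := seq_right (cstate (tm_step N c))\<rparr>"
proof (cases "cstate c \<in> {1, 2}")
  case True
  then show ?thesis by (auto simp: tm_step_def seq_right_def)
next
  case False
  then have "odd (seq_right (cstate c))"
    "(if seq_right (cstate c) = 3 then 0 else seq_right (cstate c) div 2) = cstate c"
    "seq_right (cstate c) \<notin> {1, 2}"
    by (auto simp: seq_right_def)
  then show ?thesis
    using False assms by (simp add: tm_step_def seq_tm_def cong: if_cong split: prod.split)
qed

text \<open>Exact step counts would not transfer: once \<open>M\<close> has halted it stays put,
  whereas the composition moves on. The upper bound in \<open>run\<close> absorbs the idle
  steps.\<close>

lemma run_seq_left:
  assumes "run M t c c'"
  shows "run (seq_tm M N) t (c\<lparr>cstate := seq_left (cstate c)\<rparr>) (c'\<lparr>cstate := seq_left (cstate c')\<rparr>)"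
proof -
  have "run (seq_tm M N) s (c\<lparr>cstate := seq_left (cstate c)\<rparr>)
      (((tm_step M ^^ s) c)\<lparr>cstate := seq_left (cstate ((tm_step M ^^ s) c))\<rparr>)" for s
  proof (induction s arbitrary: c)
    case 0
    then show ?case by (simp add: run_refl)
  next
    case (Suc s)
    show ?case
    proof (cases "cstate c \<in> {1, 2}")
      case True
      then show ?thesis by (simp only: tm_step_halted run_refl)
    next
      case False
      have "run (seq_tm M N) s (tm_step (seq_tm M N) (c\<lparr>cstate := seq_left (cstate c)\<rparr>))
          (((tm_step M ^^ Suc s) c)\<lparr>cstate := seq_left (cstate ((tm_step M ^^ Suc s) c))\<rparr>)"
        using Suc.IH[of "tm_step M c"] unfolding tm_step_seq_left[OF False]
        by (simp add: funpow_swap1)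
      then show ?thesis by (rule run_Suc)
    qed
  qed
  then show ?thesis using assms run_mono unfolding run_def[of M] by blast
qed

lemma run_seq_right:
  assumes "run N t c c'" "ntapes N = ntapes M"
  shows "run (seq_tm M N) t (c\<lparr>cstate := seq_right (cstate c)\<rparr>) (c'\<lparr>cstate := seq_right (cstate c')\<rparr>)"
proof -
  have "(tm_step (seq_tm M N) ^^ s) (c\<lparr>cstate := seq_right (cstate c)\<rparr>) =
      ((tm_step N ^^ s) c)\<lparr>cstate := seq_right (cstate ((tm_step N ^^ s) c))\<rparr>" for s
    by (induction s) (simp_all add: tm_step_seq_right[OF assms(2)])
  then show ?thesis using assms(1) unfolding run_def by blast
qed

lemma run_seq_tm:
  assumes "run M s c c'" "cstate c = 0" "cstate c' = 1"
    and "run N t (c'\<lparr>cstate := 0\<rparr>) c''" "cstate c'' \<in> {1, 2}" "ntapes N = ntapes M"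
  shows "run (seq_tm M N) (s + t) c c''"
proof -
  have left: "c\<lparr>cstate := seq_left (cstate c)\<rparr> = c"
    "c'\<lparr>cstate := seq_left (cstate c')\<rparr> = c'\<lparr>cstate := 3\<rparr>"
    using assms(2,3) by (cases c; simp add: seq_left_def)+
  have right: "c'\<lparr>cstate := 0, cstate := seq_right (cstate (c'\<lparr>cstate := 0\<rparr>))\<rparr> = c'\<lparr>cstate := 3\<rparr>"
    "c''\<lparr>cstate := seq_right (cstate c'')\<rparr> = c''"
    using assms(5) by (cases c''; auto simp: seq_right_def)+
  show ?thesis
    using run_trans[OF run_seq_left[OF assms(1), of N, unfolded left]
        run_seq_right[OF assms(4,6), unfolded right]] .
qed

text \<open>This is how a reduction treats an ill-formed input: it accepts with the output tape as
  the reader left it, that is, empty.\<close>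

lemma run_seq_tm_reject:
  assumes "run M s c c'" "cstate c = 0" "cstate c' = 2"
  shows "run (seq_tm M N) s c (c'\<lparr>cstate := 1\<rparr>)"
proof -
  have left: "c\<lparr>cstate := seq_left (cstate c)\<rparr> = c"
    "c'\<lparr>cstate := seq_left (cstate c')\<rparr> = c'\<lparr>cstate := 1\<rparr>"
    using assms(2,3) by (cases c; simp add: seq_left_def)+
  show ?thesis
    using run_seq_left[OF assms(1), of N, unfolded left] .
qed

section \<open>Running a machine on selected tapes of a larger machine\<close>

definition retape :: "(nat \<Rightarrow> nat) \<Rightarrow> nat \<Rightarrow> nat \<Rightarrow> tm \<Rightarrow> tm" where
  "retape \<pi> K S M = \<lparr> ntapes = K, nstates = nstates M, nsyms = S,
     delta = (\<lambda>q r.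
       if q < nstates M \<and> (\<forall>i<ntapes M. r (\<pi> i) < nsyms M) then
         case delta M q (\<lambda>i. if i < ntapes M then r (\<pi> i) else 0) of (q', w, m) \<Rightarrow>
           (q', \<lambda>j. if j \<in> \<pi> ` {..<ntapes M} then w (inv_into {..<ntapes M} \<pi> j) else r j,
                \<lambda>j. if j \<in> \<pi> ` {..<ntapes M} then m (inv_into {..<ntapes M} \<pi> j) else 0)
       else (2, r, \<lambda>j. 0)) \<rparr>"

lemma retape_simps [simp]: "ntapes (retape \<pi> K S M) = K" "nsyms (retape \<pi> K S M) = S"
  by (simp_all add: retape_def)

lemma wf_tm_delta:
  assumes "wf_tm M" "q < nstates M" "\<And>i. r i < nsyms M" "delta M q r = (q', w, m)"
  shows "q' < nstates M" "i < ntapes M \<Longrightarrow> w i < nsyms M" "i < ntapes M \<Longrightarrow> m i \<in> {-1, 0, 1}"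
proof -
  have "case delta M q r of (q', w, m) \<Rightarrow>
      q' < nstates M \<and> (\<forall>i<ntapes M. w i < nsyms M \<and> m i \<in> {-1, 0, 1})"
    using assms(1-3) unfolding wf_tm_def by simp
  then show "q' < nstates M" "i < ntapes M \<Longrightarrow> w i < nsyms M" "i < ntapes M \<Longrightarrow> m i \<in> {-1, 0, 1}"
    using assms(4) by auto
qed

text \<open>\<open>wf_tm\<close> says nothing about foreign states and symbols; the default branch
  of \<open>retape\<close>, which rejects, covers them.\<close>

lemma total_retape:
  assumes M: "wf_tm M" and "1 \<le> K" "nsyms M \<le> S"
  shows "total_tm (retape \<pi> K S M)"
proof -
  have S: "3 \<le> nstates M" "8 \<le> S" and pos: "0 < nsyms M"
    using assms by (auto simp: wf_tm_def)
  have "case delta (retape \<pi> K S M) q r of (q', w, m) \<Rightarrow> q' < nstates M \<and>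
      (\<forall>j<K. w j < S \<and> m j \<in> {-1, 0, 1})"
    if r: "\<forall>j. r j < S" for q r
  proof (cases "q < nstates M \<and> (\<forall>i<ntapes M. r (\<pi> i) < nsyms M)")
    case True
    let ?r = "\<lambda>i. if i < ntapes M then r (\<pi> i) else 0"
    obtain q' w m where d: "delta M q ?r = (q', w, m)" by (cases "delta M q ?r")
    have r': "?r i < nsyms M" for i using True pos by simp
    note D = wf_tm_delta[OF M conjunct1[OF True] r' d]
    have "inv_into {..<ntapes M} \<pi> j < ntapes M" if "j \<in> \<pi> ` {..<ntapes M}" for j
      using inv_into_into[OF that] by simp
    then have "\<forall>j. (if j \<in> \<pi> ` {..<ntapes M} then w (inv_into {..<ntapes M} \<pi> j) else r j) < S"
      "\<forall>j. (if j \<in> \<pi> ` {..<ntapes M} then m (inv_into {..<ntapes M} \<pi> j) else 0) \<in> {-1, 0, 1}"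
      using less_le_trans[OF D(2) assms(3)] D(3) r by auto
    then show ?thesis
      using True d D(1) by (simp add: retape_def)
  next
    case False
    then show ?thesis using S r by (auto simp: retape_def)
  qed
  then show ?thesis
    using assms(2) S unfolding total_tm_def by (simp add: retape_def)
qed

text \<open>The invariant under which the default branch of \<open>retape\<close> is never
  taken.\<close>

definition valid_config :: "tm \<Rightarrow> config \<Rightarrow> bool" where
  "valid_config M c \<longleftrightarrow> cstate c < nstates M \<and> (\<forall>i<ntapes M. \<forall>z. ctape c i z < nsyms M)"

lemma valid_config_step:
  assumes "wf_tm M" "valid_config M c"
  shows "valid_config M (tm_step M c)"
proof (cases "cstate c \<in> {1, 2}")
  case True
  then show ?thesis using assms(2) by (simp add: tm_step_def)
next
  case False
  let ?r = "\<lambda>i. if i < ntapes M then ctape c i (chead c i) else 0"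
  obtain q' w m where d: "delta M (cstate c) ?r = (q', w, m)" by (cases "delta M (cstate c) ?r")
  have "0 < nsyms M" using assms(1) by (simp add: wf_tm_def)
  then have r: "?r i < nsyms M" for i
    using assms(2) by (simp add: valid_config_def)
  have "cstate c < nstates M" using assms(2) by (simp add: valid_config_def)
  note D = wf_tm_delta[OF assms(1) this r d]
  then show ?thesis
    using False d assms(2) by (auto simp: tm_step_def valid_config_def)
qed

lemma sym_code_less: "x \<in> set (sym_code s) \<Longrightarrow> 0 < x \<and> x < 8"
  by (cases s) auto

lemma valid_tm_init:
  assumes "wf_tm M"
  shows "valid_config M (tm_init \<sigma>)"
proof -
  have "string_tape \<sigma> z < 8" for z
  proof -
    have "\<forall>x\<in>set (concat (map sym_code \<sigma>)). x < 8" using sym_code_less by auto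
    then have "concat (map sym_code \<sigma>) ! k < 8" if "k < length (concat (map sym_code \<sigma>))" for k
      using nth_mem[OF that] by blast
    then show ?thesis by (simp add: string_tape_def Let_def)
  qed
  moreover have "8 \<le> nsyms M" "0 < nsyms M" "3 \<le> nstates M" using assms by (auto simp: wf_tm_def)
  ultimately have "string_tape \<sigma> z < nsyms M" for z
    using less_le_trans by blast
  then show ?thesis
    using \<open>0 < nsyms M\<close> \<open>3 \<le> nstates M\<close> by (auto simp: valid_config_def tm_init_def)
qed

definition tape_sim :: "(nat \<Rightarrow> nat) \<Rightarrow> tm \<Rightarrow> config \<Rightarrow> config \<Rightarrow> bool" where
  "tape_sim \<pi> M c d \<longleftrightarrow> cstate c = cstate d \<and>
     (\<forall>i<ntapes M. chead c (\<pi> i) = chead d i \<and> ctape c (\<pi> i) = ctape d i)"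

lemma retape_frame:
  assumes "j \<notin> \<pi> ` {..<ntapes M}"
  shows "chead (tm_step (retape \<pi> K S M) c) j = chead c j \<and>
    ctape (tm_step (retape \<pi> K S M) c) j = ctape c j"
  using assms by (auto simp: tm_step_def retape_def split: prod.splits)

lemma retape_step:
  assumes "inj_on \<pi> {..<ntapes M}" "\<pi> ` {..<ntapes M} \<subseteq> {..<K}"
    and "valid_config M d" "tape_sim \<pi> M c d"
  shows "tape_sim \<pi> M (tm_step (retape \<pi> K S M) c) (tm_step M d)"
proof (cases "cstate d \<in> {1, 2}")
  case True
  then show ?thesis using assms(4) by (simp add: tm_step_def tape_sim_def)
next
  case False
  let ?r = "\<lambda>i. if i < ntapes M then ctape d i (chead d i) else 0"
  let ?R = "\<lambda>j. if j < K then ctape c j (chead c j) else 0"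
  obtain q' w m where d: "delta M (cstate d) ?r = (q', w, m)" by (cases "delta M (cstate d) ?r")
  have K: "\<pi> i < K" if "i < ntapes M" for i using assms(2) that by auto
  have R: "?R (\<pi> i) = ctape d i (chead d i)" if "i < ntapes M" for i
    using that K assms(4) by (simp add: tape_sim_def)
  have eq: "(\<lambda>i. if i < ntapes M then ?R (\<pi> i) else 0) = ?r"
    using R by (intro ext) simp
  have "cstate d < nstates M \<and> (\<forall>i<ntapes M. ?R (\<pi> i) < nsyms M)"
    using assms(3) R by (simp add: valid_config_def)
  then have D: "delta (retape \<pi> K S M) (cstate d) ?R =
      (q', \<lambda>j. if j \<in> \<pi> ` {..<ntapes M} then w (inv_into {..<ntapes M} \<pi> j) else ?R j,
           \<lambda>j. if j \<in> \<pi> ` {..<ntapes M} then m (inv_into {..<ntapes M} \<pi> j) else 0)"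
    using d eq by (simp add: retape_def)
  have inv: "inv_into {..<ntapes M} \<pi> (\<pi> i) = i" if "i < ntapes M" for i
    using that assms(1) by simp
  have "cstate c = cstate d" using assms(4) by (simp add: tape_sim_def)
  then show ?thesis
    using False assms(4) d D K inv by (simp add: tm_step_def tape_sim_def)
qed

lemma retape_run:
  assumes "wf_tm M" "inj_on \<pi> {..<ntapes M}" "\<pi> ` {..<ntapes M} \<subseteq> {..<K}"
    and "valid_config M d" "tape_sim \<pi> M c d"
  shows "valid_config M ((tm_step M ^^ t) d)"
    and "tape_sim \<pi> M ((tm_step (retape \<pi> K S M) ^^ t) c) ((tm_step M ^^ t) d)"
    and "j \<notin> \<pi> ` {..<ntapes M} \<Longrightarrow> chead ((tm_step (retape \<pi> K S M) ^^ t) c) j = chead c j \<and>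
      ctape ((tm_step (retape \<pi> K S M) ^^ t) c) j = ctape c j"
proof -
  show valid: "valid_config M ((tm_step M ^^ t) d)" for t
    by (induction t) (simp_all add: assms(4) valid_config_step[OF assms(1)])
  show "tape_sim \<pi> M ((tm_step (retape \<pi> K S M) ^^ t) c) ((tm_step M ^^ t) d)"
    by (induction t) (simp_all add: assms(5) retape_step[OF assms(2,3) valid])
  show "chead ((tm_step (retape \<pi> K S M) ^^ t) c) j = chead c j \<and>
      ctape ((tm_step (retape \<pi> K S M) ^^ t) c) j = ctape c j"
    if "j \<notin> \<pi> ` {..<ntapes M}"
    by (induction t) (simp_all add: retape_frame[OF that])
qed

text \<open>Each symbol occupies at least one nonblank cell, so the length of an output can be read
  off from the number of cells that had to be written.\<close>

lemma length_le_card_string_tape: "length \<sigma> \<le> card {z. string_tape \<sigma> z \<noteq> 0}"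
proof -
  let ?w = "concat (map sym_code \<sigma>)"
  have "1 \<le> length (sym_code s)" for s by (cases s) auto
  then have "length \<sigma> \<le> length ?w"
  proof (induction \<sigma>)
    case (Cons s \<sigma>)
    then show ?case using add_mono[OF Cons.prems Cons.IH[OF Cons.prems]] by simp
  qed simp
  also have "\<dots> = card (int ` {..<length ?w})"
    by (simp add: card_image)
  also have "int ` {..<length ?w} = {z. string_tape \<sigma> z \<noteq> 0}"
  proof (intro equalityI subsetI)
    fix z assume "z \<in> int ` {..<length ?w}"
    then obtain k where k: "z = int k" "k < length ?w" by auto
    then have "?w ! k \<in> set ?w" by (metis nth_mem)
    then have "?w ! k \<noteq> 0" using sym_code_less by fastforce
    then show "z \<in> {z. string_tape \<sigma> z \<noteq> 0}" using k by (simp add: string_tape_def)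
  next
    fix z assume "z \<in> {z. string_tape \<sigma> z \<noteq> 0}"
    then have "0 \<le> z" "nat z < length ?w"
      by (auto simp: string_tape_def Let_def split: if_splits)
    then show "z \<in> int ` {..<length ?w}" by (intro image_eqI[of _ _ "nat z"]) auto
  qed
  finally show ?thesis .
qed

text \<open>A step writes at most one cell on each tape.\<close>

lemma card_nonblank:
  assumes "finite {z. ctape c i z \<noteq> 0}"
  shows "finite {z. ctape ((tm_step M ^^ t) c) i z \<noteq> 0} \<and>
    card {z. ctape ((tm_step M ^^ t) c) i z \<noteq> 0} \<le> card {z. ctape c i z \<noteq> 0} + t"
proof (induction t)
  case 0
  then show ?case using assms by simp
next
  case (Suc t)
  let ?c = "(tm_step M ^^ t) c"
  have "{z. ctape (tm_step M ?c) i z \<noteq> 0} \<subseteq> insert (chead ?c i) {z. ctape ?c i z \<noteq> 0}"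
    by (auto simp: tm_step_def split: prod.splits if_splits)
  moreover have "finite (insert (chead ?c i) {z. ctape ?c i z \<noteq> 0})" using Suc by simp
  ultimately have "finite {z. ctape (tm_step M ?c) i z \<noteq> 0}"
    "card {z. ctape (tm_step M ?c) i z \<noteq> 0} \<le> card (insert (chead ?c i) {z. ctape ?c i z \<noteq> 0})"
    by (auto intro: finite_subset card_mono)
  moreover have "card (insert (chead ?c i) {z. ctape ?c i z \<noteq> 0}) \<le>
      Suc (card {z. ctape ?c i z \<noteq> 0})"
    by (rule card_insert_le_m1) auto
  ultimately show ?case using Suc by simp
qed

lemma poly_nat_mono: "x \<le> y \<Longrightarrow> poly (p :: nat poly) x \<le> poly p y"
  by (induction p) (auto intro: add_mono mult_mono)

theorem polytime_decidable_reducible: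
  assumes "polytime_reducible P Q" "polytime_decidable Q"
  shows "polytime_decidable P"
proof -
  obtain \<rho> R p where \<rho>: "\<And>\<sigma>. \<sigma> \<in> P \<longleftrightarrow> \<rho> \<sigma> \<in> Q" and R: "wf_tm R" "2 \<le> ntapes R"
    and Rp: "\<And>\<sigma>. \<exists>t \<le> poly p (length \<sigma>). let c = (tm_step R ^^ t) (tm_init \<sigma>)
        in cstate c = 1 \<and> ctape c 1 = string_tape (\<rho> \<sigma>) \<and> chead c 1 = 0"
    using assms(1) unfolding polytime_reducible_def polytime_computable_def by metis
  obtain D q where D: "wf_tm D"
    and Dq: "\<And>\<sigma>. \<exists>t \<le> poly q (length \<sigma>).
        cstate ((tm_step D ^^ t) (tm_init \<sigma>)) = (if \<sigma> \<in> Q then 1 else 2)"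
    using assms(2) unfolding polytime_decidable_def by metis
  define K where "K = ntapes R + ntapes D"
  define S where "S = nsyms R + nsyms D"
  \<comment> \<open>The input tape of \<open>D\<close> is the output tape 1 of \<open>R\<close>. All
    other tapes of \<open>D\<close> lie beyond those of \<open>R\<close>, where they are still blank
    when \<open>D\<close> starts.\<close>
  define \<pi> where "\<pi> i = (if i = 0 then 1 else ntapes R + i)" for i :: nat
  let ?R = "retape id K S R" and ?D = "retape \<pi> K S D"
  let ?M = "seq_tm ?R ?D"
  have K: "1 \<le> K" "nsyms R \<le> S" "nsyms D \<le> S" using R by (auto simp: K_def S_def)
  have img: "id ` {..<ntapes R} \<subseteq> {..<K}" by (auto simp: K_def)
  have \<pi>: "inj_on \<pi> {..<ntapes D}" "\<pi> ` {..<ntapes D} \<subseteq> {..<K}"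
    using R(2) by (auto simp: inj_on_def \<pi>_def K_def)
  have wf: "wf_tm ?M"
    using total_retape[OF R(1) K(1,2)] total_retape[OF D K(1,3)]
    by (intro total_tm_wf total_seq_tm) simp_all
  have "\<exists>t \<le> poly (p + pcompose q p) (length \<sigma>).
        cstate ((tm_step ?M ^^ t) (tm_init \<sigma>)) = (if \<sigma> \<in> P then 1 else 2)" for \<sigma>
  proof -
    let ?\<tau> = "\<rho> \<sigma>" and ?c = "tm_init \<sigma>"
    obtain t1 where t1: "t1 \<le> poly p (length \<sigma>)" "cstate ((tm_step R ^^ t1) ?c) = 1"
      "ctape ((tm_step R ^^ t1) ?c) 1 = string_tape ?\<tau>" "chead ((tm_step R ^^ t1) ?c) 1 = 0"
      using Rp[of \<sigma>] unfolding Let_def by blast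
    define c1 where "c1 = (tm_step ?R ^^ t1) ?c"
    have sim0: "tape_sim id R ?c ?c" by (simp add: tape_sim_def)
    note run1 = retape_run[OF R(1) inj_on_id img valid_tm_init[OF R(1)] sim0, where t = t1]
    have c1: "cstate c1 = 1" "ctape c1 1 = string_tape ?\<tau>" "chead c1 1 = 0"
      using run1(2) t1 R(2) by (simp_all add: tape_sim_def c1_def)
    have far: "chead c1 j = 0" "ctape c1 j = (\<lambda>_. 0)" if "ntapes R \<le> j" for j
      using run1(3)[where j = j] that R(2) by (auto simp: tm_init_def c1_def)
    have sim1: "tape_sim \<pi> D (c1\<lparr>cstate := 0\<rparr>) (tm_init ?\<tau>)"
      using c1 far by (auto simp: tape_sim_def \<pi>_def tm_init_def)
    obtain t2 where t2: "t2 \<le> poly q (length ?\<tau>)"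
      "cstate ((tm_step D ^^ t2) (tm_init ?\<tau>)) = (if ?\<tau> \<in> Q then 1 else 2)"
      using Dq by blast
    define c2 where "c2 = (tm_step ?D ^^ t2) (c1\<lparr>cstate := 0\<rparr>)"
    have c2: "cstate c2 = (if \<sigma> \<in> P then 1 else 2)"
      using retape_run(2)[OF D \<pi> valid_tm_init[OF D] sim1, of t2] t2(2) \<rho>
      by (simp add: tape_sim_def c2_def)
    have run: "run ?M (t1 + t2) ?c c2"
    proof (rule run_seq_tm)
      show "run ?R t1 ?c c1" "run ?D t2 (c1\<lparr>cstate := 0\<rparr>) c2"
        unfolding run_def c1_def c2_def by blast+
    qed (use c1 c2 in \<open>simp_all add: tm_init_def\<close>)
    \<comment> \<open>Tape 1 is blank at the start and gains at most one nonblank cell per step, so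
      the intermediate string is no longer than the running time of \<open>R\<close>. This gives the
      composed polynomial.\<close>
    have "card {z. string_tape ?\<tau> z \<noteq> 0} \<le> t1"
      using card_nonblank[where c = ?c and i = 1 and M = R and t = t1] t1(3) by (simp add: tm_init_def)
    then have "length ?\<tau> \<le> poly p (length \<sigma>)"
      using length_le_card_string_tape[of ?\<tau>] t1(1) by linarith
    then have "t2 \<le> poly q (poly p (length \<sigma>))"
      using t2(1) poly_nat_mono le_trans by blast
    then have "t1 + t2 \<le> poly (p + pcompose q p) (length \<sigma>)"
      using t1(1) by (simp add: poly_pcompose)
    then show ?thesis
      using run c2 unfolding run_def using le_trans by blast
  qed
  then show ?thesis unfolding polytime_decidable_def using wf by blast
qed

section \<open>Machines acting on tapes split at the head\<close>

text \<open>Head position, cells to the left of the head (nearest first), cells from the head on.\<close>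

type_synonym tape = "int \<times> nat stream \<times> nat stream"

definition blank :: "nat stream" where
  "blank = sconst 0"

lemma blank_simps [simp]: "shd blank = 0" "stl blank = blank" "0 ## blank = blank" "blank !! i = 0"
  using siterate.ctr[of id "0::nat"] by (simp_all add: blank_def)

fun rd :: "tape \<Rightarrow> nat" where
  "rd (h, l, r) = shd r"

fun wr :: "nat \<Rightarrow> tape \<Rightarrow> tape" where
  "wr s (h, l, r) = (h, l, s ## stl r)"

fun mv :: "int \<Rightarrow> tape \<Rightarrow> tape" where
  "mv d (h, l, r) = (if d = 1 then (h + 1, shd r ## l, stl r)
     else if d = -1 then (h - 1, stl l, shd l ## r) else (h, l, r))"

fun cells :: "tape \<Rightarrow> int \<Rightarrow> nat" where
  "cells (h, l, r) z = (if h \<le> z then r !! nat (z - h) else l !! nat (h - 1 - z))"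

definition conf :: "nat \<Rightarrow> (nat \<Rightarrow> tape) \<Rightarrow> config" where
  "conf q Z = \<lparr> cstate = q, chead = (\<lambda>i. fst (Z i)), ctape = (\<lambda>i. cells (Z i)) \<rparr>"

lemma conf_simps [simp]:
  "cstate (conf q Z) = q" "(conf q Z)\<lparr>cstate := q'\<rparr> = conf q' Z"
  "chead (conf q Z) i = fst (Z i)" "ctape (conf q Z) i = cells (Z i)"
  by (simp_all add: conf_def)

lemma cells_head: "cells z (fst z) = rd z"
  by (cases z) simp

lemma cells_wr: "cells (wr s z) = (cells z)(fst z := s)"
proof (cases z)
  case (fields h l r)
  have "nat (x - h) = Suc (nat (x - h - 1))" if "h \<le> x" "x \<noteq> h" for x
    using that by simp
  then show ?thesis using fields by (auto simp: fun_eq_iff)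
qed

lemma cells_mv: "cells (mv d z) = cells z"
proof (cases z)
  case (fields h l r)
  have 1: "nat (x - h) = Suc (nat (x - (h + 1)))" if "h + 1 \<le> x" for x using that by simp
  have 2: "nat (h - 1 - x) = Suc (nat (h - 1 - 1 - x))" if "\<not> h - 1 \<le> x" for x using that by simp
  have "cells (h + 1, shd r ## l, stl r) x = cells (h, l, r) x" for x
  proof -
    consider "x = h" | "h + 1 \<le> x" | "\<not> h \<le> x" by linarith
    then show ?thesis
    proof cases
      case 3
      then have "nat (h - x) = Suc (nat (h - 1 - x))" by simp
      then show ?thesis using 3 by simp
    qed (use 1[of x] in auto)
  qed
  moreover have "cells (h - 1, stl l, shd l ## r) x = cells (h, l, r) x" for x
  proof -
    consider "x = h - 1" | "h \<le> x" | "\<not> h - 1 \<le> x" by linarith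
    then show ?thesis
    proof cases
      case 2
      then have "nat (x - (h - 1)) = Suc (nat (x - h))" by simp
      then show ?thesis using 2 by simp
    qed (use 2[of x] in auto)
  qed
  ultimately show ?thesis using fields by (simp add: fun_eq_iff)
qed

lemma fst_mv: "d \<in> {-1, 0, 1} \<Longrightarrow> fst (mv d z) = fst z + d"
  by (cases z) auto

lemma fst_wr [simp]: "fst (wr s z) = fst z"
  by (cases z) simp

lemma wr_rd [simp]: "wr (rd z) z = z"
  by (cases z) simp

lemma mv_0 [simp]: "mv 0 z = z"
  by (cases z) simp

text \<open>In the split representation a step only pushes and pops at the head, so later runs are
  verified by rewriting with streams instead of arithmetic on positions.\<close>

lemma tm_step_conf:
  assumes "q \<notin> {1, 2}" "delta M q (\<lambda>i. if i < ntapes M then rd (Z i) else 0) = (q', w, m)"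
    and "\<forall>i<ntapes M. m i \<in> {-1, 0, 1}"
  shows "tm_step M (conf q Z) = conf q' (\<lambda>i. if i < ntapes M then mv (m i) (wr (w i) (Z i)) else Z i)"
proof -
  have "(\<lambda>i. if i < ntapes M then ctape (conf q Z) i (chead (conf q Z) i) else 0) =
      (\<lambda>i. if i < ntapes M then rd (Z i) else 0)"
    by (simp add: cells_head cong: if_cong)
  then have "tm_step M (conf q Z) = \<lparr> cstate = q',
      chead = (\<lambda>i. if i < ntapes M then fst (Z i) + m i else fst (Z i)),
      ctape = (\<lambda>i. if i < ntapes M then (cells (Z i))(fst (Z i) := w i) else cells (Z i)) \<rparr>"
    using assms(1,2) by (simp add: tm_step_def cong: if_cong)
  then show ?thesis
    using assms(3) by (auto simp: conf_def fun_eq_iff fst_mv cells_mv cells_wr)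
qed

text \<open>
  Machines with five tapes: input, output, stack, first argument, second argument. A transition
  lists the tapes on which it acts, with the symbol written and the move.
\<close>

type_synonym actions = "(nat \<times> nat \<times> int) list"

definition tm5 :: "nat \<Rightarrow> (nat \<Rightarrow> (nat \<Rightarrow> nat) \<Rightarrow> nat \<times> actions) \<Rightarrow> tm" where
  "tm5 N f = \<lparr> ntapes = 5, nstates = N, nsyms = 8,
     delta = (\<lambda>q r. case f q r of (q', as) \<Rightarrow>
       (q', \<lambda>i. case map_of as i of None \<Rightarrow> r i | Some (s, d) \<Rightarrow> s,
            \<lambda>i. case map_of as i of None \<Rightarrow> 0 | Some (s, d) \<Rightarrow> d)) \<rparr>"

definition act :: "actions \<Rightarrow> (nat \<Rightarrow> tape) \<Rightarrow> nat \<Rightarrow> tape" where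
  "act as Z = (\<lambda>i. case map_of as i of None \<Rightarrow> Z i | Some (s, d) \<Rightarrow> mv d (wr s (Z i)))"

lemma act_simps [simp]:
  "act [] Z = Z"
  "act ((i, s, d) # as) Z = (act as Z)(i := mv d (wr s (Z i)))"
  by (auto simp: act_def fun_eq_iff)

definition tm5_ok :: "tm \<Rightarrow> bool" where
  "tm5_ok M \<longleftrightarrow> total_tm M \<and> ntapes M = 5 \<and> nsyms M = 8"

lemma tm5_okI:
  assumes "3 \<le> N"
    and "\<And>q r. \<forall>i. r i < 8 \<Longrightarrow> fst (f q r) < N \<and>
      (\<forall>(i, s, d) \<in> set (snd (f q r)). s < 8 \<and> d \<in> {-1, 0, 1})"
  shows "tm5_ok (tm5 N f)"
proof -
  have "case delta (tm5 N f) q r of (q', w, m) \<Rightarrow>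
      q' < N \<and> (\<forall>i<5. w i < 8 \<and> m i \<in> {-1, 0, 1})" if r: "\<forall>i. r i < 8" for q r
  proof -
    obtain q' as where f: "f q r = (q', as)" by (cases "f q r")
    have "\<forall>(i, s, d) \<in> set as. s < 8 \<and> d \<in> {-1, 0, 1}" "q' < N"
      using assms(2)[OF r, of q] f by auto
    then have "(case map_of as i of None \<Rightarrow> r i | Some (s, d) \<Rightarrow> s) < 8"
      "(case map_of as i of None \<Rightarrow> 0 | Some (s, d) \<Rightarrow> d) \<in> {-1, 0, 1}" for i
      using r by (auto split: option.split prod.split dest!: map_of_SomeD)
    then show ?thesis using f \<open>q' < N\<close> by (simp add: tm5_def)
  qed
  then show ?thesis using assms(1) by (simp add: tm5_ok_def total_tm_def tm5_def)
qed

lemma tm5_ok_seq: "tm5_ok M \<Longrightarrow> tm5_ok N \<Longrightarrow> tm5_ok (seq_tm M N)"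
  by (simp add: tm5_ok_def total_seq_tm)

definition scanned :: "(nat \<Rightarrow> tape) \<Rightarrow> nat \<Rightarrow> nat" where
  "scanned Z = (\<lambda>i. if i < 5 then rd (Z i) else 0)"

lemma tm5_step:
  assumes "q \<notin> {1, 2}" "f q (scanned Z) = (q', as)"
    and "\<forall>(i, s, d) \<in> set as. i < 5 \<and> d \<in> {-1, 0, 1}"
  shows "tm_step (tm5 N f) (conf q Z) = conf q' (act as Z)"
proof -
  let ?w = "\<lambda>i. case map_of as i of None \<Rightarrow> scanned Z i | Some (s, d) \<Rightarrow> s"
  let ?m = "\<lambda>i. case map_of as i of None \<Rightarrow> 0 | Some (s, d) \<Rightarrow> d"
  have "\<forall>i<5. ?m i \<in> {-1, 0, 1}"
    using assms(3) by (auto split: option.split dest!: map_of_SomeD)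
  moreover have "delta (tm5 N f) q (\<lambda>i. if i < ntapes (tm5 N f) then rd (Z i) else 0) = (q', ?w, ?m)"
    "ntapes (tm5 N f) = 5"
    using assms(2) by (simp_all add: tm5_def flip: scanned_def)
  ultimately have "tm_step (tm5 N f) (conf q Z) =
      conf q' (\<lambda>i. if i < 5 then mv (?m i) (wr (?w i) (Z i)) else Z i)"
    using tm_step_conf[OF assms(1), of "tm5 N f" Z q' ?w ?m] by simp
  moreover have "(\<lambda>i. if i < 5 then mv (?m i) (wr (?w i) (Z i)) else Z i) = act as Z"
    using assms(3) by (auto simp: fun_eq_iff act_def scanned_def split: option.split dest!: map_of_SomeD)
  ultimately show ?thesis by simp
qed

lemma tm5_run_Suc:
  assumes "q \<notin> {1, 2}" "f q (scanned Z) = (q', as)"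
    and "\<forall>(i, s, d) \<in> set as. i < 5 \<and> d \<in> {-1, 0, 1}"
    and "run (tm5 N f) t (conf q' (act as Z)) c"
  shows "run (tm5 N f) (Suc t) (conf q Z) c"
proof (rule run_Suc)
  have "tm_step (tm5 N f) (conf q Z) = conf q' (act as Z)"
    using assms(1-3) by (rule tm5_step)
  then show "run (tm5 N f) t (tm_step (tm5 N f) (conf q Z)) c" using assms(4) by simp
qed

definition exec :: "tm \<Rightarrow> nat \<Rightarrow> (nat \<Rightarrow> tape) \<Rightarrow> bool \<Rightarrow> (nat \<Rightarrow> tape) \<Rightarrow> bool" where
  "exec M t Z b Z' \<longleftrightarrow> run M t (conf 0 Z) (conf (if b then 1 else 2) Z')"

lemma exec_mono: "exec M s Z b Z' \<Longrightarrow> s \<le> t \<Longrightarrow> exec M t Z b Z'"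
  unfolding exec_def by (rule run_mono)

lemma exec_seq:
  assumes "exec M s Z True Z'" "exec N t Z' b Z''" "tm5_ok M" "tm5_ok N"
  shows "exec (seq_tm M N) (s + t) Z b Z''"
  unfolding exec_def
  by (rule run_seq_tm[where c' = "conf 1 Z'"]) (use assms in \<open>simp_all add: exec_def tm5_ok_def\<close>)

lemma exec_seq_reject:
  assumes "exec M s Z False Z'"
  shows "exec (seq_tm M N) s Z True Z'"
  using run_seq_tm_reject[of M s "conf 0 Z" "conf 2 Z'" N] assms by (simp add: exec_def)

section \<open>Elementary machines: writing, testing, copying, rewinding\<close>

definition put_tm :: "nat \<Rightarrow> tm" where
  "put_tm s = tm5 3 (\<lambda>q r. (1, [(1, s, 1)]))"

definition skip_tm :: tm where
  "skip_tm = tm5 3 (\<lambda>q r. (1, []))"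

definition expect_tm :: "nat \<Rightarrow> tm" where
  "expect_tm s = tm5 3 (\<lambda>q r. if r 0 = s then (1, [(0, r 0, 1)]) else (2, []))"

text \<open>The head of tape \<open>k\<close> ends behind the copied word, where
  \<open>rewind_tm\<close> expects it, so an argument can be inserted several times.\<close>

definition copy_tm :: "nat \<Rightarrow> tm" where
  "copy_tm k = tm5 3 (\<lambda>q r. if r k = 0 then (1, []) else (0, [(1, r k, 1), (k, r k, 1)]))"

text \<open>The head starts on the blank behind the word, so state 0 moves left without a test; from
  state 3 on, a blank means that the left end has been passed.\<close>

definition rewind_tm :: "nat \<Rightarrow> tm" where
  "rewind_tm k = tm5 4 (\<lambda>q r. if q \<noteq> 0 \<and> r k = 0 then (1, [(k, r k, 1)]) else (3, [(k, r k, -1)]))"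

lemma basic_ok:
  "s < 8 \<Longrightarrow> tm5_ok (put_tm s)" "tm5_ok skip_tm" "tm5_ok (expect_tm s)" "tm5_ok (copy_tm k)"
  "tm5_ok (rewind_tm k)"
  unfolding put_tm_def skip_tm_def expect_tm_def copy_tm_def rewind_tm_def
  by (auto intro!: tm5_okI split: if_splits)

lemma exec_put: "exec (put_tm s) 1 Z True (Z(1 := mv 1 (wr s (Z 1))))"
  unfolding exec_def put_tm_def One_nat_def by (rule tm5_run_Suc) (auto simp: run_refl)

lemma exec_skip: "exec skip_tm 1 Z True Z"
  unfolding exec_def skip_tm_def One_nat_def by (rule tm5_run_Suc) (auto simp: run_refl)

lemma exec_expect:
  "exec (expect_tm s) 1 Z (rd (Z 0) = s) (if rd (Z 0) = s then Z(0 := mv 1 (Z 0)) else Z)"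
proof (cases "rd (Z 0) = s")
  case True
  then have "wr s (Z 0) = Z 0" using wr_rd by blast
  then show ?thesis using True unfolding exec_def expect_tm_def One_nat_def
    by (intro tm5_run_Suc) (auto simp: run_refl scanned_def)
next
  case False
  then show ?thesis unfolding exec_def expect_tm_def One_nat_def
    by (intro tm5_run_Suc) (auto simp: run_refl scanned_def)
qed

lemma exec_copy:
  assumes "k \<noteq> 1" "k < 5" "0 \<notin> set xs" "Z k = (h, l, xs @- blank)" "Z 1 = (h1, l1, blank)"
  shows "exec (copy_tm k) (Suc (length xs)) Z True
    (Z(k := (h + int (length xs), rev xs @- l, blank), 1 := (h1 + int (length xs), rev xs @- l1, blank)))"
  using assms(3-5) unfolding exec_def copy_tm_def
proof (induction xs arbitrary: Z h l h1 l1)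
  case Nil
  then have "Z(k := (h, l, blank), 1 := (h1, l1, blank)) = Z" by (auto simp: fun_eq_iff)
  then have "act [] Z = Z(k := (h, l, blank), 1 := (h1, l1, blank))" by simp
  then have "run (tm5 3 (\<lambda>q r. if r k = 0 then (1, []) else (0, [(1, r k, 1), (k, r k, 1)]))) 0
      (conf 1 (act [] Z)) (conf 1 (Z(k := (h, l, blank), 1 := (h1, l1, blank))))"
    by (simp only: run_refl)
  from tm5_run_Suc[rotated 3, OF this, of 0] show ?case
    using Nil assms(2) by (simp add: scanned_def fun_upd_def)
next
  case (Cons x xs)
  let ?f = "\<lambda>q r. if r k = 0 then (1, []) else (0, [(1, r k, 1), (k, r k, 1)])"
  let ?Z = "act [(1, x, 1), (k, x, 1)] Z"
  let ?Z' = "Z(k := (h + int (length (x # xs)), rev (x # xs) @- l, blank),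
    1 := (h1 + int (length (x # xs)), rev (x # xs) @- l1, blank))"
  have "?Z(k := (h + 1 + int (length xs), rev xs @- x ## l, blank),
      1 := (h1 + 1 + int (length xs), rev xs @- x ## l1, blank)) = ?Z'"
    by (auto simp: fun_eq_iff)
  moreover have "run (tm5 3 ?f) (Suc (length xs)) (conf 0 ?Z) (conf (if True then 1 else 2)
      (?Z(k := (h + 1 + int (length xs), rev xs @- x ## l, blank),
        1 := (h1 + 1 + int (length xs), rev xs @- x ## l1, blank))))"
    by (rule Cons.IH) (use Cons.prems assms(1) in auto)
  ultimately have "run (tm5 3 ?f) (Suc (length xs)) (conf 0 ?Z) (conf (if True then 1 else 2) ?Z')"
    by (simp only:)
  then show ?case unfolding length_Cons
    by (rule tm5_run_Suc[rotated 3]) (use Cons.prems assms(2) in \<open>auto simp: scanned_def\<close>)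
qed

lemma exec_rewind:
  assumes "k < 5" "0 \<notin> set xs" "Z k = (int (length xs), rev xs @- blank, blank)"
  shows "exec (rewind_tm k) (length xs + 2) Z True (Z(k := (0, blank, xs @- blank)))"
proof -
  let ?f = "\<lambda>q r. if q \<noteq> 0 \<and> r k = 0 then (1, [(k, r k, 1)]) else (3, [(k, r k, -1)]) :: nat \<times> actions"
  \<comment> \<open>\<open>ys\<close> lists the scanned cell and the cells to its left, nearest
    first, and \<open>r\<close> the cells already passed. For \<open>ys = []\<close> the head is at
    -1, on a blank.\<close>
  have loop: "run (tm5 4 ?f) (Suc (length ys)) (conf 3 Z) (conf 1 (Z(k := (0, blank, rev ys @- r))))"
    if "Z k = (int (length ys) - 1, stl (ys @- blank), shd (ys @- blank) ## r)" "0 \<notin> set ys" for ys r Z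
    using that
  proof (induction ys arbitrary: Z r)
    case Nil
    have "act [(k, 0, 1)] Z = Z(k := (0, blank, rev [] @- r))" using Nil
      by (auto simp: fun_eq_iff)
    then have "run (tm5 4 ?f) 0 (conf 1 (act [(k, 0, 1)] Z)) (conf 1 (Z(k := (0, blank, rev [] @- r))))"
      by (simp only: run_refl)
    from tm5_run_Suc[rotated 3, OF this, of 3] show ?case
      using Nil assms(1) by (simp add: scanned_def fun_upd_def)
  next
    case (Cons y ys)
    let ?Z = "act [(k, y, -1)] Z"
    have "run (tm5 4 ?f) (Suc (length ys)) (conf 3 ?Z) (conf 1 (?Z(k := (0, blank, rev ys @- y ## r))))"
      by (rule Cons.IH) (use Cons.prems in auto)
    moreover have "?Z(k := (0, blank, rev ys @- y ## r)) = Z(k := (0, blank, rev (y # ys) @- r))"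
      by (simp add: fun_eq_iff)
    ultimately have "run (tm5 4 ?f) (Suc (length ys)) (conf 3 ?Z) (conf 1 (Z(k := (0, blank, rev (y # ys) @- r))))"
      by (simp only:)
    then show ?case unfolding length_Cons
      by (rule tm5_run_Suc[rotated 3]) (use Cons.prems assms(1) in \<open>auto simp: scanned_def\<close>)
  qed
  let ?Z = "act [(k, 0, -1)] Z"
  have "run (tm5 4 ?f) (Suc (length (rev xs))) (conf 3 ?Z) (conf 1 (?Z(k := (0, blank, rev (rev xs) @- blank))))"
    by (rule loop) (use assms(2,3) in auto)
  moreover have "?Z(k := (0, blank, xs @- blank)) = Z(k := (0, blank, xs @- blank))"
    by (simp add: fun_eq_iff)
  ultimately have "run (tm5 4 ?f) (Suc (length xs)) (conf 3 ?Z) (conf 1 (Z(k := (0, blank, xs @- blank))))"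
    by (simp only: rev_rev_ident length_rev)
  then have "run (tm5 4 ?f) (Suc (Suc (length xs))) (conf 0 Z) (conf 1 (Z(k := (0, blank, xs @- blank))))"
    by (rule tm5_run_Suc[rotated 3]) (use assms in \<open>auto simp: scanned_def\<close>)
  then show ?thesis by (simp add: exec_def rewind_tm_def)
qed

section \<open>Parsing terms\<close>

text \<open>
  A parser for terms with a stack. The flag tells whether a term is expected next (or has just been
  completed); the stack contains, for every pending parenthesis, whether its \<open>\<oplus>\<close> has been read.
\<close>

fun next_state :: "nat \<Rightarrow> bool \<Rightarrow> bool list \<Rightarrow> sym \<Rightarrow> (bool \<times> bool list) option" where
  "next_state n e st Zero = (if e then Some (False, st) else None)"
| "next_state n e st (Var j) = (if e \<and> j < n then Some (False, st) else None)"
| "next_state n e st LPar = (if e then Some (True, False # st) else None)"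
| "next_state n e st Star = (if e then None else Some (False, st))"
| "next_state n e st Oplus = (if \<not> e \<and> st \<noteq> [] \<and> \<not> hd st then Some (True, True # tl st) else None)"
| "next_state n e st RPar = (if \<not> e \<and> st \<noteq> [] \<and> hd st then Some (False, tl st) else None)"

text \<open>Returns the term read and the remaining input. Scanning goes on as long as possible,
  because a completed term may still be extended by \<open>Star\<close>.\<close>

fun scan :: "nat \<Rightarrow> bool \<Rightarrow> bool list \<Rightarrow> sym list \<Rightarrow> (sym list \<times> sym list) option" where
  "scan n e st [] = (if \<not> e \<and> st = [] then Some ([], []) else None)"
| "scan n e st (x # s) = (case next_state n e st x of
     None \<Rightarrow> if \<not> e \<and> st = [] then Some ([], x # s) else None
   | Some (e', st') \<Rightarrow> map_option (apfst (Cons x)) (scan n e' st' s))"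

lemma map_option_apfst [simp]:
  "map_option (apfst f) (map_option (apfst g) x) = map_option (apfst (\<lambda>y. f (g y))) x"
  by (cases x) auto

text \<open>A term read on top of any stack switches the flag and restores the stack. With stack and
  remaining input arbitrary, both summands of a sum are instances of the induction
  hypothesis.\<close>

lemma scan_append:
  assumes "\<alpha> \<in> term_strings n"
  shows "scan n True st (\<alpha> @ s) = map_option (apfst ((@) \<alpha>)) (scan n False st s)"
  using assms
proof (induction arbitrary: st s)
  case (3 \<alpha>)
  have "(@) (\<alpha> @ [Star]) = (\<lambda>y. \<alpha> @ Star # y)" by (simp add: fun_eq_iff)
  then show ?case by (simp add: 3)
next
  case (4 \<alpha> \<beta>)
  have "(@) (LPar # \<alpha> @ Oplus # \<beta> @ [RPar]) = (\<lambda>y. LPar # \<alpha> @ Oplus # \<beta> @ RPar # y)"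
    by (simp add: fun_eq_iff)
  then show ?case by (simp add: 4)
next
  case 1
  have "(@) [Zero] = (#) Zero" by (simp add: fun_eq_iff)
  then show ?case by simp
next
  case (2 j)
  have "(@) [Var j] = (#) (Var j)" by (simp add: fun_eq_iff)
  then show ?case using 2 by simp
qed

text \<open>A following \<open>Star\<close> would still be absorbed into the term; with an empty
  stack every other symbol stops the scan.\<close>

lemma scan_term:
  assumes "\<alpha> \<in> term_strings n" "s = [] \<or> hd s \<noteq> Star"
  shows "scan n True [] (\<alpha> @ s) = Some (\<alpha>, s)"
proof -
  have "scan n False [] s = Some ([], s)"
    using assms(2) by (cases s; cases "hd s") auto
  then show ?thesis by (simp add: scan_append[OF assms(1)])
qed

text \<open>The prefixes after which a term is expected, reconstructed from the stack: every entry
  stands for a pending parenthesis, together with its left summand once \<open>Oplus\<close> has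
  been read.\<close>

inductive open_context :: "nat \<Rightarrow> bool list \<Rightarrow> sym list \<Rightarrow> bool" for n where
  "open_context n [] []"
| "open_context n st p \<Longrightarrow> open_context n (False # st) (p @ [LPar])"
| "open_context n st p \<Longrightarrow> \<alpha> \<in> term_strings n \<Longrightarrow> open_context n (True # st) (p @ LPar # \<alpha> @ [Oplus])"

definition read_so_far :: "nat \<Rightarrow> bool \<Rightarrow> bool list \<Rightarrow> sym list \<Rightarrow> bool" where
  "read_so_far n e st p \<longleftrightarrow>
     (if e then open_context n st p else \<exists>q \<alpha>. p = q @ \<alpha> \<and> open_context n st q \<and> \<alpha> \<in> term_strings n)"

lemma open_context_FalseE:
  assumes "open_context n (False # st) p"
  obtains q where "open_context n st q" "p = q @ [LPar]"
  using assms by (cases rule: open_context.cases) auto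

lemma open_context_TrueE:
  assumes "open_context n (True # st) p"
  obtains q \<alpha> where "open_context n st q" "\<alpha> \<in> term_strings n" "p = q @ LPar # \<alpha> @ [Oplus]"
  using assms by (cases rule: open_context.cases) auto

text \<open>The essential case is \<open>RPar\<close>: popping \<open>True\<close> releases the left
  summand stored in the context, which is joined with the term just completed.\<close>

lemma read_so_far_next:
  assumes "read_so_far n e st p" "next_state n e st x = Some (e', st')"
  shows "read_so_far n e' st' (p @ [x])"
proof (cases x)
  case Zero
  then show ?thesis using assms term_strings.intros(1)
    by (auto simp: read_so_far_def split: if_splits)
next
  case (Var j)
  then show ?thesis using assms term_strings.intros(2)
    by (auto simp: read_so_far_def split: if_splits)
next
  case LPar
  then show ?thesis using assms open_context.intros(2)
    by (auto simp: read_so_far_def split: if_splits)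
next
  case Star
  then have e: "\<not> e" "e' = False" "st' = st" using assms(2) by (auto split: if_splits)
  then obtain q \<alpha> where "p = q @ \<alpha>" "open_context n st q" "\<alpha> \<in> term_strings n"
    using assms(1) by (auto simp: read_so_far_def)
  then have "p @ [x] = q @ (\<alpha> @ [Star])" "open_context n st' q" "\<alpha> @ [Star] \<in> term_strings n"
    using Star e term_strings.intros(3) by simp_all
  then show ?thesis using e(2) unfolding read_so_far_def by auto
next
  case Oplus
  then obtain st'' where e: "\<not> e" "e'" "st = False # st''" "st' = True # st''"
    using assms(2) by (cases st) (auto split: if_splits)
  then obtain q \<alpha> where q: "p = q @ \<alpha>" "open_context n (False # st'') q" "\<alpha> \<in> term_strings n"
    using assms(1) by (auto simp: read_so_far_def)
  from q(2) obtain r where "open_context n st'' r" "q = r @ [LPar]" by (rule open_context_FalseE)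
  then show ?thesis using e Oplus q open_context.intros(3) by (auto simp: read_so_far_def)
next
  case RPar
  then obtain st'' where e: "\<not> e" "\<not> e'" "st = True # st''" "st' = st''"
    using assms(2) by (cases st) (auto split: if_splits)
  then obtain q \<beta> where q: "p = q @ \<beta>" "open_context n (True # st'') q" "\<beta> \<in> term_strings n"
    using assms(1) by (auto simp: read_so_far_def)
  from q(2) obtain r \<alpha> where r: "open_context n st'' r" "\<alpha> \<in> term_strings n"
    "q = r @ LPar # \<alpha> @ [Oplus]" by (rule open_context_TrueE)
  have "LPar # \<alpha> @ Oplus # \<beta> @ [RPar] \<in> term_strings n"
    using r q by (intro term_strings.intros)
  moreover have "p @ [x] = r @ (LPar # \<alpha> @ Oplus # \<beta> @ [RPar])" using q r RPar by simp
  ultimately show ?thesis using e(2,4) r(1) unfolding read_so_far_def by auto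
qed

lemma scan_sound:
  assumes "scan n e st s = Some (c, rest)" "read_so_far n e st p"
  shows "s = c @ rest \<and> p @ c \<in> term_strings n"
  using assms
proof (induction s arbitrary: e st c p)
  case Nil
  then show ?case
    by (auto simp: read_so_far_def elim: open_context.cases split: if_splits)
next
  case (Cons x s)
  show ?case
  proof (cases "next_state n e st x")
    case None
    then show ?thesis using Cons.prems
      by (auto simp: read_so_far_def elim: open_context.cases split: if_splits)
  next
    case (Some a)
    then obtain e' st' where a: "next_state n e st x = Some (e', st')" by (cases a) auto
    then obtain c' where c: "scan n e' st' s = Some (c', rest)" "c = x # c'"
      using Cons.prems(1) by (auto simp: apfst_def map_prod_def split: prod.splits)
    show ?thesis
      using Cons.IH[OF c(1) read_so_far_next[OF Cons.prems(2) a]] c(2) by simp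
  qed
qed

lemma scan_term_sound:
  assumes "scan n True [] s = Some (c, rest)"
  shows "s = c @ rest" "c \<in> term_strings n"
  using scan_sound[OF assms, of "[]"] by (auto simp: read_so_far_def intro: open_context.intros)

text \<open>With an empty stack \<open>RPar\<close> cannot continue a completed term, so the scanner
  recovers the first component, and the rest of the string gives the second.\<close>

lemma pair_code_eq_iff:
  assumes "\<phi> \<in> term_strings n" "\<phi>' \<in> term_strings n"
  shows "pair_code \<phi> \<psi> = pair_code \<phi>' \<psi>' \<longleftrightarrow> \<phi> = \<phi>' \<and> \<psi> = \<psi>'"
proof
  assume "pair_code \<phi> \<psi> = pair_code \<phi>' \<psi>'"
  then have eq: "\<phi> @ RPar # LPar # \<psi> @ [RPar] = \<phi>' @ RPar # LPar # \<psi>' @ [RPar]"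
    by (simp add: pair_code_def)
  have "scan n True [] (\<phi> @ RPar # LPar # \<psi> @ [RPar]) = Some (\<phi>, RPar # LPar # \<psi> @ [RPar])"
    "scan n True [] (\<phi>' @ RPar # LPar # \<psi>' @ [RPar]) = Some (\<phi>', RPar # LPar # \<psi>' @ [RPar])"
    by (rule scan_term; use assms in simp)+
  then show "\<phi> = \<phi>' \<and> \<psi> = \<psi>'" unfolding eq by simp
qed simp

section \<open>The parsing machine\<close>

abbreviation code :: "sym list \<Rightarrow> nat list" where
  "code \<sigma> \<equiv> concat (map sym_code \<sigma>)"

text \<open>The entries are 1 and 2 because 0 has to mark the bottom of the stack.\<close>

definition stack_cells :: "bool list \<Rightarrow> nat stream" where
  "stack_cells st = map (\<lambda>b. if b then 2 else 1) st @- blank"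

text \<open>The head rests on the top entry, at position \<open>length st\<close>, and cell 0 is the
  blank bottom. A push is therefore a move followed by a write, whence the additional state 4 of the
  parser.\<close>

definition stack_tape :: "bool list \<Rightarrow> tape" where
  "stack_tape st = (int (length st), stl (stack_cells st), shd (stack_cells st) ## blank)"

text \<open>
  States 0 and 3 correspond to the two values of the flag, in state 4 an opening parenthesis is
  being pushed, and in state \<open>5 + m\<close> already \<open>m\<close> strokes of a variable have been read.
\<close>

definition parse_action :: "nat \<Rightarrow> nat \<Rightarrow> nat \<Rightarrow> (nat \<Rightarrow> nat) \<Rightarrow> nat \<times> actions" where
  "parse_action n k q r = (let copy = [(0, r 0, 1), (k, r 0, 1)] in
     if q = 0 then
       if r 0 = 1 then (3, copy) else if r 0 = 6 then (5, copy)
       else if r 0 = 4 then (4, (2, r 2, 1) # copy) else (2, [])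
     else if q = 3 then
       if r 0 = 2 then (3, copy) else if r 2 = 0 then (1, [])
       else if r 0 = 3 \<and> r 2 = 1 then (0, (2, 2, 0) # copy)
       else if r 0 = 5 \<and> r 2 = 2 then (3, (2, 0, -1) # copy) else (2, [])
     else if q = 4 then (0, [(2, 1, 0)])
     else if r 0 = 7 then if q < 5 + n then (Suc q, copy) else (2, [])
     else (3, []))"

definition parse_tm :: "nat \<Rightarrow> nat \<Rightarrow> tm" where
  "parse_tm n k = tm5 (6 + n) (parse_action n k)"

lemma parse_ok: "tm5_ok (parse_tm n k)"
  unfolding parse_tm_def by (rule tm5_okI) (auto simp: parse_action_def Let_def split: if_splits)

text \<open>The net effect of a parser run: \<open>w\<close> has passed from the input to tape
  \<open>k\<close>, leaving stack \<open>st\<close> and input \<open>v\<close>. Successive runs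
  compose by appending the words \<open>w\<close>.\<close>

definition advance :: "nat \<Rightarrow> nat list \<Rightarrow> bool list \<Rightarrow> nat list \<Rightarrow> (nat \<Rightarrow> tape) \<Rightarrow> nat \<Rightarrow> tape" where
  "advance k w st v Z = Z(
     0 := (fst (Z 0) + int (length w), rev w @- fst (snd (Z 0)), v @- blank),
     2 := stack_tape st,
     k := (fst (Z k) + int (length w), rev w @- fst (snd (Z k)), blank))"

definition parsing :: "nat \<Rightarrow> bool list \<Rightarrow> nat list \<Rightarrow> (nat \<Rightarrow> tape) \<Rightarrow> bool" where
  "parsing k st v Z \<longleftrightarrow> snd (snd (Z 0)) = v @- blank \<and> Z 2 = stack_tape st \<and> snd (snd (Z k)) = blank"

lemma advance_simps:
  assumes "k \<in> {3, 4}"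
  shows "parsing k st v (advance k w st v Z)"
    "advance k w' st' v' (advance k w st v Z) = advance k (w @ w') st' v' Z"
    "advance k w st v Z 1 = Z 1"
  using assms by (auto simp: parsing_def advance_def fun_eq_iff)

lemma advance_Nil: "k \<in> {3, 4} \<Longrightarrow> parsing k st v Z \<Longrightarrow> advance k [] st v Z = Z"
  by (auto simp: parsing_def advance_def fun_eq_iff prod_eq_iff)

lemma rd_parsing:
  assumes "parsing k st v Z"
  shows "rd (Z 0) = (if v = [] then 0 else hd v)"
    "rd (Z 2) = (if st = [] then 0 else if hd st then 2 else 1)"
proof -
  show "rd (Z 0) = (if v = [] then 0 else hd v)"
    using assms by (cases "Z 0"; cases v) (auto simp: parsing_def)
  show "rd (Z 2) = (if st = [] then 0 else if hd st then 2 else 1)"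
    using assms by (cases st) (auto simp: parsing_def stack_tape_def stack_cells_def)
qed

lemma act_copy:
  assumes "k \<in> {3, 4}" "parsing k st (x # v) Z"
  shows "act [(0, x, 1), (k, x, 1)] Z = advance k [x] st v Z"
  using assms by (cases "Z 0"; cases "Z k") (auto simp: parsing_def advance_def fun_eq_iff)

lemma act_copy_stack:
  assumes "k \<in> {3, 4}" "parsing k st (x # v) Z" "mv d (wr s (stack_tape st)) = stack_tape st'"
  shows "act ((2, s, d) # [(0, x, 1), (k, x, 1)]) Z = advance k [x] st' v Z"
  using assms by (cases "Z 0"; cases "Z k") (auto simp: parsing_def advance_def fun_eq_iff)

lemma parse_run:
  assumes "q \<notin> {1, 2}" "parse_action n k q (scanned Z) = (q', as)" "k \<in> {3, 4}"
    "\<forall>(i, s, d) \<in> set as. i < 5 \<and> d \<in> {-1, 0, 1}"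
    "run (parse_tm n k) t (conf q' (act as Z)) c"
  shows "run (parse_tm n k) (Suc t) (conf q Z) c"
  using assms unfolding parse_tm_def by (intro tm5_run_Suc)

text \<open>\<open>Var j\<close> has \<open>Suc j\<close> strokes, so \<open>j < n\<close> means at
  most \<open>n\<close> of them, and state \<open>5 + n\<close> refuses any further one. The
  additional step looks at the next cell without consuming it.\<close>

lemma parse_strokes:
  assumes "k \<in> {3, 4}" "parsing k st (replicate i 7 @ v) Z" "v = [] \<or> hd v \<noteq> 7"
    and "m + i \<le> n"
  shows "run (parse_tm n k) (Suc i) (conf (5 + m) Z) (conf 3 (advance k (replicate i 7) st v Z))"
  using assms(2,4)
proof (induction i arbitrary: m Z)
  case 0
  then have "act [] Z = advance k (replicate 0 7) st v Z"
    using advance_Nil[OF assms(1)] by simp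
  then have "run (parse_tm n k) 0 (conf 3 (act [] Z)) (conf 3 (advance k (replicate 0 7) st v Z))"
    by (simp only: run_refl)
  then show ?case
    by (rule parse_run[rotated 4])
      (use 0 assms(1,3) rd_parsing(1)[of k st v Z] in \<open>auto simp: parse_action_def scanned_def\<close>)
next
  case (Suc i)
  have p: "parsing k st (7 # replicate i 7 @ v) Z" using Suc.prems by simp
  let ?Z = "act [(0, 7, 1), (k, 7, 1)] Z"
  have "run (parse_tm n k) (Suc i) (conf (5 + Suc m) ?Z) (conf 3 (advance k (replicate i 7) st v ?Z))"
    by (rule Suc.IH) (use Suc.prems advance_simps(1)[OF assms(1)] in \<open>simp_all add: act_copy[OF assms(1) p] del: act_simps\<close>)
  then have "run (parse_tm n k) (Suc i) (conf (5 + Suc m) ?Z)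
      (conf 3 (advance k (replicate (Suc i) 7) st v Z))"
    by (simp add: act_copy[OF assms(1) p] advance_simps(2)[OF assms(1)] del: act_simps)
  then show ?case
    by (rule parse_run[rotated 4])
      (use Suc.prems assms(1) rd_parsing(1)[OF p] in \<open>auto simp: parse_action_def scanned_def\<close>)
qed

text \<open>The time must not depend on \<open>i\<close>, which the number of input symbols does not
  control.\<close>

lemma parse_strokes_fail:
  assumes "k \<in> {3, 4}" "parsing k st (replicate i 7 @ v) Z" "m \<le> n" "n < m + i"
  shows "\<exists>Z'. run (parse_tm n k) (Suc (n - m)) (conf (5 + m) Z) (conf 2 Z') \<and> Z' 1 = Z 1"
  using assms(2-)
proof (induction i arbitrary: m Z)
  case 0
  then show ?case by simp
next
  case (Suc i)
  have p: "parsing k st (7 # replicate i 7 @ v) Z" using Suc.prems by simp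
  let ?Z = "act [(0, 7, 1), (k, 7, 1)] Z"
  show ?case
  proof (cases "m = n")
    case True
    have "run (parse_tm n k) 0 (conf 2 (act [] Z)) (conf 2 Z)" by (simp add: run_refl)
    then have "run (parse_tm n k) (Suc 0) (conf (5 + m) Z) (conf 2 Z)"
      by (rule parse_run[rotated 4])
        (use True assms(1) rd_parsing(1)[OF p] in \<open>auto simp: parse_action_def scanned_def\<close>)
    then show ?thesis using True by auto
  next
    case False
    have "\<exists>Z'. run (parse_tm n k) (Suc (n - Suc m)) (conf (5 + Suc m) ?Z) (conf 2 Z') \<and> Z' 1 = ?Z 1"
      by (rule Suc.IH) (use False Suc.prems advance_simps(1)[OF assms(1)] in \<open>simp_all add: act_copy[OF assms(1) p] del: act_simps\<close>)
    then obtain Z' where Z': "run (parse_tm n k) (Suc (n - Suc m)) (conf (5 + Suc m) ?Z) (conf 2 Z')"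
      "Z' 1 = Z 1"
      by (auto simp: act_copy[OF assms(1) p] advance_simps(3)[OF assms(1), simplified] simp del: act_simps)
    from Z'(1) have "run (parse_tm n k) (Suc (Suc (n - Suc m))) (conf (5 + m) Z) (conf 2 Z')"
      by (rule parse_run[rotated 4])
        (use False Suc.prems assms(1) rd_parsing(1)[OF p] in \<open>auto simp: parse_action_def scanned_def\<close>)
    then show ?thesis using Z'(2) False Suc.prems by (auto simp: Suc_diff_Suc)
  qed
qed

lemma stack_moves:
  "mv 0 (wr 1 (mv 1 (wr (rd (stack_tape st)) (stack_tape st)))) = stack_tape (False # st)"
  "mv 0 (wr 2 (stack_tape (b # st))) = stack_tape (True # st)"
  "mv (-1) (wr 0 (stack_tape (b # st))) = stack_tape st"
  by (auto simp: stack_tape_def stack_cells_def stream.expand)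

definition flag_state :: "bool \<Rightarrow> nat" where
  "flag_state e = (if e then 0 else 3)"

text \<open>No code of a symbol begins with a stroke, so one cell of lookahead tells where an index
  ends.\<close>

lemma hd_code_not_stroke: "code s = [] \<or> hd (code s) \<noteq> 7"
  by (cases s; cases "hd s") auto

text \<open>The bound comes from \<open>Var j\<close>: one step for the letter, \<open>Suc j\<close>
  for the strokes and one for leaving the stroke states, with \<open>j < n\<close>. Every other
  symbol takes at most two steps.\<close>

lemma parse_symbol:
  assumes k: "k \<in> {3, 4}" and p: "parsing k st (code (x # s)) Z"
    and nx: "next_state n e st x = Some (e', st')"
  shows "run (parse_tm n k) (n + 2) (conf (flag_state e) Z)
    (conf (flag_state e') (advance k (sym_code x) st' (code s) Z))"
proof -
  note rd = rd_parsing[OF p]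
  have simple: "run (parse_tm n k) (n + 2) (conf (flag_state e) Z)
      (conf (flag_state e') (advance k (sym_code x) st' (code s) Z))"
    if "sym_code x = [y]" "st' = st"
      "parse_action n k (flag_state e) (scanned Z) = (flag_state e', [(0, y, 1), (k, y, 1)])" for y
  proof -
    have "run (parse_tm n k) 0 (conf (flag_state e') (act [(0, y, 1), (k, y, 1)] Z))
        (conf (flag_state e') (advance k (sym_code x) st' (code s) Z))"
      using act_copy[OF k, of st y "code s" Z] p that by (simp add: run_refl)
    then have "run (parse_tm n k) (Suc 0) (conf (flag_state e) Z)
        (conf (flag_state e') (advance k (sym_code x) st' (code s) Z))"
      by (rule parse_run[rotated 4, OF _ _ that(3)]) (use k in \<open>auto simp: flag_state_def\<close>)
    then show ?thesis by (rule run_mono) simp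
  qed
  have stacked: "run (parse_tm n k) (n + 2) (conf (flag_state e) Z)
      (conf (flag_state e') (advance k (sym_code x) st' (code s) Z))"
    if "sym_code x = [y]" "mv d (wr a (stack_tape st)) = stack_tape st'" "d \<in> {-1, 0}"
      "parse_action n k (flag_state e) (scanned Z) = (flag_state e', (2, a, d) # [(0, y, 1), (k, y, 1)])"
    for y a d
  proof -
    have "run (parse_tm n k) 0 (conf (flag_state e') (act ((2, a, d) # [(0, y, 1), (k, y, 1)]) Z))
        (conf (flag_state e') (advance k (sym_code x) st' (code s) Z))"
      using act_copy_stack[OF k, of st y "code s" Z d a st'] p that by (simp only:) (simp add: run_refl)
    then have "run (parse_tm n k) (Suc 0) (conf (flag_state e) Z)
        (conf (flag_state e') (advance k (sym_code x) st' (code s) Z))"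
      by (rule parse_run[rotated 4, OF _ _ that(4)]) (use k that(3) in \<open>auto simp: flag_state_def\<close>)
    then show ?thesis by (rule run_mono) simp
  qed
  show ?thesis
  proof (cases x)
    case Zero
    then show ?thesis using nx k rd
      by (intro simple) (auto simp: parse_action_def scanned_def flag_state_def split: if_splits)
  next
    case Star
    then show ?thesis using nx k rd
      by (intro simple) (auto simp: parse_action_def scanned_def flag_state_def split: if_splits)
  next
    case Oplus
    then obtain st'' where st: "st = False # st''" "st' = True # st''" "\<not> e" "e'"
      using nx by (cases st) (auto split: if_splits)
    show ?thesis
      by (rule stacked[of 3 0 2]) (use Oplus st k rd stack_moves(2)[of False st''] in
          \<open>auto simp: parse_action_def scanned_def flag_state_def\<close>)
  next
    case RPar
    then obtain st'' where st: "st = True # st''" "st' = st''" "\<not> e" "\<not> e'"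
      using nx by (cases st) (auto split: if_splits)
    show ?thesis
      by (rule stacked[of 5 "-1" 0]) (use RPar st k rd stack_moves(3)[of True st''] in
          \<open>auto simp: parse_action_def scanned_def flag_state_def\<close>)
  next
    case LPar
    then have e: "e" "e'" "st' = False # st" using nx by (auto split: if_splits)
    let ?as = "(2, rd (Z 2), 1) # [(0, 4, 1), (k, 4, 1)]"
    have "act [(2, 1, 0)] (act ?as Z) = advance k (sym_code x) st' (code s) Z"
      using k p LPar e stack_moves(1)[of st]
      by (cases "Z 0"; cases "Z k") (auto simp: parsing_def advance_def fun_eq_iff)
    then have "run (parse_tm n k) 0 (conf 0 (act [(2, 1, 0)] (act ?as Z)))
        (conf 0 (advance k (sym_code x) st' (code s) Z))"
      by (simp only: run_refl)
    then have "run (parse_tm n k) (Suc 0) (conf 4 (act ?as Z))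
        (conf 0 (advance k (sym_code x) st' (code s) Z))"
      by (rule parse_run[rotated 4]) (use k in \<open>auto simp: parse_action_def\<close>)
    then have "run (parse_tm n k) (Suc (Suc 0)) (conf 0 Z)
        (conf 0 (advance k (sym_code x) st' (code s) Z))"
      by (rule parse_run[rotated 4])
        (use k rd LPar in \<open>auto simp: parse_action_def scanned_def\<close>)
    then show ?thesis using e run_mono[of _ 2 _ _ "n + 2"] by (simp add: flag_state_def numeral_2_eq_2)
  next
    case (Var j)
    then have e: "e" "\<not> e'" "j < n" "st' = st" using nx by (auto split: if_splits)
    have p': "parsing k st (6 # replicate (Suc j) 7 @ code s) Z" using p Var by simp
    let ?Z = "act [(0, 6, 1), (k, 6, 1)] Z"
    have "parsing k st (replicate (Suc j) 7 @ code s) ?Z"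
      by (simp only: act_copy[OF k p'] advance_simps(1)[OF k])
    then have "run (parse_tm n k) (Suc (Suc j)) (conf (5 + 0) ?Z)
        (conf 3 (advance k (replicate (Suc j) 7) st (code s) ?Z))"
      by (rule parse_strokes[OF k _ hd_code_not_stroke]) (use e in simp)
    then have "run (parse_tm n k) (Suc (Suc j)) (conf 5 ?Z)
        (conf 3 (advance k (sym_code x) st (code s) Z))"
      using Var by (simp add: act_copy[OF k p'] advance_simps(2)[OF k] del: act_simps)
    then have "run (parse_tm n k) (Suc (Suc (Suc j))) (conf 0 Z)
        (conf 3 (advance k (sym_code x) st (code s) Z))"
      by (rule parse_run[rotated 4])
        (use k rd Var in \<open>auto simp: parse_action_def scanned_def\<close>)
    then show ?thesis using e by (auto simp: flag_state_def elim: run_mono)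
  qed
qed

text \<open>On acceptance the tapes must be known exactly, since later readers continue on them. On
  rejection it suffices that the output tape is untouched.\<close>

lemma parse_stop:
  assumes k: "k \<in> {3, 4}" and p: "parsing k st (code s) Z"
    and nx: "s = [] \<or> next_state n e st (hd s) = None"
  shows "\<exists>Z'. run (parse_tm n k) (n + 2) (conf (flag_state e) Z)
    (conf (if \<not> e \<and> st = [] then 1 else 2) Z') \<and> Z' 1 = Z 1 \<and> (\<not> e \<and> st = [] \<longrightarrow> Z' = Z)"
proof -
  note rd = rd_parsing[OF p]
  have stop: ?thesis
    if "parse_action n k (flag_state e) (scanned Z) = (if \<not> e \<and> st = [] then 1 else 2, [])"
  proof -
    have "run (parse_tm n k) 0 (conf (if \<not> e \<and> st = [] then 1 else 2) (act [] Z))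
        (conf (if \<not> e \<and> st = [] then 1 else 2) Z)"
      by (simp add: run_refl)
    then have "run (parse_tm n k) (Suc 0) (conf (flag_state e) Z) (conf (if \<not> e \<and> st = [] then 1 else 2) Z)"
      by (rule parse_run[rotated 4, OF _ _ that]) (use k in \<open>auto simp: flag_state_def\<close>)
    then have "run (parse_tm n k) (n + 2) (conf (flag_state e) Z) (conf (if \<not> e \<and> st = [] then 1 else 2) Z)"
      by (rule run_mono) simp
    then show ?thesis by blast
  qed
  show ?thesis
  \<comment> \<open>A variable with too large an index, met where a term is expected, is the only
    symbol that is not refused at its first cell.\<close>
  proof (cases "e \<and> (\<exists>j s'. s = Var j # s')")
    case True
    then obtain j s' where s: "s = Var j # s'" and e: e by blast
    then have j: "n \<le> j" using nx by (auto split: if_splits)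
    have p': "parsing k st (6 # replicate (Suc j) 7 @ code s') Z" using p s by simp
    let ?Z = "act [(0, 6, 1), (k, 6, 1)] Z"
    have "parsing k st (replicate (Suc j) 7 @ code s') ?Z"
      by (simp only: act_copy[OF k p'] advance_simps(1)[OF k])
    then have "\<exists>Z'. run (parse_tm n k) (Suc (n - 0)) (conf (5 + 0) ?Z) (conf 2 Z') \<and> Z' 1 = ?Z 1"
      by (rule parse_strokes_fail[OF k]) (use j in auto)
    then obtain Z' where Z': "run (parse_tm n k) (Suc n) (conf 5 ?Z) (conf 2 Z')" "Z' 1 = Z 1"
      by (auto simp: act_copy[OF k p'] advance_simps(3)[OF k, simplified] simp del: act_simps)
    from Z'(1) have "run (parse_tm n k) (Suc (Suc n)) (conf 0 Z) (conf 2 Z')"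
      by (rule parse_run[rotated 4]) (use k rd s in \<open>auto simp: parse_action_def scanned_def\<close>)
    then show ?thesis using e Z'(2) by (auto simp: flag_state_def)
  next
    case False
    show ?thesis
    proof (rule stop, cases s)
      case Nil
      then show "parse_action n k (flag_state e) (scanned Z) = (if \<not> e \<and> st = [] then 1 else 2, [])"
        using rd by (auto simp: parse_action_def scanned_def flag_state_def)
    next
      case (Cons x s')
      then show "parse_action n k (flag_state e) (scanned Z) = (if \<not> e \<and> st = [] then 1 else 2, [])"
        using nx rd False by (cases x) (auto simp: parse_action_def scanned_def flag_state_def split: if_splits)
    qed
  qed
qed

lemma parse_scan:
  assumes k: "k \<in> {3, 4}" and "parsing k st (code s) Z"
  shows "case scan n e st s of
      Some (c, rest) \<Rightarrow> run (parse_tm n k) ((n + 2) * Suc (length s)) (conf (flag_state e) Z)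
        (conf 1 (advance k (code c) [] (code rest) Z))
    | None \<Rightarrow> \<exists>Z'. run (parse_tm n k) ((n + 2) * Suc (length s)) (conf (flag_state e) Z) (conf 2 Z') \<and> Z' 1 = Z 1"
  using assms(2)
proof (induction s arbitrary: e st Z)
  case Nil
  then show ?case
    using parse_stop[OF k Nil, of n e] advance_Nil[OF k, of st "[]" Z] by (auto split: if_splits)
next
  case (Cons x s)
  have mono: "n + 2 \<le> (n + 2) * Suc (length (x # s))" by simp
  show ?case
  proof (cases "next_state n e st x")
    case None
    obtain Z' where Z': "run (parse_tm n k) (n + 2) (conf (flag_state e) Z)
        (conf (if \<not> e \<and> st = [] then 1 else 2) Z')"
      "Z' 1 = Z 1" "\<not> e \<and> st = [] \<Longrightarrow> Z' = Z"
      using parse_stop[OF k Cons.prems, of n e] None by auto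
    show ?thesis
      using None run_mono[OF Z'(1) mono] Z'(2,3) advance_Nil[OF k Cons.prems]
      by (cases "\<not> e \<and> st = []") auto
  next
    case (Some a)
    then obtain e' st' where nx: "next_state n e st x = Some (e', st')" by (cases a) auto
    let ?Z = "advance k (sym_code x) st' (code s) Z"
    note first = parse_symbol[OF k Cons.prems nx]
    have time: "(n + 2) + (n + 2) * Suc (length s) = (n + 2) * Suc (length (x # s))" by simp
    have IH: "parsing k st' (code s) ?Z" by (rule advance_simps(1)[OF k])
    note IH = Cons.IH[OF this, of e']
    show ?thesis
    proof (cases "scan n e' st' s")
      case None
      then obtain Z' where "run (parse_tm n k) ((n + 2) * Suc (length s)) (conf (flag_state e') ?Z) (conf 2 Z')"
        "Z' 1 = Z 1"
        using IH advance_simps(3)[OF k] by auto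
      from run_trans[OF first this(1)]
      have "run (parse_tm n k) ((n + 2) * Suc (length (x # s))) (conf (flag_state e) Z) (conf 2 Z')"
        unfolding time .
      then show ?thesis using nx None \<open>Z' 1 = Z 1\<close> by auto
    next
      case (Some b)
      then obtain c rest where c: "scan n e' st' s = Some (c, rest)" by (cases b) auto
      then have "run (parse_tm n k) ((n + 2) * Suc (length s)) (conf (flag_state e') ?Z)
          (conf 1 (advance k (code c) [] (code rest) ?Z))"
        using IH by simp
      from run_trans[OF first this]
      have "run (parse_tm n k) ((n + 2) * Suc (length (x # s))) (conf (flag_state e) Z)
          (conf 1 (advance k (code c) [] (code rest) ?Z))"
        unfolding time .
      then show ?thesis using nx c by (simp add: advance_simps(2)[OF k])
    qed
  qed
qed

section \<open>Substitution into templates\<close>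

datatype piece = Lit "sym list" | Arg bool

fun piece_string :: "sym list \<Rightarrow> sym list \<Rightarrow> piece \<Rightarrow> sym list" where
  "piece_string \<phi> \<psi> (Lit s) = s"
| "piece_string \<phi> \<psi> (Arg b) = (if b then \<psi> else \<phi>)"

definition inst :: "sym list \<Rightarrow> sym list \<Rightarrow> piece list \<Rightarrow> sym list" where
  "inst \<phi> \<psi> ps = concat (map (piece_string \<phi> \<psi>) ps)"

lemma inst_simps [simp]:
  "inst \<phi> \<psi> [] = []"
  "inst \<phi> \<psi> (p # ps) = piece_string \<phi> \<psi> p @ inst \<phi> \<psi> ps"
  "inst \<phi> \<psi> (ps @ qs) = inst \<phi> \<psi> ps @ inst \<phi> \<psi> qs"
  by (simp_all add: inst_def)

definition written :: "nat list \<Rightarrow> tape" where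
  "written w = (int (length w), rev w @- blank, blank)"

definition put_word_tm :: "nat list \<Rightarrow> tm" where
  "put_word_tm w = foldr (\<lambda>s M. seq_tm (put_tm s) M) w skip_tm"

fun piece_tm :: "piece \<Rightarrow> tm" where
  "piece_tm (Lit s) = put_word_tm (code s)"
| "piece_tm (Arg b) = (let k = if b then 4 else 3 in seq_tm (rewind_tm k) (copy_tm k))"

text \<open>The final rewind is there because \<open>polytime_computable\<close> wants the head at
  the beginning of the output.\<close>

definition emit_tm :: "piece list \<Rightarrow> tm" where
  "emit_tm ps = foldr (\<lambda>p M. seq_tm (piece_tm p) M) ps (rewind_tm 1)"

lemma code_symbols: "x \<in> set (code s) \<Longrightarrow> 0 < x \<and> x < 8"
  using sym_code_less by auto

lemma zero_notin_code: "0 \<notin> set (code s)"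
  using code_symbols by blast

lemma put_word_ok: "\<forall>s\<in>set w. s < 8 \<Longrightarrow> tm5_ok (put_word_tm w)"
  unfolding put_word_tm_def by (induction w) (auto intro: tm5_ok_seq basic_ok)

lemma piece_ok: "tm5_ok (piece_tm p)"
  by (cases p) (use code_symbols in \<open>auto simp: Let_def intro!: tm5_ok_seq basic_ok put_word_ok\<close>)

lemma emit_ok: "tm5_ok (emit_tm ps)"
  unfolding emit_tm_def by (induction ps) (auto intro: tm5_ok_seq basic_ok piece_ok)

lemma exec_put_word:
  assumes "\<forall>s\<in>set w. s < 8" "Z 1 = written o'"
  shows "exec (put_word_tm w) (length w + 1) Z True (Z(1 := written (o' @ w)))"
  using assms
proof (induction w arbitrary: Z o')
  case Nil
  then have "Z(1 := written (o' @ [])) = Z" by auto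
  then show ?case using exec_skip[of Z] by (simp add: put_word_tm_def)
next
  case (Cons s w)
  let ?Z = "Z(1 := written (o' @ [s]))"
  have "exec (put_tm s) 1 Z True ?Z"
    using exec_put[of s Z] Cons.prems by (simp add: written_def add.commute)
  moreover have "exec (put_word_tm w) (length w + 1) ?Z True (?Z(1 := written ((o' @ [s]) @ w)))"
    by (rule Cons.IH) (use Cons.prems in auto)
  ultimately have "exec (seq_tm (put_tm s) (put_word_tm w)) (1 + (length w + 1)) Z True
      (?Z(1 := written ((o' @ [s]) @ w)))"
    by (rule exec_seq) (use Cons.prems in \<open>auto intro: basic_ok put_word_ok\<close>)
  then show ?case by (simp add: put_word_tm_def fun_upd_def cong: if_cong)
qed

definition args_written :: "sym list \<Rightarrow> sym list \<Rightarrow> (nat \<Rightarrow> tape) \<Rightarrow> bool" where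
  "args_written \<phi> \<psi> Z \<longleftrightarrow> Z 3 = written (code \<phi>) \<and> Z 4 = written (code \<psi>)"

lemma exec_piece:
  assumes "args_written \<phi> \<psi> Z" "Z 1 = written (code s)"
  shows "exec (piece_tm p) (2 * length (code (piece_string \<phi> \<psi> p)) + 3) Z True
    (Z(1 := written (code (s @ piece_string \<phi> \<psi> p))))"
proof (cases p)
  case (Lit u)
  have "exec (put_word_tm (code u)) (length (code u) + 1) Z True (Z(1 := written (code s @ code u)))"
    by (rule exec_put_word) (use code_symbols assms in auto)
  then show ?thesis using Lit by (auto elim: exec_mono)
next
  case (Arg b)
  define k :: nat where "k = (if b then 4 else 3)"
  let ?w = "code (piece_string \<phi> \<psi> p)"
  have k: "k \<noteq> 1" "k < 5" "Z k = written ?w"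
    using assms(1) Arg by (auto simp: k_def args_written_def)
  let ?Z = "Z(k := (0, blank, ?w @- blank))"
  have "exec (rewind_tm k) (length ?w + 2) Z True ?Z"
    by (rule exec_rewind[OF k(2) zero_notin_code]) (use k in \<open>simp add: written_def\<close>)
  moreover have "exec (copy_tm k) (Suc (length ?w)) ?Z True
      (?Z(k := (0 + int (length ?w), rev ?w @- blank, blank),
        1 := (int (length (code s)) + int (length ?w), rev ?w @- rev (code s) @- blank, blank)))"
    by (rule exec_copy[OF k(1,2) zero_notin_code]) (use k assms(2) in \<open>auto simp: written_def\<close>)
  moreover have "?Z(k := (0 + int (length ?w), rev ?w @- blank, blank),
        1 := (int (length (code s)) + int (length ?w), rev ?w @- rev (code s) @- blank, blank)) =
      Z(1 := written (code (s @ piece_string \<phi> \<psi> p)))"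
    using k by (auto simp: fun_eq_iff written_def)
  ultimately have "exec (seq_tm (rewind_tm k) (copy_tm k)) (length ?w + 2 + Suc (length ?w)) Z True
      (Z(1 := written (code (s @ piece_string \<phi> \<psi> p))))"
    using exec_seq basic_ok by metis
  moreover have "seq_tm (rewind_tm k) (copy_tm k) = piece_tm p" by (simp add: Arg k_def Let_def)
  ultimately show ?thesis by (auto intro: exec_mono)
qed

text \<open>A piece costs twice its length plus 3, for rewinding and copying, and the final rewind
  costs the length of the whole output plus 2; hence the factor 3.\<close>

lemma exec_emit:
  assumes "args_written \<phi> \<psi> Z" "Z 1 = written (code s)"
  shows "exec (emit_tm ps) (length (code s) + 3 * length (code (inst \<phi> \<psi> ps)) + 3 * length ps + 2) Z True
    (Z(1 := (0, blank, code (s @ inst \<phi> \<psi> ps) @- blank)))"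
  using assms
proof (induction ps arbitrary: Z s)
  case Nil
  have "exec (rewind_tm 1) (length (code s) + 2) Z True (Z(1 := (0, blank, code s @- blank)))"
    by (rule exec_rewind[OF _ zero_notin_code]) (use Nil in \<open>auto simp: written_def\<close>)
  then show ?case by (simp add: emit_tm_def fun_upd_def)
next
  case (Cons p ps)
  let ?u = "piece_string \<phi> \<psi> p"
  let ?Z = "Z(1 := written (code (s @ ?u)))"
  note exec_piece[OF Cons.prems]
  moreover have "exec (emit_tm ps) (length (code (s @ ?u)) + 3 * length (code (inst \<phi> \<psi> ps)) + 3 * length ps + 2)
      ?Z True (?Z(1 := (0, blank, code ((s @ ?u) @ inst \<phi> \<psi> ps) @- blank)))"
    by (rule Cons.IH) (use Cons.prems in \<open>auto simp: args_written_def\<close>)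
  ultimately have "exec (seq_tm (piece_tm p) (emit_tm ps))
      (2 * length (code ?u) + 3 + (length (code (s @ ?u)) + 3 * length (code (inst \<phi> \<psi> ps)) + 3 * length ps + 2))
      Z True (?Z(1 := (0, blank, code ((s @ ?u) @ inst \<phi> \<psi> ps) @- blank)))"
    by (rule exec_seq[OF _ _ piece_ok emit_ok])
  then show ?case by (simp add: emit_tm_def fun_upd_def algebra_simps cong: if_cong)
qed

text \<open>For a fixed template the number of literal symbols and of argument occurrences is
  constant, so the output is linear in the arguments.\<close>

lemma length_code_inst:
  "\<exists>L. \<forall>\<phi> \<psi> m. length (code \<phi>) \<le> m \<longrightarrow> length (code \<psi>) \<le> m \<longrightarrow>
     length (code (inst \<phi> \<psi> ps)) \<le> L * Suc m"
proof (induction ps)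
  case Nil
  then show ?case by simp
next
  case (Cons p ps)
  then obtain L where L: "\<And>\<phi> \<psi> m. length (code \<phi>) \<le> m \<Longrightarrow> length (code \<psi>) \<le> m \<Longrightarrow>
     length (code (inst \<phi> \<psi> ps)) \<le> L * Suc m" by blast
  obtain K where K: "\<And>\<phi> \<psi> m. length (code \<phi>) \<le> m \<Longrightarrow> length (code \<psi>) \<le> m \<Longrightarrow>
     length (code (piece_string \<phi> \<psi> p)) \<le> K * Suc m"
  proof (cases p)
    case (Lit s)
    then show ?thesis by (intro that[of "length (code s)"]) simp
  next
    case (Arg b)
    then show ?thesis by (intro that[of 1]) simp
  qed
  have "length (code (inst \<phi> \<psi> (p # ps))) \<le> (K + L) * Suc m"
    if "length (code \<phi>) \<le> m" "length (code \<psi>) \<le> m" for \<phi> \<psi> m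
    using add_mono[OF K[OF that] L[OF that]] by (simp add: algebra_simps)
  then show ?case by blast
qed

text \<open>The bound on the variables of a term limits each symbol to at most \<open>n + 1\<close>
  cells; this relates tape length to the number of symbols.\<close>

lemma length_code_term: "\<phi> \<in> term_strings n \<Longrightarrow> length (code \<phi>) \<le> (n + 2) * length \<phi>"
  by (induction rule: term_strings.induct) (auto simp: algebra_simps)

section \<open>Reading the input\<close>

type_synonym reader = "sym list \<times> sym list \<times> sym list \<Rightarrow> (sym list \<times> sym list \<times> sym list) option"

fun reading :: "nat \<Rightarrow> sym list \<times> sym list \<times> sym list \<Rightarrow> (nat \<Rightarrow> tape) \<Rightarrow> bool" where
  "reading N (s, \<phi>, \<psi>) Z \<longleftrightarrow> length s \<le> N \<and> snd (snd (Z 0)) = code s @- blank \<and> Z 1 = written [] \<and>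
     Z 2 = written [] \<and> args_written \<phi> \<psi> Z"

text \<open>The time \<open>T\<close> is uniform over all inputs of at most \<open>N\<close>
  symbols. After a failure only the output tape is described: it is blank with its head at 0, as
  required for the empty string.\<close>

definition reads :: "nat \<Rightarrow> nat \<Rightarrow> tm \<Rightarrow> reader \<Rightarrow> bool" where
  "reads N T M f \<longleftrightarrow> tm5_ok M \<and> (\<forall>S Z. reading N S Z \<longrightarrow>
     (case f S of
        None \<Rightarrow> \<exists>Z'. exec M T Z False Z' \<and> Z' 1 = written []
      | Some S' \<Rightarrow> \<exists>Z'. exec M T Z True Z' \<and> reading N S' Z'))"

fun read_all :: "(tm \<times> reader) list \<Rightarrow> reader" where
  "read_all [] S = Some S"
| "read_all ((M, f) # Ms) S = (case f S of None \<Rightarrow> None | Some S' \<Rightarrow> read_all Ms S')"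

definition read_then :: "(tm \<times> reader) list \<Rightarrow> tm \<Rightarrow> tm" where
  "read_then Ms B = foldr (\<lambda>(M, f) B. seq_tm M B) Ms B"

lemma read_then_ok:
  assumes "\<forall>(M, f)\<in>set Ms. reads N T M f" "tm5_ok B"
  shows "tm5_ok (read_then Ms B)"
  using assms(1) unfolding read_then_def
  by (induction Ms) (auto simp: reads_def assms(2) intro: tm5_ok_seq)

text \<open>The success case quantifies over the runs of \<open>B\<close>, because the tapes
  \<open>Z1\<close> on which \<open>B\<close> starts are known only through
  \<open>reading\<close>.\<close>

lemma exec_read_then:
  assumes "\<forall>(M, f)\<in>set Ms. reads N T M f" "tm5_ok B" "reading N S Z"
  shows "case read_all Ms S of
      None \<Rightarrow> \<exists>Z'. exec (read_then Ms B) (T * length Ms) Z True Z' \<and> Z' 1 = written []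
    | Some S' \<Rightarrow> \<exists>Z1. reading N S' Z1 \<and> (\<forall>t Z'. exec B t Z1 True Z' \<longrightarrow>
        exec (read_then Ms B) (T * length Ms + t) Z True Z')"
  using assms(1,3)
proof (induction Ms arbitrary: S Z)
  case Nil
  then show ?case by (auto simp: read_then_def)
next
  case (Cons a Ms)
  obtain M f where a: "a = (M, f)" by (cases a)
  have M: "reads N T M f" "tm5_ok M" using Cons.prems(1) a by (auto simp: reads_def)
  have ok: "tm5_ok (read_then Ms B)" using read_then_ok[OF _ assms(2), of Ms N T] Cons.prems(1) by simp
  have seq: "read_then (a # Ms) B = seq_tm M (read_then Ms B)" by (simp add: a read_then_def)
  show ?case
  proof (cases "f S")
    case None
    then obtain Z' where Z': "exec M T Z False Z'" "Z' 1 = written []"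
      using M(1)[unfolded reads_def, THEN conjunct2, rule_format, OF Cons.prems(2)] by auto
    have "exec (read_then (a # Ms) B) (T * length (a # Ms)) Z True Z'"
      unfolding seq by (rule exec_mono[OF exec_seq_reject[OF Z'(1)]]) simp
    then show ?thesis using None a Z'(2) by auto
  next
    case (Some S')
    then obtain Z' where Z': "exec M T Z True Z'" "reading N S' Z'"
      using M(1)[unfolded reads_def, THEN conjunct2, rule_format, OF Cons.prems(2)] by auto
    have chain: "exec (read_then (a # Ms) B) (T * length (a # Ms) + t) Z True Z''"
      if "exec (read_then Ms B) (T * length Ms + t) Z' True Z''" for t Z''
      using exec_seq[OF Z'(1) that M(2) ok] by (simp add: seq add_ac)
    have IH: "case read_all Ms S' of
        None \<Rightarrow> \<exists>Z''. exec (read_then Ms B) (T * length Ms) Z' True Z'' \<and> Z'' 1 = written []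
      | Some S'' \<Rightarrow> \<exists>Z1. reading N S'' Z1 \<and> (\<forall>t Z''. exec B t Z1 True Z'' \<longrightarrow>
          exec (read_then Ms B) (T * length Ms + t) Z' True Z'')"
      by (rule Cons.IH) (use Cons.prems(1) Z'(2) in auto)
    show ?thesis
    proof (cases "read_all Ms S'")
      case None
      then show ?thesis using IH chain[of 0] Some a by auto
    next
      case (Some S'')
      then obtain Z1 where "reading N S'' Z1"
        "\<And>t Z''. exec B t Z1 True Z'' \<Longrightarrow> exec (read_then Ms B) (T * length Ms + t) Z' True Z''"
        using IH by auto
      then show ?thesis using Some \<open>f S = Some S'\<close> a chain by auto
    qed
  qed
qed

fun read_term :: "nat \<Rightarrow> bool \<Rightarrow> reader" where
  "read_term n b (s, \<phi>, \<psi>) = (case scan n True [] s of None \<Rightarrow> None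
     | Some (c, rest) \<Rightarrow> Some (if b then (rest, \<phi>, \<psi> @ c) else (rest, \<phi> @ c, \<psi>)))"

fun read_symbol :: "sym \<Rightarrow> reader" where
  "read_symbol x (s, \<phi>, \<psi>) = (if s \<noteq> [] \<and> hd s = x then Some (tl s, \<phi>, \<psi>) else None)"

fun read_end :: reader where
  "read_end (s, \<phi>, \<psi>) = (if s = [] then Some (s, \<phi>, \<psi>) else None)"

lemma stack_tape_Nil: "stack_tape [] = written []"
  by (simp add: stack_tape_def stack_cells_def written_def)

lemma reads_term: "reads N ((n + 2) * Suc N) (parse_tm n (if b then 4 else 3)) (read_term n b)"
  unfolding reads_def
proof (intro conjI allI impI)
  show "tm5_ok (parse_tm n (if b then 4 else 3))" by (rule parse_ok)
  fix S Z
  assume R: "reading N S Z"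
  obtain s \<phi> \<psi> where S: "S = (s, \<phi>, \<psi>)" by (cases S)
  define k :: nat where "k = (if b then 4 else 3)"
  define u where "u = (if b then \<psi> else \<phi>)"
  have k: "k \<in> {3, 4}" by (simp add: k_def)
  have Zk: "Z k = written (code u)" using R S by (simp add: k_def u_def args_written_def)
  then have p: "parsing k [] (code s) Z"
    using R S by (simp add: parsing_def stack_tape_Nil written_def)
  have "(n + 2) * Suc (length s) \<le> (n + 2) * Suc N" using R S by (intro mult_le_mono) auto
  note mono = exec_mono[OF _ this]
  note scan = parse_scan[OF k p, of n True, unfolded flag_state_def, simplified]
  show "case read_term n b S of
      None \<Rightarrow> \<exists>Z'. exec (parse_tm n (if b then 4 else 3)) ((n + 2) * Suc N) Z False Z' \<and> Z' 1 = written []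
    | Some S' \<Rightarrow> \<exists>Z'. exec (parse_tm n (if b then 4 else 3)) ((n + 2) * Suc N) Z True Z' \<and> reading N S' Z'"
    unfolding k_def[symmetric]
  proof (cases "scan n True [] s")
    case None
    then obtain Z' where Z': "exec (parse_tm n k) ((n + 2) * Suc (length s)) Z False Z'" "Z' 1 = Z 1"
      using scan by (auto simp: exec_def)
    show "case read_term n b S of
        None \<Rightarrow> \<exists>Z'. exec (parse_tm n k) ((n + 2) * Suc N) Z False Z' \<and> Z' 1 = written []
      | Some S' \<Rightarrow> \<exists>Z'. exec (parse_tm n k) ((n + 2) * Suc N) Z True Z' \<and> reading N S' Z'"
      using None S R mono[OF Z'(1)] Z'(2) by auto
  next
    case (Some a)
    then obtain c rest where c: "scan n True [] s = Some (c, rest)" by (cases a) auto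
    let ?Z = "advance k (code c) [] (code rest) Z"
    have "exec (parse_tm n k) ((n + 2) * Suc N) Z True ?Z"
      by (rule mono) (use scan c in \<open>simp add: exec_def\<close>)
    moreover have "length rest \<le> N" using scan_term_sound(1)[OF c] R S by simp
    then have "reading N (if b then (rest, \<phi>, \<psi> @ c) else (rest, \<phi> @ c, \<psi>)) ?Z"
      using R S Zk by (auto simp: advance_def k_def u_def args_written_def stack_tape_Nil written_def)
    ultimately show "case read_term n b S of
        None \<Rightarrow> \<exists>Z'. exec (parse_tm n k) ((n + 2) * Suc N) Z False Z' \<and> Z' 1 = written []
      | Some S' \<Rightarrow> \<exists>Z'. exec (parse_tm n k) ((n + 2) * Suc N) Z True Z' \<and> reading N S' Z'"
      using c S by auto
  qed
qed

text \<open>A single treatment of one-cell symbols and of the end of input, which is the blank 0; in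
  the latter case moving on is consistent because \<open>stl blank = blank\<close>.\<close>

lemma reads_expect:
  assumes "1 \<le> T"
    and "\<And>s \<phi> \<psi>. (case f (s, \<phi>, \<psi>) of None \<Rightarrow> shd (code s @- blank) \<noteq> c
      | Some S' \<Rightarrow> shd (code s @- blank) = c \<and>
          (\<exists>s'. S' = (s', \<phi>, \<psi>) \<and> length s' \<le> length s \<and> code s' @- blank = stl (code s @- blank)))"
  shows "reads N T (expect_tm c) f"
  unfolding reads_def
proof (intro conjI allI impI)
  show "tm5_ok (expect_tm c)" by (rule basic_ok)
  fix S Z
  assume R: "reading N S Z"
  obtain s \<phi> \<psi> where S: "S = (s, \<phi>, \<psi>)" by (cases S)
  have rd: "rd (Z 0) = shd (code s @- blank)" using R S by (cases "Z 0") auto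
  note ex = exec_mono[OF exec_expect[of c Z] assms(1)]
  show "case f S of
      None \<Rightarrow> \<exists>Z'. exec (expect_tm c) T Z False Z' \<and> Z' 1 = written []
    | Some S' \<Rightarrow> \<exists>Z'. exec (expect_tm c) T Z True Z' \<and> reading N S' Z'"
  proof (cases "f S")
    case None
    then have "rd (Z 0) \<noteq> c" using assms(2)[of s \<phi> \<psi>] S rd by simp
    then have "exec (expect_tm c) T Z False Z" using ex by simp
    then show ?thesis using None R S by auto
  next
    case (Some S')
    then obtain s' where s': "S' = (s', \<phi>, \<psi>)" "length s' \<le> length s" "code s' @- blank = stl (code s @- blank)"
      and c: "rd (Z 0) = c"
      using assms(2)[of s \<phi> \<psi>] S rd by auto
    then have "exec (expect_tm c) T Z True (Z(0 := mv 1 (Z 0)))" using ex by simp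
    moreover have "reading N S' (Z(0 := mv 1 (Z 0)))"
      using R S s' by (cases "Z 0") (auto simp: args_written_def)
    ultimately show ?thesis using Some by auto
  qed
qed

lemma reads_symbol:
  assumes "sym_code x = [c]" "1 \<le> T"
  shows "reads N T (expect_tm c) (read_symbol x)"
proof (rule reads_expect[OF assms(2)])
  have c: "c \<in> {1, 2, 3, 4, 5}" using assms(1) by (cases x) auto
  have x: "hd (sym_code y) = c \<longleftrightarrow> y = x" for y using assms(1) by (cases x; cases y) auto
  show "case read_symbol x (s, \<phi>, \<psi>) of None \<Rightarrow> shd (code s @- blank) \<noteq> c
      | Some S' \<Rightarrow> shd (code s @- blank) = c \<and>
          (\<exists>s'. S' = (s', \<phi>, \<psi>) \<and> length s' \<le> length s \<and> code s' @- blank = stl (code s @- blank))"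
    for s \<phi> \<psi>
  proof (cases s)
    case Nil
    then show ?thesis using c by auto
  next
    case (Cons y s')
    then show ?thesis using x[of y] assms(1) by (cases y) auto
  qed
qed

lemma reads_end: "1 \<le> T \<Longrightarrow> reads N T (expect_tm 0) read_end"
proof (rule reads_expect)
  show "case read_end (s, \<phi>, \<psi>) of None \<Rightarrow> shd (code s @- blank) \<noteq> 0
      | Some S' \<Rightarrow> shd (code s @- blank) = 0 \<and>
          (\<exists>s'. S' = (s', \<phi>, \<psi>) \<and> length s' \<le> length s \<and> code s' @- blank = stl (code s @- blank))"
    for s \<phi> \<psi>
  proof (cases s)
    case Nil
    then show ?thesis by simp
  next
    case (Cons y s')
    then show ?thesis by (cases y) auto
  qed
qed

section \<open>Polynomial-time computability of template substitutions\<close>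

lemma tm_init_conf: "tm_init \<sigma> = conf 0 (\<lambda>i. (0, blank, if i = 0 then code \<sigma> @- blank else blank))"
  by (auto simp: tm_init_def conf_def string_tape_def Let_def fun_eq_iff shift_snth)

lemma polytime_computable_template:
  assumes "\<And>N. \<forall>(M, f)\<in>set Ms. reads N ((n + 2) * Suc N) M f"
    and sound: "\<And>\<sigma> s \<phi> \<psi>. read_all Ms (\<sigma>, [], []) = Some (s, \<phi>, \<psi>) \<Longrightarrow>
      length (code \<phi>) \<le> (n + 2) * length \<sigma> \<and> length (code \<psi>) \<le> (n + 2) * length \<sigma>"
  shows "polytime_computable (\<lambda>\<sigma>. case read_all Ms (\<sigma>, [], []) of None \<Rightarrow> []
    | Some (s, \<phi>, \<psi>) \<Rightarrow> inst \<phi> \<psi> ps)"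
proof -
  let ?M = "read_then Ms (emit_tm ps)"
  have ok: "tm5_ok ?M" using read_then_ok[OF assms(1) emit_ok] .
  obtain L where L: "\<And>\<phi> \<psi> m. length (code \<phi>) \<le> m \<Longrightarrow> length (code \<psi>) \<le> m \<Longrightarrow>
      length (code (inst \<phi> \<psi> ps)) \<le> L * Suc m"
    using length_code_inst[of ps] by blast
  \<comment> \<open>The summands pay for the readers, for writing an output of at most
    \<open>L * (n + 2) * Suc (length \<sigma>)\<close> cells, and for the fixed costs of the pieces.
    The total time is at most \<open>C * Suc (length \<sigma>)\<close>, hence the polynomial
    \<open>[:C, C:]\<close>.\<close>
  define C where "C = (n + 2) * length Ms + 3 * L * (n + 2) + 3 * length ps + 2"
  have "\<exists>t \<le> poly [:C, C:] (length \<sigma>). let c = (tm_step ?M ^^ t) (tm_init \<sigma>)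
      in cstate c = 1 \<and> ctape c 1 = string_tape (case read_all Ms (\<sigma>, [], []) of None \<Rightarrow> []
        | Some (s, \<phi>, \<psi>) \<Rightarrow> inst \<phi> \<psi> ps) \<and> chead c 1 = 0" for \<sigma>
  proof -
    let ?N = "length \<sigma>"
    let ?T = "(n + 2) * Suc ?N * length Ms"
    define Z :: "nat \<Rightarrow> tape" where "Z i = (0, blank, if i = 0 then code \<sigma> @- blank else blank)" for i
    have init: "tm_init \<sigma> = conf 0 Z" unfolding tm_init_conf Z_def ..
    have "reading ?N (\<sigma>, [], []) Z" by (simp add: Z_def args_written_def written_def)
    note read = exec_read_then[OF assms(1) emit_ok this, of ps]
    have goal: ?thesis
      if ex: "exec ?M t Z True Z'" and Z': "Z' 1 = (0, blank, code \<tau> @- blank)" and t: "t \<le> C * Suc ?N"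
        and \<tau>: "\<tau> = (case read_all Ms (\<sigma>, [], []) of None \<Rightarrow> [] | Some (s, \<phi>, \<psi>) \<Rightarrow> inst \<phi> \<psi> ps)"
      for t Z' \<tau>
    proof -
      obtain t' where t': "t' \<le> t" "(tm_step ?M ^^ t') (tm_init \<sigma>) = conf 1 Z'"
        using ex unfolding exec_def run_def init by auto
      have "cells (0, blank, code \<tau> @- blank) = string_tape \<tau>"
        by (auto simp: string_tape_def Let_def fun_eq_iff shift_snth)
      moreover have "t' \<le> poly [:C, C:] ?N" using t'(1) t by (simp add: mult.commute)
      ultimately show ?thesis using t'(2) Z' \<tau> by (intro exI[of _ t']) (simp add: Let_def)
    qed
    show ?thesis
    proof (cases "read_all Ms (\<sigma>, [], [])")
      case None
      then obtain Z' where "exec ?M ?T Z True Z'" "Z' 1 = written []" using read by auto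
      then show ?thesis using None
        by (intro goal[of ?T Z' "[]"]) (auto simp: written_def C_def algebra_simps)
    next
      case (Some S)
      then obtain s \<phi> \<psi> where S: "read_all Ms (\<sigma>, [], []) = Some (s, \<phi>, \<psi>)" by (cases S) auto
      then obtain Z1 where Z1: "reading ?N (s, \<phi>, \<psi>) Z1"
        "\<And>t Z'. exec (emit_tm ps) t Z1 True Z' \<Longrightarrow> exec ?M (?T + t) Z True Z'"
        using read by auto
      let ?\<tau> = "inst \<phi> \<psi> ps"
      let ?t = "3 * length (code ?\<tau>) + 3 * length ps + 2"
      have "exec (emit_tm ps) ?t Z1 True (Z1(1 := (0, blank, code ?\<tau> @- blank)))"
        using exec_emit[of \<phi> \<psi> Z1 "[]" ps] Z1(1) by simp
      note ex = Z1(2)[OF this]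
      have "length (code ?\<tau>) \<le> L * Suc ((n + 2) * ?N)" using L sound[OF S] by blast
      also have "\<dots> \<le> L * ((n + 2) * Suc ?N)" by (intro mult_le_mono) auto
      finally have "?T + ?t \<le> C * Suc ?N" by (simp add: C_def algebra_simps)
      then show ?thesis
        using S by (intro goal[OF ex, of ?\<tau>]) auto
    qed
  qed
  moreover have "wf_tm ?M" "2 \<le> ntapes ?M" using ok by (auto simp: tm5_ok_def total_tm_wf)
  ultimately show ?thesis unfolding polytime_computable_def by blast
qed

text \<open>The dummy second component gives single terms the same format as pairs.\<close>

definition term_of :: "nat \<Rightarrow> sym list \<Rightarrow> (sym list \<times> sym list) option" where
  "term_of n \<sigma> = (if \<sigma> \<in> term_strings n then Some (\<sigma>, []) else None)"

definition pair_of :: "nat \<Rightarrow> sym list \<Rightarrow> (sym list \<times> sym list) option" where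
  "pair_of n \<sigma> = (if \<exists>\<phi> \<psi>. \<phi> \<in> term_strings n \<and> \<psi> \<in> term_strings n \<and> \<sigma> = pair_code \<phi> \<psi>
     then Some (THE (\<phi>, \<psi>). \<phi> \<in> term_strings n \<and> \<psi> \<in> term_strings n \<and> \<sigma> = pair_code \<phi> \<psi>) else None)"

lemma pair_of_pair_code:
  assumes "\<phi> \<in> term_strings n" "\<psi> \<in> term_strings n"
  shows "pair_of n (pair_code \<phi> \<psi>) = Some (\<phi>, \<psi>)"
proof -
  have "(THE (\<phi>', \<psi>'). \<phi>' \<in> term_strings n \<and> \<psi>' \<in> term_strings n \<and> pair_code \<phi> \<psi> = pair_code \<phi>' \<psi>') = (\<phi>, \<psi>)"
    by (rule the_equality) (use assms in \<open>auto simp: pair_code_eq_iff\<close>)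
  then show ?thesis using assms unfolding pair_of_def by (simp only:) auto
qed

theorem polytime_computable_term_template:
  "polytime_computable (\<lambda>\<sigma>. case term_of n \<sigma> of None \<Rightarrow> [] | Some (\<phi>, \<psi>) \<Rightarrow> inst \<phi> \<psi> ps)"
proof -
  define Ms where "Ms = [(parse_tm n 3, read_term n False), (expect_tm 0, read_end)]"
  have read: "read_all Ms (\<sigma>, [], []) = map_option (Pair []) (term_of n \<sigma>)" for \<sigma>
  proof (cases "\<sigma> \<in> term_strings n")
    case True
    then show ?thesis using scan_term[OF True, of "[]"] by (simp add: Ms_def term_of_def)
  next
    case False
    then show ?thesis using scan_term_sound[of n \<sigma>]
      by (force simp: Ms_def term_of_def split: option.split)
  qed
  have "polytime_computable (\<lambda>\<sigma>. case read_all Ms (\<sigma>, [], []) of None \<Rightarrow> []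
      | Some (s, \<phi>, \<psi>) \<Rightarrow> inst \<phi> \<psi> ps)"
  proof (rule polytime_computable_template)
    show "\<forall>(M, f)\<in>set Ms. reads N ((n + 2) * Suc N) M f" for N
      using reads_term[of N n False] reads_end[of "(n + 2) * Suc N" N] by (simp add: Ms_def)
    show "length (code \<phi>) \<le> (n + 2) * length \<sigma> \<and> length (code \<psi>) \<le> (n + 2) * length \<sigma>"
      if "read_all Ms (\<sigma>, [], []) = Some (s, \<phi>, \<psi>)" for \<sigma> s \<phi> \<psi>
      using that length_code_term[of \<sigma> n] by (auto simp: read term_of_def split: if_splits)
  qed
  moreover have "(case map_option (Pair ([] :: sym list)) x of None \<Rightarrow> [] | Some (s, \<phi>, \<psi>) \<Rightarrow> inst \<phi> \<psi> ps) =
      (case x of None \<Rightarrow> [] | Some (\<phi>, \<psi>) \<Rightarrow> inst \<phi> \<psi> ps)" for x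
    by (auto split: option.split)
  ultimately show ?thesis by (simp only: read)
qed

theorem polytime_computable_pair_template:
  "polytime_computable (\<lambda>\<sigma>. case pair_of n \<sigma> of None \<Rightarrow> [] | Some (\<phi>, \<psi>) \<Rightarrow> inst \<phi> \<psi> ps)"
proof -
  \<comment> \<open>The readers follow the shape of \<open>pair_code\<close>. In
    \<open>expect_tm\<close> the numbers are symbols, 4 and 5 being the parentheses and 0 the end of
    input; in \<open>parse_tm\<close> they are the tapes that receive the terms.\<close>
  define Ms where "Ms = [(expect_tm 4, read_symbol LPar), (parse_tm n 3, read_term n False),
    (expect_tm 5, read_symbol RPar), (expect_tm 4, read_symbol LPar), (parse_tm n 4, read_term n True),
    (expect_tm 5, read_symbol RPar), (expect_tm 0, read_end)]"
  have complete: "read_all Ms (pair_code \<phi> \<psi>, [], []) = Some ([], \<phi>, \<psi>)"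
    if "\<phi> \<in> term_strings n" "\<psi> \<in> term_strings n" for \<phi> \<psi>
    using scan_term[OF that(1), of "RPar # LPar # \<psi> @ [RPar]"] scan_term[OF that(2), of "[RPar]"]
    by (simp add: Ms_def pair_code_def)
  have sound: "\<exists>\<phi> \<psi>. \<phi> \<in> term_strings n \<and> \<psi> \<in> term_strings n \<and> \<sigma> = pair_code \<phi> \<psi>"
    if R: "read_all Ms (\<sigma>, [], []) = Some S" for \<sigma> S
  proof -
    obtain s where s: "\<sigma> = LPar # s" using R by (cases \<sigma>) (auto simp: Ms_def split: if_splits)
    obtain \<phi> s1 where 1: "scan n True [] s = Some (\<phi>, s1)"
      using R s by (auto simp: Ms_def split: option.splits)
    obtain s2 where 2: "s1 = RPar # LPar # s2"
      using R s 1 by (cases s1; cases "tl s1") (auto simp: Ms_def split: option.splits if_splits)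
    obtain \<psi> s3 where 3: "scan n True [] s2 = Some (\<psi>, s3)"
      using R s 1 2 by (auto simp: Ms_def split: option.splits)
    have 4: "s3 = [RPar]"
      using R s 1 2 3 by (cases s3) (auto simp: Ms_def split: option.splits if_splits)
    show ?thesis
      using scan_term_sound[OF 1] scan_term_sound[OF 3] s 2 4 by (auto simp: pair_code_def)
  qed
  have read: "read_all Ms (\<sigma>, [], []) = map_option (Pair []) (pair_of n \<sigma>)" for \<sigma>
  proof (cases "\<exists>\<phi> \<psi>. \<phi> \<in> term_strings n \<and> \<psi> \<in> term_strings n \<and> \<sigma> = pair_code \<phi> \<psi>")
    case True
    then show ?thesis using complete pair_of_pair_code by auto
  next
    case False
    then have "read_all Ms (\<sigma>, [], []) \<noteq> Some S" for S using sound by blast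
    then have "read_all Ms (\<sigma>, [], []) = None" by (rule not_Some_eq[THEN iffD1, OF allI])
    then show ?thesis using False by (simp add: pair_of_def)
  qed
  have "polytime_computable (\<lambda>\<sigma>. case read_all Ms (\<sigma>, [], []) of None \<Rightarrow> []
      | Some (s, \<phi>, \<psi>) \<Rightarrow> inst \<phi> \<psi> ps)"
  proof (rule polytime_computable_template)
    show "\<forall>(M, f)\<in>set Ms. reads N ((n + 2) * Suc N) M f" for N
    proof -
      have "1 \<le> (n + 2) * Suc N" by simp
      then show ?thesis
        using reads_term[of N n False] reads_term[of N n True] reads_end reads_symbol
        by (simp add: Ms_def)
    qed
    show "length (code \<phi>) \<le> (n + 2) * length \<sigma> \<and> length (code \<psi>) \<le> (n + 2) * length \<sigma>"
      if S: "read_all Ms (\<sigma>, [], []) = Some (s, \<phi>, \<psi>)" for \<sigma> s \<phi> \<psi>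
    proof -
      obtain \<phi>' \<psi>' where *: "\<phi>' \<in> term_strings n" "\<psi>' \<in> term_strings n" "\<sigma> = pair_code \<phi>' \<psi>'"
        using sound[OF S] by blast
      then have "\<phi> = \<phi>'" "\<psi> = \<psi>'" using S complete by auto
      moreover have "(n + 2) * length \<phi>' \<le> (n + 2) * length \<sigma>" "(n + 2) * length \<psi>' \<le> (n + 2) * length \<sigma>"
        unfolding *(3) pair_code_def by (intro mult_le_mono; simp)+
      ultimately show ?thesis
        using length_code_term[OF *(1)] length_code_term[OF *(2)] by (meson le_trans)
    qed
  qed
  moreover have "(case map_option (Pair ([] :: sym list)) x of None \<Rightarrow> [] | Some (s, \<phi>, \<psi>) \<Rightarrow> inst \<phi> \<psi> ps) =
      (case x of None \<Rightarrow> [] | Some (\<phi>, \<psi>) \<Rightarrow> inst \<phi> \<psi> ps)" for x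
    by (auto split: option.split)
  ultimately show ?thesis by (simp only: read)
qed

section \<open>The unit interval of a lattice-ordered group\<close>

context lattice_ab_group_add
begin

text \<open>Mundici's functor Gamma. The definition of \<open>elliott\<close> has the same form,
  with \<open>k0_meet\<close> as infimum.\<close>

definition gamma :: "'a \<Rightarrow> 'a mv" where
  "gamma u = \<lparr> mvcarrier = {x. 0 \<le> x \<and> x \<le> u}, mvzero = 0, mvneg = (\<lambda>x. u - x),
     mvplus = (\<lambda>x y. inf (x + y) u) \<rparr>"

lemma gamma_simps [simp]:
  "x \<in> mvcarrier (gamma u) \<longleftrightarrow> 0 \<le> x \<and> x \<le> u"
  "mvzero (gamma u) = 0" "mvneg (gamma u) x = u - x" "mvplus (gamma u) x y = inf (x + y) u"
  by (simp_all add: gamma_def)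

text \<open>Complementation turns \<open>inf\<close> into \<open>sup\<close> and the unit cancels,
  so truncated subtraction is the positive part of the group difference.\<close>

lemma mvminus_gamma: "mvminus (gamma u) x y = pprt (x - y)"
proof -
  have 1: "u - (u - y) = y" by (simp add: algebra_simps)
  have 2: "u - (u - x + y) = x - y" by (simp add: algebra_simps)
  show ?thesis
    by (simp only: mvminus_def mvtimes_def gamma_simps 1 2 diff_inf_eq_sup add_sup_distrib_left
        add_uminus_conv_diff diff_self pprt_def)
qed

lemma pprt_diff_le: "0 \<le> y \<Longrightarrow> 0 \<le> x \<Longrightarrow> x \<le> u \<Longrightarrow> pprt (x - y) \<le> u"
  by (simp add: pprt_def diff_le_eq add_increasing2)

lemma pprt_eq_0_iff: "pprt (x - y) = 0 \<longleftrightarrow> x \<le> y"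
  using le_zero_iff_zero_pprt[of "x - y"] by simp

lemma mvle_gamma: "mvle (gamma u) x y \<longleftrightarrow> x \<le> y"
  by (simp add: mvle_def mvminus_gamma pprt_eq_0_iff)

lemma gamma_closed:
  assumes "0 \<le> u"
  shows "0 \<le> x \<Longrightarrow> x \<le> u \<Longrightarrow> 0 \<le> u - x \<and> u - x \<le> u"
    "0 \<le> x \<Longrightarrow> 0 \<le> y \<Longrightarrow> 0 \<le> inf (x + y) u \<and> inf (x + y) u \<le> u"
  using assms by (simp_all add: diff_le_eq)

lemma le_add_pprt: "x \<le> y + pprt (x - y)"
proof -
  have "x - y \<le> pprt (x - y)" by (simp add: pprt_def)
  then show ?thesis by (simp add: diff_le_eq add.commute)
qed

text \<open>Together with \<open>le_add_pprt\<close> this is residuation: for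
  \<open>0 \<le> p\<close>, \<open>pprt (x - y) \<le> p\<close> iff
  \<open>x \<le> y + p\<close>.\<close>

lemma pprt_diff_leI: "0 \<le> p \<Longrightarrow> x \<le> y + p \<Longrightarrow> pprt (x - y) \<le> p"
  by (simp add: pprt_def diff_le_eq add.commute)

lemma add_pprt_diff: "y + pprt (x - y) = sup x y"
  by (simp add: pprt_def add_sup_distrib_left sup.commute add_diff_eq)

text \<open>The two elements are \<open>sup x y - y\<close> and \<open>sup x y - x\<close>, whose
  infimum is \<open>sup x y - sup x y\<close>.\<close>

lemma inf_pprt: "inf (pprt (x - y)) (pprt (y - x)) = 0"
proof -
  have "y + pprt (x - y) = sup x y" "x + pprt (y - x) = sup x y"
    using add_pprt_diff[of x y] add_pprt_diff[of y x] by (simp_all add: sup.commute)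
  then have eq: "pprt (x - y) = sup x y - y" "pprt (y - x) = sup x y - x"
    by (metis add_diff_cancel_left')+
  have "inf (sup x y + - y) (sup x y + - x) = sup x y + inf (- y) (- x)"
    by (simp add: add_inf_distrib_left)
  also have "inf (- y) (- x) = - sup x y"
    by (simp add: neg_sup_eq_inf inf.commute)
  finally show ?thesis by (simp only: eq add_uminus_conv_diff diff_self)
qed

text \<open>Distributing the right-hand side gives an infimum of four sums: \<open>x + y\<close> and
  three others that are at least \<open>z\<close>.\<close>

lemma inf_add_le: "0 \<le> x \<Longrightarrow> 0 \<le> y \<Longrightarrow> 0 \<le> z \<Longrightarrow> inf (x + y) z \<le> inf x z + inf y z"
proof -
  assume *: "0 \<le> x" "0 \<le> y" "0 \<le> z"
  have "inf x z + inf y z = inf (inf (x + y) (z + y)) (inf (x + z) (z + z))"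
    by (simp add: add_inf_distrib_left add_inf_distrib_right)
  moreover have "z \<le> z + y" "z \<le> x + z" "z \<le> z + z"
    using * by (simp_all add: add_increasing add_increasing2)
  ultimately show ?thesis by (simp add: le_infI1 le_infI2)
qed

text \<open>This merges two equations with 0 into one, both in the distance and in the eccentricity
  polynomial.\<close>

lemma truncated_sum_eq_0:
  assumes "0 \<le> x" "x \<le> u" "0 \<le> y" "y \<le> u"
  shows "inf (x + y) u = 0 \<longleftrightarrow> x = 0 \<and> y = 0"
proof
  assume 0: "inf (x + y) u = 0"
  have "x \<le> inf (x + y) u" "y \<le> inf (x + y) u" using assms by (simp_all add: add_increasing add_increasing2)
  then show "x = 0 \<and> y = 0" using 0 assms by (simp add: order.antisym)
next
  assume "x = 0 \<and> y = 0"
  moreover have "0 \<le> u" using assms(1,2) by (rule order.trans)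
  ultimately show "inf (x + y) u = 0" by (simp add: inf_absorb1)
qed

section \<open>Ideals, quotients and prime ideals of the unit interval\<close>

lemma ideal_gammaD:
  assumes "mv_ideal (gamma u) J"
  shows "0 \<in> J" "x \<in> J \<Longrightarrow> 0 \<le> x \<and> x \<le> u"
    "x \<in> J \<Longrightarrow> 0 \<le> y \<Longrightarrow> y \<le> x \<Longrightarrow> y \<in> J"
    "x \<in> J \<Longrightarrow> y \<in> J \<Longrightarrow> inf (x + y) u \<in> J"
proof -
  have J: "J \<subseteq> mvcarrier (gamma u)" "0 \<in> J"
    "\<And>x y. x \<in> J \<Longrightarrow> 0 \<le> y \<Longrightarrow> y \<le> u \<Longrightarrow> y \<le> x \<Longrightarrow> y \<in> J"
    "\<And>x y. x \<in> J \<Longrightarrow> y \<in> J \<Longrightarrow> inf (x + y) u \<in> J"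
    using assms unfolding mv_ideal_def by (auto simp: mvle_gamma)
  show "0 \<in> J" by (rule J)
  show x: "x \<in> J \<Longrightarrow> 0 \<le> x \<and> x \<le> u" for x using J(1) by auto
  show "x \<in> J \<Longrightarrow> 0 \<le> y \<Longrightarrow> y \<le> x \<Longrightarrow> y \<in> J" using J(3) x order.trans by blast
  show "x \<in> J \<Longrightarrow> y \<in> J \<Longrightarrow> inf (x + y) u \<in> J" by (rule J)
qed

lemma ideal_gammaI:
  assumes "\<And>x. x \<in> J \<Longrightarrow> 0 \<le> x \<and> x \<le> u" "0 \<in> J"
    "\<And>x y. x \<in> J \<Longrightarrow> 0 \<le> y \<Longrightarrow> y \<le> x \<Longrightarrow> y \<in> J"
    "\<And>x y. x \<in> J \<Longrightarrow> y \<in> J \<Longrightarrow> inf (x + y) u \<in> J"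
  shows "mv_ideal (gamma u) J"
  unfolding mv_ideal_def
proof (intro conjI ballI impI subsetI)
  show "x \<in> mvcarrier (gamma u)" if "x \<in> J" for x using assms(1)[OF that] by simp
  show "y \<in> J" if "x \<in> J" "y \<in> mvcarrier (gamma u)" "mvle (gamma u) y x" for x y
    using assms(3)[OF that(1)] that(2,3) by (simp add: mvle_gamma)
qed (use assms(2,4) in simp_all)

lemma ideal_gamma_le_add:
  assumes "mv_ideal (gamma u) J" "x \<in> J" "y \<in> J" "0 \<le> z" "z \<le> u" "z \<le> x + y"
  shows "z \<in> J"
  using ideal_gammaD(3)[OF assms(1) ideal_gammaD(4)[OF assms(1-3)] assms(4)] assms(5,6) by simp

text \<open>Membership of the distance in \<open>J\<close>, split into two one-sided conditions.
  Each can be handled as a preorder, and one alone describes the order of the quotient.\<close>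

definition congruent_mod :: "'a set \<Rightarrow> 'a \<Rightarrow> 'a \<Rightarrow> bool" where
  "congruent_mod J x y \<longleftrightarrow> pprt (x - y) \<in> J \<and> pprt (y - x) \<in> J"

context
  fixes u J
  assumes J: "mv_ideal (gamma u) J"
begin

lemma unit_nonneg: "0 \<le> u"
  using ideal_gammaD(2)[OF J ideal_gammaD(1)[OF J]] by simp

lemma mvcoset_gamma:
  assumes "0 \<le> x" "x \<le> u"
  shows "mvcoset (gamma u) J x = {y. 0 \<le> y \<and> y \<le> u \<and> congruent_mod J x y}"
proof -
  have "mvdist (gamma u) x y \<in> J \<longleftrightarrow> congruent_mod J x y" if y: "0 \<le> y" "y \<le> u" for y
  proof
    have le: "pprt (x - y) \<le> u" "pprt (y - x) \<le> u" using pprt_diff_le assms y by auto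
    have eq: "mvdist (gamma u) x y = inf (pprt (x - y) + pprt (y - x)) u"
      by (simp add: mvdist_def mvminus_gamma)
    show "congruent_mod J x y" if "mvdist (gamma u) x y \<in> J"
      unfolding congruent_mod_def
      using ideal_gammaD(3)[OF J that[unfolded eq], of "pprt (x - y)"]
        ideal_gammaD(3)[OF J that[unfolded eq], of "pprt (y - x)"] le
      by (simp add: add_increasing add_increasing2)
    show "mvdist (gamma u) x y \<in> J" if "congruent_mod J x y"
      using that ideal_gammaD(4)[OF J] by (simp add: eq congruent_mod_def)
  qed
  then show ?thesis by (auto simp: mvcoset_def)
qed

lemma congruent_mod_refl: "congruent_mod J x x"
  using ideal_gammaD(1)[OF J] by (simp add: congruent_mod_def)

lemma congruent_mod_sym: "congruent_mod J x y \<Longrightarrow> congruent_mod J y x"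
  by (auto simp: congruent_mod_def)

lemma pprt_mod_trans:
  assumes "0 \<le> x" "x \<le> u" "0 \<le> z" "pprt (x - y) \<in> J" "pprt (y - z) \<in> J"
  shows "pprt (x - z) \<in> J"
proof (rule ideal_gamma_le_add[OF J assms(4,5)])
  have "x \<le> y + pprt (x - y)" by (rule le_add_pprt)
  also have "\<dots> \<le> z + pprt (y - z) + pprt (x - y)" by (intro add_right_mono le_add_pprt)
  finally show "pprt (x - z) \<le> pprt (x - y) + pprt (y - z)"
    by (intro pprt_diff_leI) (simp_all add: add_ac)
  show "pprt (x - z) \<le> u" using assms by (intro pprt_diff_le) auto
qed simp

lemma congruent_mod_trans:
  "0 \<le> x \<Longrightarrow> x \<le> u \<Longrightarrow> 0 \<le> z \<Longrightarrow> z \<le> u \<Longrightarrow> congruent_mod J x y \<Longrightarrow> congruent_mod J y z \<Longrightarrow>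
    congruent_mod J x z"
  unfolding congruent_mod_def using pprt_mod_trans by meson

lemma mvcoset_eq_iff:
  assumes "0 \<le> x" "x \<le> u" "0 \<le> y" "y \<le> u"
  shows "mvcoset (gamma u) J x = mvcoset (gamma u) J y \<longleftrightarrow> congruent_mod J x y"
proof
  assume "mvcoset (gamma u) J x = mvcoset (gamma u) J y"
  then show "congruent_mod J x y"
    using assms congruent_mod_refl by (auto simp: mvcoset_gamma)
next
  assume xy: "congruent_mod J x y"
  have "congruent_mod J x z \<longleftrightarrow> congruent_mod J y z" if z: "0 \<le> z" "z \<le> u" for z
    using congruent_mod_trans[OF assms(3,4) z congruent_mod_sym[OF xy]]
      congruent_mod_trans[OF assms(1,2) z xy] by blast
  then show "mvcoset (gamma u) J x = mvcoset (gamma u) J y"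
    unfolding mvcoset_gamma[OF assms(1,2)] mvcoset_gamma[OF assms(3,4)] by blast
qed

lemma congruent_mod_neg: "congruent_mod J x y \<Longrightarrow> congruent_mod J (u - x) (u - y)"
  by (simp add: congruent_mod_def algebra_simps)

lemma pprt_mod_plus:
  assumes "0 \<le> x" "0 \<le> y" "0 \<le> x'" "0 \<le> y'" "pprt (x - x') \<in> J" "pprt (y - y') \<in> J"
  shows "pprt (inf (x + y) u - inf (x' + y') u) \<in> J"
proof (rule ideal_gamma_le_add[OF J assms(5,6)])
  let ?p = "pprt (x - x') + pprt (y - y')"
  have "x + y \<le> (x' + pprt (x - x')) + (y' + pprt (y - y'))"
    by (intro add_mono le_add_pprt)
  then have "x + y \<le> x' + y' + ?p" by (simp add: add_ac)
  moreover have "u \<le> u + ?p" by simp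
  ultimately have "inf (x + y) u \<le> inf (x' + y' + ?p) (u + ?p)" by (rule inf_mono)
  also have "\<dots> = inf (x' + y') u + ?p" by (simp add: add_inf_distrib_right)
  finally show "pprt (inf (x + y) u - inf (x' + y') u) \<le> ?p" by (intro pprt_diff_leI) simp_all
  show "pprt (inf (x + y) u - inf (x' + y') u) \<le> u"
    using assms unit_nonneg by (intro pprt_diff_le) simp_all
qed simp

lemma congruent_mod_plus:
  "0 \<le> x \<Longrightarrow> 0 \<le> y \<Longrightarrow> 0 \<le> x' \<Longrightarrow> 0 \<le> y' \<Longrightarrow> congruent_mod J x x' \<Longrightarrow> congruent_mod J y y' \<Longrightarrow>
    congruent_mod J (inf (x + y) u) (inf (x' + y') u)"
  unfolding congruent_mod_def using pprt_mod_plus by blast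

text \<open>\<open>mvquot\<close> takes a union over all representatives; by congruence every member
  of the union is the same coset.\<close>

lemma mvneg_mvquot:
  assumes x: "0 \<le> x" "x \<le> u"
  shows "mvneg (mvquot (gamma u) J) (mvcoset (gamma u) J x) = mvcoset (gamma u) J (u - x)"
proof -
  have "mvcoset (gamma u) J (u - x') = mvcoset (gamma u) J (u - x)"
    if "x' \<in> mvcoset (gamma u) J x" for x'
  proof -
    have x': "0 \<le> x'" "x' \<le> u" "congruent_mod J x x'" using that by (simp_all add: mvcoset_gamma x)
    show ?thesis
      using mvcoset_eq_iff[of "u - x'" "u - x"] gamma_closed(1)[OF unit_nonneg x'(1,2)]
        gamma_closed(1)[OF unit_nonneg x] congruent_mod_neg[OF congruent_mod_sym[OF x'(3)]]
      by blast
  qed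
  moreover have "x \<in> mvcoset (gamma u) J x" using x congruent_mod_refl by (simp add: mvcoset_gamma)
  ultimately have "(\<Union>x'\<in>mvcoset (gamma u) J x. mvcoset (gamma u) J (u - x')) =
      mvcoset (gamma u) J (u - x)"
    by blast
  then show ?thesis by (simp add: mvquot_def)
qed

lemma mvplus_mvquot:
  assumes x: "0 \<le> x" "x \<le> u" and y: "0 \<le> y" "y \<le> u"
  shows "mvplus (mvquot (gamma u) J) (mvcoset (gamma u) J x) (mvcoset (gamma u) J y) =
    mvcoset (gamma u) J (inf (x + y) u)"
proof -
  have "mvcoset (gamma u) J (inf (x' + y') u) = mvcoset (gamma u) J (inf (x + y) u)"
    if "x' \<in> mvcoset (gamma u) J x" "y' \<in> mvcoset (gamma u) J y" for x' y'
  proof -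
    have x': "0 \<le> x'" "x' \<le> u" "congruent_mod J x x'" using that by (simp_all add: mvcoset_gamma x)
    have y': "0 \<le> y'" "y' \<le> u" "congruent_mod J y y'" using that by (simp_all add: mvcoset_gamma y)
    show ?thesis
      using mvcoset_eq_iff[of "inf (x' + y') u" "inf (x + y) u"]
        gamma_closed(2)[OF unit_nonneg x'(1) y'(1)] gamma_closed(2)[OF unit_nonneg x(1) y(1)]
        congruent_mod_plus[OF x'(1) y'(1) x(1) y(1) congruent_mod_sym[OF x'(3)] congruent_mod_sym[OF y'(3)]]
      by blast
  qed
  moreover have "x \<in> mvcoset (gamma u) J x" "y \<in> mvcoset (gamma u) J y"
    using x y congruent_mod_refl by (simp_all add: mvcoset_gamma)
  ultimately have "(\<Union>x'\<in>mvcoset (gamma u) J x. \<Union>y'\<in>mvcoset (gamma u) J y.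
      mvcoset (gamma u) J (inf (x' + y') u)) = mvcoset (gamma u) J (inf (x + y) u)"
    by blast
  then show ?thesis by (simp add: mvquot_def)
qed

lemma mvle_mvquot:
  assumes x: "0 \<le> x" "x \<le> u" and y: "0 \<le> y" "y \<le> u"
  shows "mvle (mvquot (gamma u) J) (mvcoset (gamma u) J x) (mvcoset (gamma u) J y) \<longleftrightarrow>
    pprt (x - y) \<in> J"
proof -
  note closed = gamma_closed[OF unit_nonneg]
  have "mvminus (mvquot (gamma u) J) (mvcoset (gamma u) J x) (mvcoset (gamma u) J y) =
      mvcoset (gamma u) J (mvminus (gamma u) x y)"
    unfolding mvminus_def mvtimes_def gamma_simps
    using x y closed(1) closed(2)[of "u - x" "u - (u - y)"]
    by (simp add: mvneg_mvquot mvplus_mvquot)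
  moreover have "mvzero (mvquot (gamma u) J) = mvcoset (gamma u) J 0" by (simp add: mvquot_def)
  moreover have "pprt (x - y) \<le> u" using x y by (intro pprt_diff_le)
  ultimately show ?thesis
    using unit_nonneg ideal_gammaD(1)[OF J]
    by (simp add: mvle_def mvminus_gamma mvcoset_eq_iff congruent_mod_def)
qed

lemma mvless_mvquot:
  assumes "0 \<le> x" "x \<le> u" "0 \<le> y" "y \<le> u"
  shows "mvless (mvquot (gamma u) J) (mvcoset (gamma u) J x) (mvcoset (gamma u) J y) \<longleftrightarrow>
    pprt (x - y) \<in> J \<and> pprt (y - x) \<notin> J"
  using assms by (auto simp: mvless_def mvle_mvquot mvcoset_eq_iff congruent_mod_def)

lemma mv_prime_gamma:
  "mv_prime (gamma u) J \<longleftrightarrow> u \<notin> J \<and>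
     (\<forall>x y. 0 \<le> x \<and> x \<le> u \<and> 0 \<le> y \<and> y \<le> u \<longrightarrow> pprt (x - y) \<in> J \<or> pprt (y - x) \<in> J)"
proof -
  have "J = mvcarrier (gamma u)" if "u \<in> J"
  proof (intro equalityI subsetI)
    show "x \<in> mvcarrier (gamma u)" if "x \<in> J" for x using ideal_gammaD(2)[OF J that] by simp
    show "x \<in> J" if "x \<in> mvcarrier (gamma u)" for x
      using ideal_gammaD(3)[OF J \<open>u \<in> J\<close>] that by simp
  qed
  moreover have "u \<in> mvcarrier (gamma u)" using unit_nonneg by simp
  ultimately have "J \<noteq> mvcarrier (gamma u) \<longleftrightarrow> u \<notin> J" by metis
  moreover have "(\<forall>C\<in>mvcarrier (mvquot (gamma u) J). \<forall>D\<in>mvcarrier (mvquot (gamma u) J).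
        mvle (mvquot (gamma u) J) C D \<or> mvle (mvquot (gamma u) J) D C) \<longleftrightarrow>
      (\<forall>x y. 0 \<le> x \<and> x \<le> u \<and> 0 \<le> y \<and> y \<le> u \<longrightarrow> pprt (x - y) \<in> J \<or> pprt (y - x) \<in> J)"
  proof -
    have "mvcarrier (mvquot (gamma u) J) = mvcoset (gamma u) J ` {x. 0 \<le> x \<and> x \<le> u}"
      by (simp add: mvquot_def gamma_def)
    then show ?thesis by (auto simp: mvle_mvquot)
  qed
  ultimately show ?thesis unfolding mv_prime_def using J by simp
qed

end

text \<open>Disjoint \<open>x\<close> and \<open>y\<close> are the positive and the negative part of
  \<open>x - y\<close>, and a prime ideal contains one of these.\<close>

lemma prime_inf:
  assumes "mv_ideal (gamma u) J" "mv_prime (gamma u) J" "0 \<le> x" "x \<le> u" "0 \<le> y" "y \<le> u" "inf x y = 0"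
  shows "x \<in> J \<or> y \<in> J"
proof -
  have "x - y \<le> x" "y - x \<le> y" using assms by (simp_all add: diff_le_eq)
  then have le: "pprt (x - y) \<le> x" "pprt (y - x) \<le> y"
    using assms by (simp_all add: pprt_def)
  have "x + y = sup x y" using add_eq_inf_sup[of x y] assms(7) by simp
  then have "y + pprt (x - y) = y + x" "x + pprt (y - x) = x + y"
    by (simp_all only: add_pprt_diff add.commute[of y x] sup.commute[of y x])
  then have "pprt (x - y) = x" "pprt (y - x) = y" by simp_all
  then show ?thesis using assms(2-6) mv_prime_gamma[OF assms(1)] by metis
qed

text \<open>The annihilator of \<open>a\<close> modulo \<open>J\<close>; closure under truncated
  addition rests on \<open>inf_add_le\<close>.\<close>

lemma ideal_inf:
  assumes J: "mv_ideal (gamma u) J" and a: "0 \<le> a"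
  shows "mv_ideal (gamma u) {x. 0 \<le> x \<and> x \<le> u \<and> inf x a \<in> J}"
proof (rule ideal_gammaI)
  note D = ideal_gammaD[OF J]
  have u: "0 \<le> u" using unit_nonneg[OF J] .
  show "0 \<in> {x. 0 \<le> x \<and> x \<le> u \<and> inf x a \<in> J}"
    using u D(1) a by (simp add: inf_absorb1)
  show "y \<in> {x. 0 \<le> x \<and> x \<le> u \<and> inf x a \<in> J}"
    if "x \<in> {x. 0 \<le> x \<and> x \<le> u \<and> inf x a \<in> J}" "0 \<le> y" "y \<le> x" for x y
  proof -
    have "inf y a \<le> inf x a" using that(3) by (rule inf_mono) simp
    then have "inf y a \<in> J" using that a D(3)[of "inf x a" "inf y a"] by simp
    moreover have "x \<le> u" using that(1) by simp
    then have "y \<le> u" by (rule order.trans[OF that(3)])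
    ultimately show ?thesis using that(2) by simp
  qed
  show "inf (x + y) u \<in> {x. 0 \<le> x \<and> x \<le> u \<and> inf x a \<in> J}"
    if "x \<in> {x. 0 \<le> x \<and> x \<le> u \<and> inf x a \<in> J}" "y \<in> {x. 0 \<le> x \<and> x \<le> u \<and> inf x a \<in> J}" for x y
  proof -
    have *: "0 \<le> x" "0 \<le> y" "inf x a \<in> J" "inf y a \<in> J" using that by auto
    have "inf (inf (x + y) u) a \<in> J"
    proof (rule ideal_gamma_le_add[OF J *(3,4)])
      show "0 \<le> inf (inf (x + y) u) a" using * u a by simp
      show "inf (inf (x + y) u) a \<le> u" by (simp add: le_infI1)
      have "inf (inf (x + y) u) a \<le> inf (x + y) a" by (simp add: le_infI1)
      then show "inf (inf (x + y) u) a \<le> inf x a + inf y a"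
        using inf_add_le[OF *(1,2) a] by (rule order.trans)
    qed
    then show ?thesis using * u by simp
  qed
qed simp

text \<open>
  An ideal that is maximal among those omitting \<open>c\<close> is prime: if \<open>inf a b = 0\<close> and \<open>a\<close>, \<open>b\<close> are not
  in \<open>J\<close>, then the ideal \<open>{x. inf x a \<in> J}\<close> contains \<open>b\<close>, hence \<open>c\<close>, and therefore the ideal
  \<open>{x. inf x c \<in> J}\<close> contains \<open>a\<close>, hence \<open>c\<close>, so that \<open>c = inf c c\<close> is in \<open>J\<close>.
\<close>

lemma prime_ideal_separation:
  assumes c: "0 \<le> c" "c \<le> u" "c \<noteq> 0"
  obtains J where "mv_prime (gamma u) J" "c \<notin> J"
proof -
  let ?S = "{J. mv_ideal (gamma u) J \<and> c \<notin> J}"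
  have u: "0 \<le> u" using c order.trans by blast
  have "mv_ideal (gamma u) {0}"
    by (rule ideal_gammaI) (use u in \<open>auto simp: inf_absorb1 intro: order.antisym\<close>)
  then have ne: "{0} \<in> ?S" using c by auto
  have "\<exists>M\<in>?S. \<forall>J\<in>?S. M \<subseteq> J \<longrightarrow> J = M"
  proof (rule subset_Zorn_nonempty)
    show "?S \<noteq> {}" using ne by blast
    fix \<C> assume \<C>: "\<C> \<noteq> {}" "subset.chain ?S \<C>"
    then have I: "mv_ideal (gamma u) J" "c \<notin> J" if "J \<in> \<C>" for J
      using that unfolding subset.chain_def by auto
    have "mv_ideal (gamma u) (\<Union>\<C>)"
    proof (rule ideal_gammaI)
      show "0 \<le> x \<and> x \<le> u" if "x \<in> \<Union>\<C>" for x using that I(1) ideal_gammaD(2) by blast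
      show "0 \<in> \<Union>\<C>" using \<C>(1) I(1) ideal_gammaD(1) by blast
      show "y \<in> \<Union>\<C>" if "x \<in> \<Union>\<C>" "0 \<le> y" "y \<le> x" for x y
        using that I(1) ideal_gammaD(3) by blast
      show "inf (x + y) u \<in> \<Union>\<C>" if xy: "x \<in> \<Union>\<C>" "y \<in> \<Union>\<C>" for x y
      proof -
        obtain J K where JK: "J \<in> \<C>" "x \<in> J" "K \<in> \<C>" "y \<in> K" using xy by blast
        then have "J \<subseteq> K \<or> K \<subseteq> J" using \<C>(2) unfolding subset.chain_def by blast
        then obtain L where "L \<in> \<C>" "x \<in> L" "y \<in> L" using JK by blast
        then show ?thesis using I(1) ideal_gammaD(4) by blast
      qed
    qed
    then show "\<Union>\<C> \<in> ?S" using I(2) by auto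
  qed
  then obtain M where M: "mv_ideal (gamma u) M" "c \<notin> M"
    and max: "\<And>J. mv_ideal (gamma u) J \<Longrightarrow> c \<notin> J \<Longrightarrow> M \<subseteq> J \<Longrightarrow> J = M"
    by auto
  have larger: "inf c a \<in> M" if "0 \<le> a" "0 \<le> b" "b \<le> u" "inf b a \<in> M" "b \<notin> M" for a b
  proof (rule ccontr)
    assume "inf c a \<notin> M"
    let ?J = "{x. 0 \<le> x \<and> x \<le> u \<and> inf x a \<in> M}"
    have "M \<subseteq> ?J"
    proof
      fix x assume x: "x \<in> M"
      then have "inf x a \<in> M" using ideal_gammaD(2,3)[OF M(1) x] \<open>0 \<le> a\<close> by simp
      then show "x \<in> ?J" using ideal_gammaD(2)[OF M(1) x] by simp
    qed
    then have "?J = M"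
      using \<open>inf c a \<notin> M\<close> by (intro max ideal_inf M(1) that) auto
    then show False using that by blast
  qed
  have "mv_prime (gamma u) M" unfolding mv_prime_gamma[OF M(1)]
  proof (intro conjI allI impI)
    show "u \<notin> M" using M ideal_gammaD(3)[OF M(1)] c by blast
    fix x y assume xy: "0 \<le> x \<and> x \<le> u \<and> 0 \<le> y \<and> y \<le> u"
    let ?a = "pprt (x - y)" and ?b = "pprt (y - x)"
    show "?a \<in> M \<or> ?b \<in> M"
    proof (rule ccontr)
      assume no: "\<not> (?a \<in> M \<or> ?b \<in> M)"
      have le: "?a \<le> u" "?b \<le> u" using xy pprt_diff_le by auto
      have "inf c ?a \<in> M"
        by (rule larger[of ?a ?b]) (use no le inf_pprt[of y x] ideal_gammaD(1)[OF M(1)] in auto)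
      then have "inf c c \<in> M"
        by (intro larger[of c ?a]) (use no le c in \<open>auto simp: inf.commute\<close>)
      then show False using M(2) by simp
    qed
  qed
  then show thesis using that M(2) by blast
qed

text \<open>Each implication in a prime quotient becomes a disjunction
  \<open>p \<in> J \<or> q \<in> J\<close>. It holds for all primes iff \<open>inf p q = 0\<close>:
  a nonzero infimum is omitted by some prime, and conversely \<open>prime_inf\<close>
  applies.\<close>

lemma eccentric_le_gamma:
  assumes x: "0 \<le> x" "x \<le> u" and y: "0 \<le> y" "y \<le> u"
  shows "eccentric_le (gamma u) x y \<longleftrightarrow>
    inf (pprt (u - y - y)) (pprt (x - y)) = 0 \<and> inf (pprt (y - (u - y))) (pprt (y - x)) = 0"
proof -
  let ?a = "pprt (u - y - y)" and ?b = "pprt (y - (u - y))"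
  have u: "0 \<le> u" using x order.trans by blast
  have ny: "0 \<le> u - y" "u - y \<le> u" using gamma_closed(1)[OF u y] by auto
  have le: "?a \<le> u" "?b \<le> u" "pprt (x - y) \<le> u" "pprt (y - x) \<le> u"
    using x y ny pprt_diff_le by auto
  have "eccentric_le (gamma u) x y \<longleftrightarrow> (\<forall>J. mv_prime (gamma u) J \<longrightarrow>
      (?a \<in> J \<or> pprt (x - y) \<in> J) \<and> (?b \<in> J \<or> pprt (y - x) \<in> J))"
    unfolding eccentric_le_def Let_def
  proof (intro all_cong1 imp_cong refl)
    fix J assume "mv_prime (gamma u) J"
    then have J: "mv_ideal (gamma u) J" by (simp add: mv_prime_def)
    \<comment> \<open>The quotient is totally ordered, so the strict inequalities between
      \<open>y\<close> and its complement reduce to \<open>?a \<notin> J\<close> and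
      \<open>?b \<notin> J\<close>.\<close>
    have "?b \<in> J \<or> ?a \<in> J"
      using \<open>mv_prime (gamma u) J\<close> y ny unfolding mv_prime_gamma[OF J] by blast
    then show "((mvless (mvquot (gamma u) J) (mvcoset (gamma u) J y) (mvcoset (gamma u) J (mvneg (gamma u) y)) \<longrightarrow>
          mvle (mvquot (gamma u) J) (mvcoset (gamma u) J x) (mvcoset (gamma u) J y)) \<and>
        (mvless (mvquot (gamma u) J) (mvcoset (gamma u) J (mvneg (gamma u) y)) (mvcoset (gamma u) J y) \<longrightarrow>
          mvle (mvquot (gamma u) J) (mvcoset (gamma u) J y) (mvcoset (gamma u) J x))) =
        ((?a \<in> J \<or> pprt (x - y) \<in> J) \<and> (?b \<in> J \<or> pprt (y - x) \<in> J))"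
      using x y ny by (auto simp: mvless_mvquot[OF J] mvle_mvquot[OF J])
  qed
  also have "\<dots> \<longleftrightarrow> inf ?a (pprt (x - y)) = 0 \<and> inf ?b (pprt (y - x)) = 0"
  proof
    assume *: "\<forall>J. mv_prime (gamma u) J \<longrightarrow>
      (?a \<in> J \<or> pprt (x - y) \<in> J) \<and> (?b \<in> J \<or> pprt (y - x) \<in> J)"
    have "inf p q = 0" if "0 \<le> p" "p \<le> u" "0 \<le> q" "\<forall>J. mv_prime (gamma u) J \<longrightarrow> p \<in> J \<or> q \<in> J" for p q
    proof (rule ccontr)
      assume "inf p q \<noteq> 0"
      moreover have "0 \<le> inf p q" "inf p q \<le> u" using that by (simp_all add: le_infI1)
      ultimately obtain J where J: "mv_prime (gamma u) J" "inf p q \<notin> J"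
        using prime_ideal_separation[of "inf p q" u] by blast
      then have "p \<in> J \<or> q \<in> J" "mv_ideal (gamma u) J" using that(4) by (auto simp: mv_prime_def)
      then show False
        using J(2) that(1,3) ideal_gammaD(3)[of u J p "inf p q"] ideal_gammaD(3)[of u J q "inf p q"]
        by auto
    qed
    then show "inf ?a (pprt (x - y)) = 0 \<and> inf ?b (pprt (y - x)) = 0"
      using * le by simp
  next
    assume *: "inf ?a (pprt (x - y)) = 0 \<and> inf ?b (pprt (y - x)) = 0"
    show "\<forall>J. mv_prime (gamma u) J \<longrightarrow>
      (?a \<in> J \<or> pprt (x - y) \<in> J) \<and> (?b \<in> J \<or> pprt (y - x) \<in> J)"
    proof (intro allI impI)
      fix J assume J: "mv_prime (gamma u) J"
      then have "mv_ideal (gamma u) J" by (simp add: mv_prime_def)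
      then show "(?a \<in> J \<or> pprt (x - y) \<in> J) \<and> (?b \<in> J \<or> pprt (y - x) \<in> J)"
        using prime_inf[OF _ J] * le by simp
    qed
  qed
  finally show ?thesis .
qed

end

text \<open>The infimum of an MV-algebra, written with the basic operations because these are all
  that terms can express.\<close>

definition mvmeet :: "'a mv \<Rightarrow> 'a \<Rightarrow> 'a \<Rightarrow> 'a" where
  "mvmeet A x y = mvminus A x (mvminus A x y)"

definition mvecc :: "'a mv \<Rightarrow> 'a \<Rightarrow> 'a \<Rightarrow> 'a" where
  "mvecc A x y = mvplus A (mvmeet A (mvminus A (mvneg A y) y) (mvminus A x y))
     (mvmeet A (mvminus A y (mvneg A y)) (mvminus A y x))"

context lattice_ab_group_add
begin

lemma mvmeet_gamma: "0 \<le> x \<Longrightarrow> 0 \<le> y \<Longrightarrow> mvmeet (gamma u) x y = inf x y"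
proof -
  assume *: "0 \<le> x" "0 \<le> y"
  have "x - pprt (x - y) = inf y x"
    by (simp add: pprt_def diff_sup_eq_inf add_inf_distrib_left add_diff_eq)
  then show ?thesis using * by (simp add: mvmeet_def mvminus_gamma inf.commute)
qed

lemma mvecc_eq_0_iff:
  assumes x: "0 \<le> x" "x \<le> u" and y: "0 \<le> y" "y \<le> u"
  shows "mvecc (gamma u) x y = 0 \<longleftrightarrow> eccentric_le (gamma u) x y"
proof -
  have u: "0 \<le> u" using x order.trans by blast
  have "0 \<le> u - y" "u - y \<le> u" using gamma_closed(1)[OF u y] by auto
  then have "pprt (u - y - y) \<le> u" "pprt (y - (u - y)) \<le> u" using y pprt_diff_le by auto
  then show ?thesis
    unfolding eccentric_le_gamma[OF assms]
    by (simp add: mvecc_def mvmeet_gamma mvminus_gamma truncated_sum_eq_0 le_infI1)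
qed

lemma mvdist_eq_0_iff:
  assumes x: "0 \<le> x" "x \<le> u" and y: "0 \<le> y" "y \<le> u"
  shows "mvdist (gamma u) x y = 0 \<longleftrightarrow> x = y"
  using assms pprt_diff_le
  by (auto simp: mvdist_def mvminus_gamma truncated_sum_eq_0 pprt_eq_0_iff intro: order.antisym)

text \<open>Prime quotients are nontrivial, so there 0 lies strictly below its complement and the
  relation says \<open>x \<le> 0\<close>. In the polynomial this appears as
  \<open>inf u x = x\<close>.\<close>

lemma eccentric_le_0_iff:
  assumes "0 \<le> x" "x \<le> u"
  shows "eccentric_le (gamma u) x 0 \<longleftrightarrow> x = 0"
proof -
  have u: "0 \<le> u" using assms order.trans by blast
  then have "inf (pprt (u - 0 - 0)) (pprt (x - 0)) = x" "inf (pprt (0 - (u - 0))) (pprt (0 - x)) = 0"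
    using assms by (simp_all add: inf_absorb2)
  then show ?thesis using eccentric_le_gamma[of x u 0] assms u by simp
qed

end

section \<open>Functoriality and order of the Grothendieck group\<close>

lemma star_homD:
  assumes "star_hom h"
  shows "h (x + y) = h x + h y" "h (x * y) = h x * h y" "h (star x) = star (h x)" "h 1 = 1" "h 0 = 0"
proof -
  show *: "h (x + y) = h x + h y" "h (x * y) = h x * h y" "h (star x) = star (h x)" "h 1 = 1" for x y
    using assms by (auto simp: star_hom_def)
  show "h 0 = 0" using *(1)[of 0 0] by simp
qed

lemma star_hom_sum: "star_hom h \<Longrightarrow> h (sum f S) = (\<Sum>i\<in>S. h (f i))"
  by (induction S rule: infinite_finite_induct) (simp_all add: star_homD)

lemma map_mat_mult:
  assumes "star_hom h" "A \<in> carrier_mat k m" "B \<in> carrier_mat m n"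
  shows "map_mat h (A * B) = map_mat h A * map_mat h B"
  using assms(2,3)
  by (intro eq_matI) (auto simp: scalar_prod_def star_hom_sum[OF assms(1)] star_homD[OF assms(1)])

lemma map_mat_adj: "star_hom h \<Longrightarrow> map_mat h (adj A) = adj (map_mat h A)"
  by (intro eq_matI) (auto simp: adj_def star_homD)

lemma projection_map_mat:
  assumes "star_hom h" "projection_mat p"
  shows "projection_mat (map_mat h p)"
proof -
  note p = projection_matD[OF assms(2)]
  have "map_mat h p * map_mat h p = map_mat h p"
    using map_mat_mult[OF assms(1) p(1) p(1)] p(2) by simp
  moreover have "adj (map_mat h p) = map_mat h p"
    using map_mat_adj[OF assms(1), of p] p(3) by simp
  ultimately show ?thesis using p(1) unfolding projection_mat_def by auto
qed

text \<open>The entrywise image of the partial isometry is again a witness.\<close>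

lemma mvn_equiv_map_mat:
  assumes "star_hom h" "mvn_equiv p q"
  shows "mvn_equiv (map_mat h p) (map_mat h q)"
proof -
  obtain v k m where v: "projection_mat p" "projection_mat q" "v \<in> carrier_mat m k"
    "p \<in> carrier_mat k k" "q \<in> carrier_mat m m" "adj v * v = p" "v * adj v = q"
    using assms(2) by (rule mvn_equivE)
  have "adj (map_mat h v) * map_mat h v = map_mat h p" "map_mat h v * adj (map_mat h v) = map_mat h q"
    using map_mat_mult[OF assms(1) adj_carrier[OF v(3)] v(3)]
      map_mat_mult[OF assms(1) v(3) adj_carrier[OF v(3)]] v(6,7) map_mat_adj[OF assms(1)] by simp_all
  then show ?thesis
    using v(3-5) by (intro mvn_equivI[of _ _ "map_mat h v" m k] projection_map_mat assms(1) v(1,2)) auto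
qed

lemma mvn_class_eq_iff:
  "projection_mat p \<Longrightarrow> projection_mat q \<Longrightarrow> mvn_class p = mvn_class q \<longleftrightarrow> mvn_equiv p q"
  using Quotient3_rel[OF Quotient3_mvn_class, of p q] mvn_refl by blast

lemma mvn_class_cases:
  obtains p where "projection_mat p" "a = mvn_class p"
  using Quotient3_abs_rep[OF Quotient3_mvn_class, of a] Quotient3_rep_reflp[OF Quotient3_mvn_class, of a]
    mvn_equivD by metis

lemma mvn_class_block_sum:
  "projection_mat p \<Longrightarrow> projection_mat q \<Longrightarrow> mvn_class (block_sum p q) = mvn_class p + mvn_class q"
  using plus_mvn_class.abs_eq[OF mvn_refl mvn_refl] by metis

lemma mvn_map_class:
  assumes "star_hom h" "projection_mat p"
  shows "mvn_map h (mvn_class p) = mvn_class (map_mat h p)"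
  unfolding mvn_map_def
proof (rule the_equality)
  fix b assume "\<exists>q. projection_mat q \<and> mvn_class p = mvn_class q \<and> b = mvn_class (map_mat h q)"
  then obtain q where q: "projection_mat q" "mvn_equiv p q" "b = mvn_class (map_mat h q)"
    using mvn_class_eq_iff[OF assms(2)] by blast
  then show "b = mvn_class (map_mat h p)"
    using mvn_equiv_map_mat[OF assms(1) mvn_sym[OF q(2)]] projection_map_mat[OF assms(1)] assms(2)
    by (simp add: mvn_class_eq_iff)
qed (use assms in blast)

lemma mvn_map_add:
  assumes h: "star_hom h"
  shows "mvn_map h (a + b) = mvn_map h a + mvn_map h b"
proof -
  obtain p where p: "projection_mat p" "a = mvn_class p" by (rule mvn_class_cases)
  obtain q where q: "projection_mat q" "b = mvn_class q" by (rule mvn_class_cases)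
  obtain k l where "p \<in> carrier_mat k k" "q \<in> carrier_mat l l"
    using projection_matD(1)[OF p(1)] projection_matD(1)[OF q(1)] by blast
  then have "map_mat h (block_sum p q) = block_sum (map_mat h p) (map_mat h q)"
    by (intro eq_matI) (auto simp: block_sum_def star_homD[OF h])
  then show ?thesis
    using p q by (simp add: mvn_map_class[OF h] projection_block_sum projection_map_mat[OF h]
        flip: mvn_class_block_sum)
qed

lemma mvn_map_0: "star_hom h \<Longrightarrow> mvn_map h 0 = 0"
proof -
  assume h: "star_hom h"
  have "map_mat h (0\<^sub>m 0 0) = 0\<^sub>m 0 0" by (rule eq_matI) auto
  then show ?thesis
    using mvn_map_class[OF h projection_zero[of 0]] by (simp add: zero_mvn_class_def)
qed

lemma projection_one: "projection_mat (1\<^sub>m 1 :: 'a::cstar_algebra mat)"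
proof -
  have "1\<^sub>m 1 * 1\<^sub>m 1 = (1\<^sub>m 1 :: 'a mat)" "adj (1\<^sub>m 1) = (1\<^sub>m 1 :: 'a mat)"
    by (intro eq_matI; auto simp: scalar_prod_def adj_def)+
  then show ?thesis unfolding projection_mat_def by (auto intro: exI[of _ 1])
qed

lemma mvn_map_one:
  assumes "star_hom h"
  shows "mvn_map h (mvn_class (1\<^sub>m 1)) = mvn_class (1\<^sub>m 1)"
proof -
  have "map_mat h (1\<^sub>m 1) = 1\<^sub>m 1" by (intro eq_matI) (auto simp: star_homD[OF assms])
  then show ?thesis using mvn_map_class[OF assms projection_one] by simp
qed

lemma k0_of_add: "k0_of (a + b) = k0_of a + k0_of b"
  by (simp add: k0_of_def plus_abs_K0)

lemma k0_of_0: "k0_of 0 = 0"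
  by (simp add: k0_of_def zero_K0_def)

lemma k0_of_eq_iff: "k0_of a = k0_of b \<longleftrightarrow> (\<exists>c. a + c = b + c)"
  by (simp add: k0_of_def abs_K0_eq)

text \<open>The description in \<open>k0_map\<close> ranges over all ways to write the element as a
  difference. Additivity of \<open>mvn_map\<close> carries the cancelling summand along, which makes
  the value unique.\<close>

lemma k0_map_k0_of:
  assumes "star_hom h"
  shows "k0_map h (k0_of a) = k0_of (mvn_map h a)"
  unfolding k0_map_def
proof (rule the_equality)
  show "\<exists>a' b. k0_of a = k0_of a' - k0_of b \<and> k0_of (mvn_map h a) = k0_of (mvn_map h a') - k0_of (mvn_map h b)"
    by (intro exI[of _ a] exI[of _ 0]) (simp add: mvn_map_0[OF assms] k0_of_0)
  fix y assume "\<exists>a' b. k0_of a = k0_of a' - k0_of b \<and> y = k0_of (mvn_map h a') - k0_of (mvn_map h b)"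
  then obtain a' b where "k0_of a = k0_of a' - k0_of b"
    and y: "y = k0_of (mvn_map h a') - k0_of (mvn_map h b)"
    by blast
  then have "k0_of (a + b) = k0_of a'" by (simp add: k0_of_add)
  then obtain c where "a + b + c = a' + c" by (auto simp: k0_of_eq_iff)
  then have "mvn_map h (a + b) + mvn_map h c = mvn_map h a' + mvn_map h c"
    by (metis mvn_map_add[OF assms])
  then have "k0_of (mvn_map h a + mvn_map h b) = k0_of (mvn_map h a')"
    by (auto simp: k0_of_eq_iff mvn_map_add[OF assms])
  then show "y = k0_of (mvn_map h a)" using y by (metis k0_of_add add_diff_cancel_right')
qed

lemma k0_le_iff: "k0_le x y \<longleftrightarrow> (\<exists>a. y = x + k0_of a)"
  by (auto simp: k0_le_def image_iff algebra_simps)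

text \<open>Both \<open>x\<close> and \<open>k0_unit - x\<close> come from classes, and
  \<open>mvn_map\<close> preserves sums and the class of 1, so this decomposition of the unit is
  carried over.\<close>

lemma k0_map_elliott:
  assumes h: "star_hom h" and x: "x \<in> mvcarrier elliott"
  shows "k0_map h x \<in> mvcarrier elliott"
proof -
  obtain a b where a: "x = k0_of a" and b: "k0_unit = x + k0_of b"
    using x by (auto simp: elliott_def k0_le_iff)
  then have "k0_of (mvn_class (1\<^sub>m 1)) = k0_of (a + b)" by (simp add: k0_unit_def k0_of_add)
  then obtain c where "mvn_class (1\<^sub>m 1) + c = a + b + c" by (auto simp: k0_of_eq_iff)
  then have "mvn_class (1\<^sub>m 1) + mvn_map h c = mvn_map h a + mvn_map h b + mvn_map h c"
    by (metis mvn_map_add[OF h] mvn_map_one[OF h])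
  then have "k0_unit = k0_of (mvn_map h a + mvn_map h b)" unfolding k0_unit_def k0_of_eq_iff by blast
  then show ?thesis by (auto simp: a k0_map_k0_of[OF h] elliott_def k0_le_iff k0_of_add)
qed

section \<open>The Murray-von Neumann order and the order of K0\<close>

lemma mvn_class_zero: "mvn_class (0\<^sub>m k k :: 'a::cstar_algebra mat) = 0"
proof -
  have "mvn_equiv (0\<^sub>m k k :: 'a mat) (0\<^sub>m 0 0)"
    \<comment> \<open>The partial isometry is the matrix without rows.\<close>
    by (rule mvn_equivI[where v = "0\<^sub>m 0 k" and m = 0 and k = k]) (auto simp: projection_zero)
  then show ?thesis
    by (simp add: zero_mvn_class_def mvn_class_eq_iff projection_zero)
qed

text \<open>The partial isometry from \<open>block_sum r s\<close> to \<open>r + s\<close> has first row \<open>(r, s)\<close>.\<close>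

lemma mvn_class_add_orthogonal:
  assumes r: "projection_mat r" "r \<in> carrier_mat k k" and s: "projection_mat s" "s \<in> carrier_mat k k"
    and rs: "r * s = 0\<^sub>m k k" "s * r = 0\<^sub>m k k" and "projection_mat (r + s)"
  shows "mvn_class (r + s) = mvn_class r + mvn_class s"
proof -
  let ?z = "0\<^sub>m k k"
  let ?v = "four_block_mat r s ?z ?z"
  note R = projection_matD[OF r(1)] and S = projection_matD[OF s(1)]
  have z: "?z \<in> carrier_mat k k" by simp
  have av: "adj ?v = four_block_mat r ?z s ?z"
    using adj_four_block[OF r(2) s(2) z z] R S by simp
  have "mvn_equiv (block_sum r s) (block_sum (r + s) ?z)"
  proof (rule mvn_equivI[where v = ?v and k = "k + k" and m = "k + k"])
    show "adj ?v * ?v = block_sum r s"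
      unfolding av using r(2) s(2) R S rs
      by (simp add: block_sum_def mult_four_block_mat[OF r(2) z s(2) z r(2) s(2) z z])
    show "?v * adj ?v = block_sum (r + s) ?z"
      unfolding av using r(2) s(2) R S rs
      by (simp add: block_sum_def mult_four_block_mat[OF r(2) s(2) z z r(2) z s(2) z])
    show "projection_mat (block_sum r s)" "projection_mat (block_sum (r + s) ?z)"
      by (intro projection_block_sum projection_zero r(1) s(1) assms(7))+
  qed (use r s in \<open>auto simp: block_sum_def\<close>)
  then have "mvn_class (block_sum r s) = mvn_class (block_sum (r + s) ?z)"
    using r(1) s(1) assms(7) by (simp add: mvn_class_eq_iff projection_block_sum projection_zero)
  then show ?thesis
    using r(1) s(1) assms(7) by (simp add: mvn_class_block_sum mvn_class_zero projection_zero)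
qed

text \<open>For a subprojection \<open>r\<close> of \<open>q\<close>, the difference
  \<open>q - r\<close> is a projection orthogonal to \<open>r\<close>; its class is the summand
  sought.\<close>

lemma mvn_le_add:
  assumes "mvn_le a b"
  shows "\<exists>c. b = a + c"
proof -
  obtain p r q where p: "projection_mat p" and q: "projection_mat q" and pr: "mvn_equiv p r"
    and dim: "dim_row r = dim_row q" and rq: "r * q = r" and ab: "a = mvn_class p" "b = mvn_class q"
    using assms unfolding mvn_le_def by blast
  have r: "projection_mat r" using mvn_equivD[OF mvn_sym[OF pr]] .
  define k where "k = dim_row q"
  have rk: "r \<in> carrier_mat k k" and qk: "q \<in> carrier_mat k k"
    using projection_matD(1)[OF r] projection_matD(1)[OF q] unfolding dim k_def .
  note R = projection_matD(2,3)[OF r] and Q = projection_matD(2,3)[OF q]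
  have qr: "q * r = r" using adj_mult[OF rk qk] rq R Q by simp
  define s where "s = q - r"
  have sk: "s \<in> carrier_mat k k" using rk qk by (simp add: s_def minus_carrier_mat)
  have rs: "r * s = 0\<^sub>m k k"
    unfolding s_def using mult_minus_distrib_mat[OF rk qk rk] rq R rk by simp
  have sr: "s * r = 0\<^sub>m k k"
    unfolding s_def using minus_mult_distrib_mat[OF qk rk rk] qr R rk by simp
  have qs: "q * s = s"
    unfolding s_def using mult_minus_distrib_mat[OF qk qk rk] qr Q by simp
  have "s * s = q * s - r * s"
    using minus_mult_distrib_mat[OF qk rk sk] by (simp add: s_def)
  then have "s * s = s" using qs rs sk by (intro eq_matI) auto
  moreover have "adj s = s"
  proof -
    have "adj s = adj q - adj r"
    proof (rule eq_matI)
      have minus: "star (x - y) = star x - star y" for x y :: 'a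
        using star_add[of "x - y" y] by simp
      show "adj s $$ (i, j) = (adj q - adj r) $$ (i, j)"
        if "i < dim_row (adj q - adj r)" "j < dim_col (adj q - adj r)" for i j
        using that rk qk by (simp add: s_def adj_def minus)
    qed (use rk qk in \<open>auto simp: s_def adj_def\<close>)
    then show ?thesis using R Q by (simp add: s_def)
  qed
  ultimately have s: "projection_mat s" using sk by (auto simp: projection_mat_def)
  have rsq: "r + s = q" unfolding s_def using rk qk by (intro eq_matI) auto
  have "mvn_class q = mvn_class r + mvn_class s"
    using mvn_class_add_orthogonal[OF r rk s sk rs sr] q by (simp add: rsq)
  moreover have "mvn_class p = mvn_class r" using pr p r by (simp add: mvn_class_eq_iff)
  ultimately show ?thesis using ab by auto
qed

text \<open>A representative of \<open>a\<close> padded with zeros is a subprojection of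
  \<open>block_sum p q\<close>.\<close>

lemma mvn_le_addI: "mvn_le a (a + c)"
proof -
  obtain p where p: "projection_mat p" "a = mvn_class p" by (rule mvn_class_cases)
  obtain q where q: "projection_mat q" "c = mvn_class q" by (rule mvn_class_cases)
  obtain k l where pk: "p \<in> carrier_mat k k" and ql: "q \<in> carrier_mat l l"
    using projection_matD(1)[OF p(1)] projection_matD(1)[OF q(1)] by blast
  let ?r = "block_sum p (0\<^sub>m l l)"
  have "projection_mat ?r" using p(1) by (simp add: projection_block_sum projection_zero)
  moreover have "mvn_class ?r = mvn_class p"
    using p(1) by (simp add: mvn_class_block_sum mvn_class_zero projection_zero)
  ultimately have "mvn_equiv p ?r" using p by (metis mvn_class_eq_iff)
  moreover have "?r * block_sum p q = ?r"
    using pk ql projection_matD(2)[OF p(1)]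
    by (simp add: block_sum_def mult_four_block_mat[of p k k _ l _ l _ p k _ l])
  moreover have "dim_row ?r = dim_row (block_sum p q)" using pk ql by (simp add: block_sum_def)
  moreover have "a + c = mvn_class (block_sum p q)" using p q by (simp add: mvn_class_block_sum)
  ultimately show ?thesis
    unfolding mvn_le_def using p q projection_block_sum by blast
qed

text \<open>The hypothesis provides a class \<open>a\<close> representing \<open>x\<close>. As
  \<open>k0_mvn_le\<close> admits any representing classes, \<open>y = x + k0_of c\<close> may be
  represented by \<open>a + c\<close>.\<close>

lemma k0_mvn_le_iff:
  assumes "k0_le 0 x"
  shows "k0_mvn_le x y \<longleftrightarrow> k0_le x y"
proof
  assume "k0_mvn_le x y"
  then show "k0_le x y"
    using mvn_le_add unfolding k0_mvn_le_def k0_le_iff by (metis k0_of_add)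
next
  assume "k0_le x y"
  then obtain a c where "x = k0_of a" "y = k0_of (a + c)"
    using assms by (auto simp: k0_le_iff k0_of_add)
  then show "k0_mvn_le x y" unfolding k0_mvn_le_def using mvn_le_addI by blast
qed

text \<open>Translation invariance makes the lattice provided by \<open>afl_algebra\<close> a
  lattice-ordered group. \<open>k0_meet\<close> is its infimum, so \<open>elliott\<close> is
  literally an instance of \<open>gamma\<close>.\<close>

lemma afl_elliott:
  assumes "afl_algebra TYPE('a::cstar_algebra)"
  obtains inf sup where
    "class.lattice_ab_group_add (+) 0 (-) uminus (k0_le :: 'a K0 \<Rightarrow> _) k0_less inf sup"
    "(elliott :: 'a K0 mv) = lattice_ab_group_add.gamma (+) 0 (-) k0_le inf k0_unit"
proof -
  obtain inf sup where lat: "class.lattice inf (k0_le :: 'a K0 \<Rightarrow> _) k0_less sup"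
    using assms unfolding afl_algebra_def by blast
  interpret lat: Lattices.lattice inf "k0_le :: 'a K0 \<Rightarrow> _" k0_less sup by (fact lat)
  interpret G: lattice_ab_group_add "(+)" "0 :: 'a K0" "(-)" uminus k0_le k0_less inf sup
  proof unfold_locales
    show "k0_le (c + a) (c + b)" if "k0_le a b" for a b c :: "'a K0"
      using that by (simp add: k0_le_def)
  qed
  have "k0_meet x y = inf x y" for x y :: "'a K0"
    unfolding k0_meet_def by (rule the_equality) (auto intro: lat.order.antisym)
  then have "(elliott :: 'a K0 mv) = G.gamma k0_unit" by (simp add: elliott_def G.gamma_def)
  then show thesis using that G.lattice_ab_group_add_axioms by blast
qed

section \<open>Interpretation of terms\<close>

lemma term_strings_mono: "\<alpha> \<in> term_strings m \<Longrightarrow> m \<le> n \<Longrightarrow> \<alpha> \<in> term_strings n"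
  by (induction rule: term_strings.induct) (auto intro: term_strings.intros)

text \<open>\<open>interprets\<close> admits all variables, so a suitable \<open>n\<close> depends
  on the string.\<close>

lemma interprets_term: "interprets A g \<phi> x \<Longrightarrow> \<exists>n. \<phi> \<in> term_strings n"
proof (induction rule: interprets.induct)
  case (2 j)
  show ?case by (rule exI[of _ "Suc j"]) (simp add: term_strings.intros)
next
  case (4 \<alpha> x \<beta> y)
  then obtain m n where "\<alpha> \<in> term_strings m" "\<beta> \<in> term_strings n" by blast
  then have "\<alpha> \<in> term_strings (max m n)" "\<beta> \<in> term_strings (max m n)"
    by (auto elim: term_strings_mono)
  then show ?case using term_strings.intros(4) by blast
qed (use term_strings.intros in blast)+

text \<open>Unique readability of sums: with an empty stack the scanner stops at
  \<open>Oplus\<close>, hence exactly behind the left summand.\<close>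

lemma plus_string_inject:
  assumes "\<alpha> \<in> term_strings m" "\<alpha>' \<in> term_strings n" "\<alpha> @ Oplus # \<beta> = \<alpha>' @ Oplus # \<beta>'"
  shows "\<alpha> = \<alpha>' \<and> \<beta> = \<beta>'"
proof -
  have \<alpha>: "\<alpha> \<in> term_strings (max m n)" "\<alpha>' \<in> term_strings (max m n)"
    using assms(1,2) by (auto elim: term_strings_mono)
  have "scan (max m n) True [] (\<alpha> @ Oplus # \<beta>) = Some (\<alpha>, Oplus # \<beta>)"
    "scan (max m n) True [] (\<alpha>' @ Oplus # \<beta>') = Some (\<alpha>', Oplus # \<beta>')"
    by (rule scan_term, rule \<alpha>, simp)+
  then show ?thesis unfolding assms(3) by simp
qed

lemma interprets_unique:
  "interprets A g \<phi> x \<Longrightarrow> interprets A g \<phi> y \<Longrightarrow> x = y"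
proof (induction arbitrary: y rule: interprets.induct)
  case 1
  then show ?case by (cases rule: interprets.cases) (use interprets_term in \<open>auto elim: term_strings.cases\<close>)
next
  case (2 j)
  then show ?case by (cases rule: interprets.cases) (use interprets_term in \<open>auto elim: term_strings.cases\<close>)
next
  case (3 \<alpha> x)
  have ne: "\<alpha> \<noteq> []" using interprets_term[OF 3(1)] by (auto elim: term_strings.cases)
  from 3(3) obtain y' where "interprets A g \<alpha> y'" "y = mvneg A y'"
  proof (cases rule: interprets.cases)
    case (4 \<beta> x' \<gamma> y')
    then have "last (\<alpha> @ [Star]) = last (LPar # \<beta> @ Oplus # \<gamma> @ [RPar])" by simp
    then show ?thesis by simp
  qed (use ne in auto)
  then show ?case using 3 by simp
next
  case (4 \<alpha> x \<beta> x')
  from 4(5) obtain y1 y2 where "interprets A g \<alpha> y1" "interprets A g \<beta> y2" "y = mvplus A y1 y2"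
  proof (cases rule: interprets.cases)
    case (3 \<gamma> x')
    then have "last (LPar # \<alpha> @ Oplus # \<beta> @ [RPar]) = last (\<gamma> @ [Star])" by simp
    then show ?thesis by simp
  next
    case (4 \<alpha>' y1 \<beta>' y2)
    then have "\<alpha> @ Oplus # \<beta> = \<alpha>' @ Oplus # \<beta>'" by (metis append_Cons append_assoc append_same_eq list.inject)
    moreover obtain m n where "\<alpha> \<in> term_strings m" "\<alpha>' \<in> term_strings n"
      using interprets_term \<open>interprets A g \<alpha> x\<close> \<open>interprets A g \<alpha>' y1\<close> by meson
    ultimately have "\<alpha> = \<alpha>' \<and> \<beta> = \<beta>'" by (metis plus_string_inject)
    then show ?thesis using 4 that by blast
  qed
  then show ?case using 4 by blast
qed

lemma interp_eqI: "interprets A g \<phi> x \<Longrightarrow> interp A g \<phi> = x"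
  unfolding interp_def using interprets_unique by (intro the_equality)

lemma interprets_interp: "\<phi> \<in> term_strings n \<Longrightarrow> interprets A g \<phi> (interp A g \<phi>)"
proof -
  assume "\<phi> \<in> term_strings n"
  then have "\<exists>x. interprets A g \<phi> x"
    by induction (blast intro: interprets.intros)+
  then show ?thesis using interp_eqI by metis
qed

definition denotes ::
  "nat \<Rightarrow> 'a mv \<Rightarrow> (nat \<Rightarrow> 'a) \<Rightarrow> sym list \<Rightarrow> sym list \<Rightarrow> piece list \<Rightarrow> 'a \<Rightarrow> bool" where
  "denotes n A g \<phi> \<psi> t x \<longleftrightarrow> inst \<phi> \<psi> t \<in> term_strings n \<and> interprets A g (inst \<phi> \<psi> t) x"

definition neg_template :: "piece list \<Rightarrow> piece list" where
  "neg_template t = t @ [Lit [Star]]"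

definition plus_template :: "piece list \<Rightarrow> piece list \<Rightarrow> piece list" where
  "plus_template s t = Lit [LPar] # s @ Lit [Oplus] # t @ [Lit [RPar]]"

text \<open>The double negation of \<open>t\<close> copies the definition of \<open>mvminus\<close>
  literally, so \<open>denotes_minus\<close> holds in every record, whether or not its negation is
  involutive.\<close>

definition minus_template :: "piece list \<Rightarrow> piece list \<Rightarrow> piece list" where
  "minus_template s t = neg_template (plus_template (neg_template s) (neg_template (neg_template t)))"

definition meet_template :: "piece list \<Rightarrow> piece list \<Rightarrow> piece list" where
  "meet_template s t = minus_template s (minus_template s t)"

definition dist_template :: "piece list \<Rightarrow> piece list \<Rightarrow> piece list" where
  "dist_template s t = plus_template (minus_template s t) (minus_template t s)"

definition ecc_template :: "piece list \<Rightarrow> piece list \<Rightarrow> piece list" where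
  "ecc_template s t = plus_template
     (meet_template (minus_template (neg_template t) t) (minus_template s t))
     (meet_template (minus_template t (neg_template t)) (minus_template t s))"

lemma denotes_neg: "denotes n A g \<phi> \<psi> t x \<Longrightarrow> denotes n A g \<phi> \<psi> (neg_template t) (mvneg A x)"
  by (auto simp: denotes_def neg_template_def intro: term_strings.intros interprets.intros)

lemma denotes_plus:
  assumes "denotes n A g \<phi> \<psi> s x" "denotes n A g \<phi> \<psi> t y"
  shows "denotes n A g \<phi> \<psi> (plus_template s t) (mvplus A x y)"
  using assms term_strings.intros(4)[of "inst \<phi> \<psi> s" n "inst \<phi> \<psi> t"]
    interprets.intros(4)[of A g "inst \<phi> \<psi> s" x "inst \<phi> \<psi> t" y]
  by (simp add: denotes_def plus_template_def)

lemma denotes_minus: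
  "denotes n A g \<phi> \<psi> s x \<Longrightarrow> denotes n A g \<phi> \<psi> t y \<Longrightarrow>
    denotes n A g \<phi> \<psi> (minus_template s t) (mvminus A x y)"
  unfolding minus_template_def mvminus_def mvtimes_def by (intro denotes_neg denotes_plus)

lemma denotes_meet:
  "denotes n A g \<phi> \<psi> s x \<Longrightarrow> denotes n A g \<phi> \<psi> t y \<Longrightarrow>
    denotes n A g \<phi> \<psi> (meet_template s t) (mvmeet A x y)"
  unfolding meet_template_def mvmeet_def by (intro denotes_minus)

lemma denotes_dist:
  "denotes n A g \<phi> \<psi> s x \<Longrightarrow> denotes n A g \<phi> \<psi> t y \<Longrightarrow>
    denotes n A g \<phi> \<psi> (dist_template s t) (mvdist A x y)"
  unfolding dist_template_def mvdist_def by (intro denotes_minus denotes_plus)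

lemma denotes_ecc:
  "denotes n A g \<phi> \<psi> s x \<Longrightarrow> denotes n A g \<phi> \<psi> t y \<Longrightarrow>
    denotes n A g \<phi> \<psi> (ecc_template s t) (mvecc A x y)"
  unfolding ecc_template_def mvecc_def by (intro denotes_minus denotes_meet denotes_plus denotes_neg)

lemma denotes_Arg:
  "\<phi> \<in> term_strings n \<Longrightarrow> denotes n A g \<phi> \<psi> [Arg False] (interp A g \<phi>)"
  "\<psi> \<in> term_strings n \<Longrightarrow> denotes n A g \<phi> \<psi> [Arg True] (interp A g \<psi>)"
  by (simp_all add: denotes_def interprets_interp)

lemma denotesD:
  assumes "denotes n A g \<phi> \<psi> t x"
  shows "inst \<phi> \<psi> t \<in> term_strings n" "interp A g (inst \<phi> \<psi> t) = x"
  using assms interp_eqI by (auto simp: denotes_def)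

section \<open>The generators\<close>

lemma coord_mcnaughton:
  assumes "j < n"
  shows "coord n j \<in> mcnaughton n"
proof -
  have "coord n j \<in> cube n \<rightarrow>\<^sub>E {0..1}"
    using assms by (auto simp: coord_def cube_def PiE_iff)
  moreover have "continuous_on (cube n) (coord n j) \<longleftrightarrow> continuous_on (cube n) (\<lambda>x. x j)"
    by (rule continuous_on_cong) (simp_all add: coord_def)
  then have "continuous_on (cube n) (coord n j)"
    using continuous_on_subset[OF continuous_on_product_coordinates subset_UNIV] by simp
  moreover have "\<exists>L :: ((nat \<Rightarrow> int) \<times> int) set. finite L \<and> (\<forall>x\<in>cube n. \<exists>(a, b)\<in>L.
      coord n j x = real_of_int b + (\<Sum>i<n. real_of_int (a i) * x i))"
  proof (intro exI conjI ballI)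
    let ?a = "\<lambda>i. if i = j then 1 else 0 :: int"
    show "finite {(?a, 0 :: int)}" by simp
    fix x assume x: "x \<in> cube n"
    have "(\<Sum>i<n. real_of_int (?a i) * x i) = (\<Sum>i<n. if i = j then x i else 0)"
      by (rule sum.cong) auto
    then have "(\<Sum>i<n. real_of_int (?a i) * x i) = coord n j x"
      using x assms by (simp add: coord_def)
    then show "\<exists>(a, b)\<in>{(?a, 0)}. coord n j x = real_of_int b + (\<Sum>i<n. real_of_int (a i) * x i)"
      by simp
  qed
  ultimately show ?thesis unfolding mcnaughton_def by blast
qed

text \<open>The coordinates are McNaughton functions, hence in the range of \<open>e\<close>, which
  gives \<open>inv_into\<close> its meaning.\<close>

lemma generator_elliott:
  assumes "mv_iso elliott (Free n) e" "star_hom h" "j < n"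
  shows "generator n e h j \<in> mvcarrier elliott"
proof -
  have "coord n j \<in> e ` mvcarrier elliott"
    using assms(1) coord_mcnaughton[OF assms(3)] by (simp add: mv_iso_def bij_betw_def Free_def)
  then have "inv_into (mvcarrier elliott) e (coord n j) \<in> mvcarrier elliott" by (rule inv_into_into)
  then show ?thesis unfolding generator_def by (rule k0_map_elliott[OF assms(2)])
qed

section \<open>Reductions\<close>

definition instance_of :: "nat \<Rightarrow> nat \<Rightarrow> sym list \<Rightarrow> (sym list \<times> sym list) option" where
  "instance_of i n = (if i = 4 then term_of n else pair_of n)"

definition zero_template :: "nat \<Rightarrow> piece list" where
  "zero_template i =
     (if i = 1 then dist_template [Arg False] [Arg True]
      else if i = 2 then minus_template [Arg False] [Arg True]
      else if i = 3 then ecc_template [Arg False] [Arg True]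
      else [Arg False])"

definition zero_instance :: "nat \<Rightarrow> piece list \<Rightarrow> piece list" where
  "zero_instance j t = (if j = 4 then t else Lit [LPar] # t @ [Lit [RPar, LPar, Zero, RPar]])"

lemma inst_zero_instance:
  "inst \<phi> \<psi> (zero_instance j t) = (if j = 4 then inst \<phi> \<psi> t else pair_code (inst \<phi> \<psi> t) [Zero])"
  by (simp add: zero_instance_def pair_code_def)

lemma polytime_computable_instance_template:
  "polytime_computable (\<lambda>\<sigma>. case instance_of i n \<sigma> of None \<Rightarrow> [] | Some (\<phi>, \<psi>) \<Rightarrow> inst \<phi> \<psi> ps)"
  unfolding instance_of_def
  using polytime_computable_term_template polytime_computable_pair_template by auto

lemma mem_pair_problem_iff:
  "\<sigma> \<in> {pair_code \<phi> \<psi> |\<phi> \<psi>. \<phi> \<in> term_strings n \<and> \<psi> \<in> term_strings n \<and> R \<phi> \<psi>} \<longleftrightarrow>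
    (\<exists>\<phi> \<psi>. pair_of n \<sigma> = Some (\<phi>, \<psi>) \<and> R \<phi> \<psi>)"
proof (cases "\<exists>\<phi> \<psi>. \<phi> \<in> term_strings n \<and> \<psi> \<in> term_strings n \<and> \<sigma> = pair_code \<phi> \<psi>")
  case True
  then show ?thesis using pair_of_pair_code pair_code_eq_iff by force
next
  case False
  then show ?thesis by (auto simp: pair_of_def)
qed

lemma term_strings_not_Nil: "\<phi> \<in> term_strings n \<Longrightarrow> \<phi> \<noteq> []"
  by (auto elim: term_strings.cases)

text \<open>The reductions answer ill-formed inputs with the empty string, which must therefore be a
  negative instance.\<close>

lemma Nil_notin_problem: "[] \<notin> problem j n g"
  by (auto simp: problem_def word_problem_def order_problem_def eccentricity_problem_def
      zero_problem_def pair_code_def dest: term_strings_not_Nil)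

lemma pair_of_terms:
  assumes "pair_of n \<sigma> = Some (\<phi>, \<psi>)"
  shows "\<phi> \<in> term_strings n" "\<psi> \<in> term_strings n"
proof -
  obtain \<phi>' \<psi>' where "\<phi>' \<in> term_strings n" "\<psi>' \<in> term_strings n" "\<sigma> = pair_code \<phi>' \<psi>'"
    using assms by (auto simp: pair_of_def split: if_splits)
  then show "\<phi> \<in> term_strings n" "\<psi> \<in> term_strings n" using assms pair_of_pair_code by auto
qed

definition pair_relation :: "nat \<Rightarrow> 'b::cstar_algebra K0 \<Rightarrow> 'b K0 \<Rightarrow> bool" where
  "pair_relation i x y = (if i = 1 then x = y else if i = 2 then k0_mvn_le x y else eccentric_le elliott x y)"

lemma mem_problem_iff:
  assumes "i \<in> {1, 2, 3}"
  shows "\<sigma> \<in> problem i n g \<longleftrightarrow>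
    (\<exists>\<phi> \<psi>. pair_of n \<sigma> = Some (\<phi>, \<psi>) \<and> pair_relation i (interp elliott g \<phi>) (interp elliott g \<psi>))"
proof -
  have "problem i n g = {pair_code \<phi> \<psi> | \<phi> \<psi>. \<phi> \<in> term_strings n \<and> \<psi> \<in> term_strings n \<and>
      pair_relation i (interp elliott g \<phi>) (interp elliott g \<psi>)}"
    using assms by (auto simp: problem_def word_problem_def order_problem_def
        eccentricity_problem_def pair_relation_def)
  then show ?thesis by (simp only: mem_pair_problem_iff)
qed

lemma mem_problem_4_iff: "\<sigma> \<in> problem 4 n g \<longleftrightarrow> \<sigma> \<in> term_strings n \<and> interp elliott g \<sigma> = 0"
  by (simp add: problem_def zero_problem_def)

context
  fixes n :: nat and g :: "nat \<Rightarrow> 'b::cstar_algebra K0"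
  assumes afl: "afl_algebra TYPE('b)" and gen: "\<And>j. j < n \<Longrightarrow> g j \<in> mvcarrier elliott"
begin

lemma interp_elliott:
  assumes "\<phi> \<in> term_strings n"
  shows "interp elliott g \<phi> \<in> mvcarrier elliott"
proof -
  obtain inf sup where
    lat: "class.lattice_ab_group_add (+) 0 (-) uminus (k0_le :: 'b K0 \<Rightarrow> _) k0_less inf sup" and
    gamma: "(elliott :: 'b K0 mv) = lattice_ab_group_add.gamma (+) 0 (-) k0_le inf k0_unit"
    using afl by (rule afl_elliott)
  interpret lattice_ab_group_add "(+)" "0 :: 'b K0" "(-)" uminus k0_le k0_less inf sup
    by (fact lat)
  have unit: "k0_le 0 (k0_unit :: 'b K0)" by (auto simp: k0_le_iff k0_unit_def)
  from assms show ?thesis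
  proof induction
    case 1
    then show ?case using unit by (simp add: interp_eqI[OF interprets.intros(1)] gamma)
  next
    case (2 j)
    then show ?case using gen by (simp add: interp_eqI[OF interprets.intros(2)])
  next
    case (3 \<alpha>)
    then show ?case
      using gamma_closed(1)[OF unit]
      by (simp add: interp_eqI[OF interprets.intros(3)[OF interprets_interp[OF 3(1)]]] gamma)
  next
    case (4 \<alpha> \<beta>)
    have "interp elliott g (LPar # \<alpha> @ Oplus # \<beta> @ [RPar]) =
        mvplus elliott (interp elliott g \<alpha>) (interp elliott g \<beta>)"
      using 4 by (intro interp_eqI interprets.intros interprets_interp)
    then show ?case using 4 gamma_closed(2)[OF unit] unit by (simp add: gamma)
  qed
qed

lemma zero_conditions:
  assumes x: "(x :: 'b K0) \<in> mvcarrier elliott" and y: "y \<in> mvcarrier elliott"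
  shows "mvdist elliott x y = 0 \<longleftrightarrow> x = y"
    and "mvminus elliott x y = 0 \<longleftrightarrow> k0_mvn_le x y"
    and "mvecc elliott x y = 0 \<longleftrightarrow> eccentric_le elliott x y"
    and "k0_mvn_le x 0 \<longleftrightarrow> x = 0"
    and "eccentric_le elliott x 0 \<longleftrightarrow> x = 0"
proof -
  obtain inf sup where
    lat: "class.lattice_ab_group_add (+) 0 (-) uminus (k0_le :: 'b K0 \<Rightarrow> _) k0_less inf sup" and
    gamma: "(elliott :: 'b K0 mv) = lattice_ab_group_add.gamma (+) 0 (-) k0_le inf k0_unit"
    using afl by (rule afl_elliott)
  interpret lattice_ab_group_add "(+)" "0 :: 'b K0" "(-)" uminus k0_le k0_less inf sup
    by (fact lat)
  have x': "k0_le 0 x" "k0_le x k0_unit" and y': "k0_le 0 y" "k0_le y k0_unit"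
    using x y by (simp_all add: gamma)
  show "mvdist elliott x y = 0 \<longleftrightarrow> x = y" unfolding gamma by (rule mvdist_eq_0_iff[OF x' y'])
  show "mvminus elliott x y = 0 \<longleftrightarrow> k0_mvn_le x y"
    unfolding gamma mvminus_gamma pprt_eq_0_iff k0_mvn_le_iff[OF x'(1)] ..
  show "mvecc elliott x y = 0 \<longleftrightarrow> eccentric_le elliott x y"
    unfolding gamma by (rule mvecc_eq_0_iff[OF x' y'])
  show "k0_mvn_le x 0 \<longleftrightarrow> x = 0"
    unfolding k0_mvn_le_iff[OF x'(1)] using x'(1) order.antisym by auto
  show "eccentric_le elliott x 0 \<longleftrightarrow> x = 0"
    unfolding gamma by (rule eccentric_le_0_iff[OF x'])
qed

lemma instance_denotes:
  assumes i: "i \<in> {1, 2, 3, 4}" and "instance_of i n \<sigma> = Some (\<phi>, \<psi>)"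
  shows "\<exists>x. denotes n elliott g \<phi> \<psi> (zero_template i) x \<and> (\<sigma> \<in> problem i n g \<longleftrightarrow> x = 0)"
proof (cases "i = 4")
  case True
  then have "\<phi> = \<sigma>" "\<sigma> \<in> term_strings n"
    using assms(2) by (auto simp: instance_of_def term_of_def split: if_splits)
  then show ?thesis
    using denotes_Arg(1)[of \<sigma> n elliott g \<psi>] True
    by (auto simp: zero_template_def mem_problem_4_iff)
next
  case False
  then have pair: "pair_of n \<sigma> = Some (\<phi>, \<psi>)" using assms(2) by (simp add: instance_of_def)
  note terms = pair_of_terms[OF pair]
  note mem = interp_elliott[OF terms(1)] interp_elliott[OF terms(2)]
  note args = denotes_Arg(1)[OF terms(1), of elliott g \<psi>] denotes_Arg(2)[OF terms(2), of elliott g \<phi>]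
  have problem: "\<sigma> \<in> problem i n g \<longleftrightarrow> pair_relation i (interp elliott g \<phi>) (interp elliott g \<psi>)"
    using i False pair by (subst mem_problem_iff) auto
  consider "i = 1" | "i = 2" | "i = 3" using i False by auto
  then show ?thesis
  proof cases
    case 1
    then show ?thesis
      using denotes_dist[OF args] zero_conditions(1)[OF mem] problem
      by (simp add: zero_template_def pair_relation_def) blast
  next
    case 2
    then show ?thesis
      using denotes_minus[OF args] zero_conditions(2)[OF mem] problem
      by (simp add: zero_template_def pair_relation_def) blast
  next
    case 3
    then show ?thesis
      using denotes_ecc[OF args] zero_conditions(3)[OF mem] problem
      by (simp add: zero_template_def pair_relation_def) blast
  qed
qed

lemma instance_of_problem:
  assumes "i \<in> {1, 2, 3, 4}" "\<sigma> \<in> problem i n g"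
  shows "instance_of i n \<sigma> \<noteq> None"
proof (cases "i = 4")
  case True
  then show ?thesis using assms(2) by (simp add: instance_of_def mem_problem_4_iff term_of_def)
next
  case False
  then have "i \<in> {1, 2, 3}" using assms(1) by simp
  then show ?thesis using assms(2) False by (auto simp: instance_of_def mem_problem_iff)
qed

lemma zero_instance_problem:
  assumes "j \<in> {1, 2, 3, 4}" "\<tau> \<in> term_strings n"
  shows "(if j = 4 then \<tau> else pair_code \<tau> [Zero]) \<in> problem j n g \<longleftrightarrow> interp elliott g \<tau> = 0"
proof (cases "j = 4")
  case True
  then show ?thesis using assms(2) by (simp add: mem_problem_4_iff)
next
  case False
  then have j: "j \<in> {1, 2, 3}" using assms(1) by simp
  have "[Zero] \<in> term_strings n" by (rule term_strings.intros)
  note pair = pair_of_pair_code[OF assms(2) this]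
  have "interp elliott g [Zero] = 0"
    by (simp add: interp_eqI[OF interprets.intros(1)] elliott_def)
  then show ?thesis
    using False j pair zero_conditions(4,5)[OF interp_elliott[OF assms(2)] interp_elliott[OF assms(2)]]
    by (simp add: mem_problem_iff[OF j] pair_relation_def)
qed

text \<open>The reduction to the zero problem and the one from it to problem \<open>j\<close> are
  merged into the single template \<open>zero_instance j (zero_template i)\<close>, so one machine
  performs both.\<close>

theorem polytime_reducible_problems:
  assumes "i \<in> {1, 2, 3, 4}" "j \<in> {1, 2, 3, 4}"
  shows "polytime_reducible (problem i n g) (problem j n g)"
proof -
  let ?\<rho> = "\<lambda>\<sigma>. case instance_of i n \<sigma> of None \<Rightarrow> []
    | Some (\<phi>, \<psi>) \<Rightarrow> inst \<phi> \<psi> (zero_instance j (zero_template i))"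
  have "\<sigma> \<in> problem i n g \<longleftrightarrow> ?\<rho> \<sigma> \<in> problem j n g" for \<sigma>
  proof (cases "instance_of i n \<sigma>")
    case None
    then show ?thesis
      using instance_of_problem[OF assms(1), of \<sigma>] Nil_notin_problem[of j n g] by auto
  next
    case (Some a)
    then obtain \<phi> \<psi> where a: "instance_of i n \<sigma> = Some (\<phi>, \<psi>)" by (cases a) auto
    then obtain x where x: "denotes n elliott g \<phi> \<psi> (zero_template i) x"
      "\<sigma> \<in> problem i n g \<longleftrightarrow> x = 0"
      using instance_denotes[OF assms(1)] by blast
    show ?thesis
      using zero_instance_problem[OF assms(2) denotesD(1)[OF x(1)]] denotesD(2)[OF x(1)] x(2) a
      by (simp add: inst_zero_instance)
  qed
  then show ?thesis
    unfolding polytime_reducible_def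
    by (intro exI[of _ ?\<rho>] conjI allI polytime_computable_instance_template)
qed

end

theorem theorem3p2:
  fixes n :: nat
    and e :: "'a::cstar_algebra K0 \<Rightarrow> (nat \<Rightarrow> real) \<Rightarrow> real"
    and I :: "'a set"
    and h :: "'a \<Rightarrow> 'b::cstar_algebra"
  assumes "n \<ge> 1"
    and "afl_algebra TYPE('a)"
    and "mv_iso elliott (Free n) e"
    and "closed_ideal I"
    and "afl_algebra TYPE('b)"
    and "mv_finitely_generated (elliott :: 'b K0 mv)"
    and "quotient_map_by h I"
  shows "\<forall>i\<in>{1,2,3,4}. \<forall>j\<in>{1,2,3,4}.
           polytime_reducible (problem i n (generator n e h)) (problem j n (generator n e h)) \<and>
           (polytime_decidable (problem i n (generator n e h)) \<longleftrightarrow>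
            polytime_decidable (problem j n (generator n e h)))"
proof -
  have "star_hom h" using assms(7) by (simp add: quotient_map_by_def)
  then have generators: "generator n e h j \<in> mvcarrier elliott" if "j < n" for j
    using generator_elliott[OF assms(3) _ that] by blast
  have reducible: "polytime_reducible (problem i n (generator n e h)) (problem j n (generator n e h))"
    if "i \<in> {1, 2, 3, 4}" "j \<in> {1, 2, 3, 4}" for i j
    by (rule polytime_reducible_problems[OF assms(5) _ that]) (rule generators)
  show ?thesis
  proof (intro ballI conjI iffI)
    fix i j :: nat assume ij: "i \<in> {1, 2, 3, 4}" "j \<in> {1, 2, 3, 4}"
    show "polytime_reducible (problem i n (generator n e h)) (problem j n (generator n e h))"
      by (rule reducible[OF ij])
    show "polytime_decidable (problem j n (generator n e h))"
      if "polytime_decidable (problem i n (generator n e h))"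
      \<comment> \<open>Decidability passes from the target of a reduction to its source, so this
        direction uses the reduction from \<open>j\<close> to \<open>i\<close>.\<close>
      by (rule polytime_decidable_reducible[OF reducible[OF ij(2,1)] that])
    show "polytime_decidable (problem i n (generator n e h))"
      if "polytime_decidable (problem j n (generator n e h))"
      by (rule polytime_decidable_reducible[OF reducible[OF ij] that])
  qed
qed

end
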